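(* Let $\alpha,\alpha_M>0$ and let $v^{in},Z^{in}\in V'$ (equivalently, $u^{in},\mathcal B^{in}\in V$, where $v^{in}=(\alpha^2A+I)u^{in}$ and $Z^{in}=(\alpha_M^2A+I)\mathcal B^{in}$). Then the system $$\frac{\partial}{\partial t}\begin{pmatrix}v\\ Z\end{pmatrix}=\begin{pmatrix}B(\mathcal B,\mathcal B)-B(u,u)\\ B(\mathcal B,u)-B(u,\mathcal B)\end{pmatrix},\qquad \begin{pmatrix}v(0)\\ Z(0)\end{pmatrix}=\begin{pmatrix}v^{in}\\ Z^{in}\end{pmatrix},$$ where $v=(\alpha^2A+I)u$ and $Z=(\alpha_M^2A+I)\mathcal B$, has a unique solution $(v,Z)\in C^1((-\infty,\infty),V')$ (equivalently, $(u,\mathcal B)\in C^1((-\infty,\infty),V)$).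
   Context: $\mathbb T^3=[0,1]^3$ is the periodic unit torus. $\mathcal V$ is the set of $\mathbb R^3$-valued trigonometric polynomials $\varphi$ on $\mathbb T^3$ with $\nabla\cdot\varphi=0$ and $\int_{\mathbb T^3}\varphi\,dx=0$. $H$ and $V$ are the closures of $\mathcal V$ in $L^2(\mathbb T^3)$ and $H^1(\mathbb T^3)$, respectively, and $V'$ is the dual of $V$. $P_\sigma:L^2\to H$ is the Leray-Helmholtz (orthogonal) projection, and $A=-P_\sigma\triangle$ is the Stokes operator (here $A=-\triangle$), extended to a bounded operator $V\to V'$; $\alpha^2A+I$ and $\alpha_M^2A+I$ are isomorphisms $V\to V'$. $B(w_1,w_2)=P_\sigma((w_1\cdot\nabla)w_2)$ for $w_1,w_2\in\mathcal V$, extended to a continuous bilinear map $B:V\times V\to V'$. $(v,Z)\in C^1((-\infty,\infty),V')$ means that both components lie in that space, and similarly for $(u,\mathcal B)$. The system is the functional form of the inviscid, irresistive MHD-Voigt system $-\alpha^2\partial_t\triangle u+\partial_tu+(u\cdot\nabla)u+\nabla p+\frac12\nabla|\mathcal B|^2=(\mathcal B\cdot\nabla)\mathcal B$, $-\alpha_M^2\partial_t\triangle\mathcal B+\partial_t\mathcal B+(u\cdot\nabla)\mathcal B-(\mathcal B\cdot\nabla)u+\nabla q=0$, $\nabla\cdot\mathcal B=\nabla\cdot u=0$, with periodic boundary conditions and mean-zero $u,\mathcal B$. *)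

theory Defs
  imports "HOL-Analysis.Analysis"
begin

section \<open>The space \<open>L\<^sup>2\<close> of vector fields on the torus\<close>

text \<open>
  A function on the torus is represented by a function on \<open>real^3\<close>, of which only the values on the
  fundamental cell \<open>[0,1]\<^sup>3\<close> matter for integration; where smoothness on the torus is meant,
  periodicity is required explicitly.
\<close>

definition torus :: "(real^3) measure"
  where "torus = lebesgue_on (cbox 0 1)"

definition square_integrable :: "(real^3 \<Rightarrow> real^3) \<Rightarrow> bool"
  where "square_integrable f \<longleftrightarrow>
    f \<in> borel_measurable torus \<and> integrable torus (\<lambda>x. (norm (f x))\<^sup>2)"

lemma square_integrable_inner:
  assumes "square_integrable f" "square_integrable g"
  shows "integrable torus (\<lambda>x. f x \<bullet> g x)"
proof (rule Bochner_Integration.integrable_bound)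
  show "integrable torus (\<lambda>x. (norm (f x))\<^sup>2 + (norm (g x))\<^sup>2)"
    using assms by (auto simp: square_integrable_def)
  show "(\<lambda>x. f x \<bullet> g x) \<in> borel_measurable torus"
    using assms by (auto simp: square_integrable_def)
  have "\<bar>f x \<bullet> g x\<bar> \<le> (norm (f x))\<^sup>2 + (norm (g x))\<^sup>2" for x
  proof -
    have "\<bar>f x \<bullet> g x\<bar> \<le> norm (f x) * norm (g x)" by (rule Cauchy_Schwarz_ineq2)
    also have "\<dots> \<le> (norm (f x))\<^sup>2 + (norm (g x))\<^sup>2"
      using sum_squares_bound[of "norm (f x)" "norm (g x)"]
        mult_nonneg_nonneg[OF norm_ge_zero[of "f x"] norm_ge_zero[of "g x"]] by linarith
    finally show ?thesis .
  qed
  then show "AE x in torus. norm (f x \<bullet> g x) \<le> norm ((norm (f x))\<^sup>2 + (norm (g x))\<^sup>2)"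
    by (intro always_eventually allI) simp
qed

lemma square_integrable_zero: "square_integrable (\<lambda>x. 0)"
  by (simp add: square_integrable_def)

lemma square_integrable_add:
  assumes "square_integrable f" "square_integrable g"
  shows "square_integrable (\<lambda>x. f x + g x)"
proof -
  have "integrable torus (\<lambda>x. (norm (f x))\<^sup>2 + 2 * (f x \<bullet> g x) + (norm (g x))\<^sup>2)"
    using assms square_integrable_inner[OF assms] by (auto simp: square_integrable_def)
  moreover have "(norm (f x + g x))\<^sup>2 = (norm (f x))\<^sup>2 + 2 * (f x \<bullet> g x) + (norm (g x))\<^sup>2" for x
    by (simp add: power2_norm_eq_inner inner_add_left inner_add_right inner_commute)
  ultimately show ?thesis using assms by (auto simp: square_integrable_def)
qed

lemma square_integrable_scaleR:
  assumes "square_integrable f"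
  shows "square_integrable (\<lambda>x. r *\<^sub>R f x)"
  using assms by (auto simp: square_integrable_def power_mult_distrib)

definition L2_eq :: "(real^3 \<Rightarrow> real^3) \<Rightarrow> (real^3 \<Rightarrow> real^3) \<Rightarrow> bool"
  where "L2_eq f g \<longleftrightarrow>
    square_integrable f \<and> square_integrable g \<and> (AE x in torus. f x = g x)"

quotient_type L2 = "real^3 \<Rightarrow> real^3" / partial: L2_eq
  morphisms rep_L2 L2_of
proof (rule part_equivpI)
  show "\<exists>f. L2_eq f f"
    by (rule exI[of _ "\<lambda>x. 0"]) (simp add: L2_eq_def square_integrable_zero)
  show "symp L2_eq"
    by (rule sympI) (auto simp: L2_eq_def)
  show "transp L2_eq"
    by (rule transpI) (auto simp: L2_eq_def)
qed

instantiation L2 :: real_inner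
begin

lift_definition zero_L2 :: L2 is "\<lambda>x. 0"
  by (simp add: L2_eq_def square_integrable_zero)

lift_definition plus_L2 :: "L2 \<Rightarrow> L2 \<Rightarrow> L2" is "\<lambda>f g x. f x + g x"
  by (auto simp: L2_eq_def square_integrable_add)

lift_definition scaleR_L2 :: "real \<Rightarrow> L2 \<Rightarrow> L2" is "\<lambda>r f x. r *\<^sub>R f x"
  by (auto simp: L2_eq_def square_integrable_scaleR)

definition uminus_L2 :: "L2 \<Rightarrow> L2"
  where "uminus_L2 f = (-1) *\<^sub>R f"

definition minus_L2 :: "L2 \<Rightarrow> L2 \<Rightarrow> L2"
  where "minus_L2 f g = f + (-1) *\<^sub>R g"

lift_definition inner_L2 :: "L2 \<Rightarrow> L2 \<Rightarrow> real" is "\<lambda>f g. \<integral>x. f x \<bullet> g x \<partial>torus"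
proof -
  fix f f' g g' assume *: "L2_eq f f'" "L2_eq g g'"
  then have "AE x in torus. f x \<bullet> g x = f' x \<bullet> g' x" by (auto simp: L2_eq_def)
  with * show "(\<integral>x. f x \<bullet> g x \<partial>torus) = (\<integral>x. f' x \<bullet> g' x \<partial>torus)"
    by (intro integral_cong_AE) (auto simp: L2_eq_def square_integrable_def)
qed

definition norm_L2 :: "L2 \<Rightarrow> real"
  where "norm_L2 f = sqrt (f \<bullet> f)"

definition sgn_L2 :: "L2 \<Rightarrow> L2"
  where "sgn_L2 f = inverse (norm f) *\<^sub>R f"

definition dist_L2 :: "L2 \<Rightarrow> L2 \<Rightarrow> real"
  where "dist_L2 f g = norm (f - g)"

definition uniformity_L2 :: "(L2 \<times> L2) filter"
  where "uniformity_L2 = (INF e\<in>{0<..}. principal {(f, g). dist f g < e})"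

definition open_L2 :: "L2 set \<Rightarrow> bool"
  where "open_L2 U \<longleftrightarrow> (\<forall>f\<in>U. \<forall>\<^sub>F (f', g) in uniformity. f' = f \<longrightarrow> g \<in> U)"

instance
proof
  fix f g h :: L2 and r s :: real
  show "f + g + h = f + (g + h)"
    by transfer (auto simp: L2_eq_def square_integrable_add add.assoc)
  show "f + g = g + f"
    by transfer (auto simp: L2_eq_def square_integrable_add add.commute)
  show "0 + f = f"
    by transfer (auto simp: L2_eq_def)
  show "- f + f = 0"
    unfolding uminus_L2_def
    by transfer (auto simp: L2_eq_def square_integrable_add square_integrable_scaleR square_integrable_zero)
  show "f - g = f + - g"
    by (simp add: uminus_L2_def minus_L2_def)
  show "r *\<^sub>R (f + g) = r *\<^sub>R f + r *\<^sub>R g"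
    by transfer (auto simp: L2_eq_def square_integrable_add square_integrable_scaleR scaleR_add_right)
  show "(r + s) *\<^sub>R f = r *\<^sub>R f + s *\<^sub>R f"
    by transfer (auto simp: L2_eq_def square_integrable_add square_integrable_scaleR scaleR_add_left)
  show "r *\<^sub>R s *\<^sub>R f = (r * s) *\<^sub>R f"
    by transfer (auto simp: L2_eq_def square_integrable_scaleR)
  show "1 *\<^sub>R f = f"
    by transfer (auto simp: L2_eq_def)
  show "dist f g = norm (f - g)" by (rule dist_L2_def)
  show "sgn f = inverse (norm f) *\<^sub>R f" by (rule sgn_L2_def)
  show "(uniformity :: (L2 \<times> L2) filter) = (INF e\<in>{0<..}. principal {(f, g). dist f g < e})"
    by (rule uniformity_L2_def)
  show "open U \<longleftrightarrow> (\<forall>f\<in>U. \<forall>\<^sub>F (f', g) in uniformity. f' = f \<longrightarrow> g \<in> U)" for U :: "L2 set"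
    by (rule open_L2_def)
  show "f \<bullet> g = g \<bullet> f"
    by transfer (simp add: inner_commute)
  show "(f + g) \<bullet> h = f \<bullet> h + g \<bullet> h"
    by transfer (auto simp: L2_eq_def inner_add_left square_integrable_inner)
  show "r *\<^sub>R f \<bullet> g = r * (f \<bullet> g)"
    by transfer (auto simp: L2_eq_def)
  show "0 \<le> f \<bullet> f"
    by transfer (auto intro!: integral_nonneg_AE)
  show "f \<bullet> f = 0 \<longleftrightarrow> f = 0"
  proof transfer
    fix f assume "L2_eq f f"
    then have f: "square_integrable f" by (simp add: L2_eq_def)
    have "(\<integral>x. f x \<bullet> f x \<partial>torus) = 0 \<longleftrightarrow> (AE x in torus. f x \<bullet> f x = 0)"
      by (rule integral_nonneg_eq_0_iff_AE) (auto intro: square_integrable_inner f)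
    then show "(\<integral>x. f x \<bullet> f x \<partial>torus) = 0 \<longleftrightarrow> L2_eq f (\<lambda>x. 0)"
      using f by (simp add: L2_eq_def square_integrable_zero)
  qed
  show "norm f = sqrt (f \<bullet> f)" by (rule norm_L2_def)
qed

end

lemma L2_of_add:
  "square_integrable f \<Longrightarrow> square_integrable g \<Longrightarrow> L2_of (\<lambda>x. f x + g x) = L2_of f + L2_of g"
  by (simp add: plus_L2.abs_eq L2_eq_def)

lemma L2_of_scaleR:
  "square_integrable f \<Longrightarrow> L2_of (\<lambda>x. r *\<^sub>R f x) = r *\<^sub>R L2_of f"
  by (simp add: scaleR_L2.abs_eq L2_eq_def)

lemma inner_L2_of:
  "square_integrable f \<Longrightarrow> square_integrable g \<Longrightarrow> L2_of f \<bullet> L2_of g = (\<integral>x. f x \<bullet> g x \<partial>torus)"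
  by (simp add: inner_L2.abs_eq L2_eq_def)


section \<open>Differential operators and solenoidal trigonometric polynomials\<close>

definition partial :: "3 \<Rightarrow> (real^3 \<Rightarrow> real^3) \<Rightarrow> real^3 \<Rightarrow> real^3"
  where "partial i f x = frechet_derivative f (at x) (axis i 1)"

definition divergence :: "(real^3 \<Rightarrow> real^3) \<Rightarrow> real^3 \<Rightarrow> real"
  where "divergence f x = (\<Sum>i\<in>UNIV. partial i f x $ i)"

definition laplacian :: "(real^3 \<Rightarrow> real^3) \<Rightarrow> real^3 \<Rightarrow> real^3"
  where "laplacian f x = (\<Sum>i\<in>UNIV. partial i (partial i f) x)"

text \<open>\<open>convect w f\<close> is \<open>(w \<cdot> \<nabla>) f\<close>.\<close>

definition convect :: "(real^3 \<Rightarrow> real^3) \<Rightarrow> (real^3 \<Rightarrow> real^3) \<Rightarrow> real^3 \<Rightarrow> real^3"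
  where "convect w f x = (\<Sum>i\<in>UNIV. (w x $ i) *\<^sub>R partial i f x)"

definition phase :: "int^3 \<Rightarrow> real^3 \<Rightarrow> real"
  where "phase k x = 2 * pi * (\<Sum>i\<in>UNIV. of_int (k $ i) * x $ i)"

definition trig_sum :: "(int^3) set \<Rightarrow> (int^3 \<Rightarrow> real^3) \<Rightarrow> (int^3 \<Rightarrow> real^3) \<Rightarrow> real^3 \<Rightarrow> real^3"
  where "trig_sum K a b x = (\<Sum>k\<in>K. cos (phase k x) *\<^sub>R a k + sin (phase k x) *\<^sub>R b k)"

definition trig_poly :: "(real^3 \<Rightarrow> real^3) \<Rightarrow> bool"
  where "trig_poly \<phi> \<longleftrightarrow> (\<exists>K a b. finite K \<and> \<phi> = trig_sum K a b)"

definition calV :: "(real^3 \<Rightarrow> real^3) set"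
  where "calV = {\<phi>. trig_poly \<phi> \<and> (\<forall>x. divergence \<phi> x = 0) \<and> (\<integral>x. \<phi> x \<partial>torus) = 0}"

lemma trig_sum_has_derivative:
  "(trig_sum K a b has_derivative
     (\<lambda>h. \<Sum>k\<in>K. - (phase k h * sin (phase k x)) *\<^sub>R a k + (phase k h * cos (phase k x)) *\<^sub>R b k))
     (at x)"
proof -
  have p: "(phase k has_derivative phase k) (at x)" for k
    unfolding phase_def[abs_def]
    by (intro has_derivative_mult_right has_derivative_sum
        bounded_linear_imp_has_derivative[OF bounded_linear_vec_nth])
  have c: "((\<lambda>x. cos (phase k x)) has_derivative (\<lambda>h. - (phase k h * sin (phase k x)))) (at x)" for k
    by (rule has_derivative_eq_rhs[OF has_derivative_cos[OF p]]) (auto simp: algebra_simps)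
  have s: "((\<lambda>x. sin (phase k x)) has_derivative (\<lambda>h. phase k h * cos (phase k x))) (at x)" for k
    by (rule has_derivative_eq_rhs[OF has_derivative_sin[OF p]]) (auto simp: algebra_simps)
  show ?thesis
    unfolding trig_sum_def[abs_def]
    by (intro has_derivative_sum has_derivative_add has_derivative_scaleR_left c s)
qed

lemma partial_trig_sum:
  "partial i (trig_sum K a b) =
     trig_sum K (\<lambda>k. (2 * pi * of_int (k $ i)) *\<^sub>R b k) (\<lambda>k. - (2 * pi * of_int (k $ i)) *\<^sub>R a k)"
proof
  fix x
  have "phase k (axis i 1) = 2 * pi * of_int (k $ i)" for k
    by (simp add: phase_def axis_def if_distrib cong: if_cong)
  then show "partial i (trig_sum K a b) x =
     trig_sum K (\<lambda>k. (2 * pi * of_int (k $ i)) *\<^sub>R b k) (\<lambda>k. - (2 * pi * of_int (k $ i)) *\<^sub>R a k) x"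
    unfolding partial_def frechet_derivative_at[OF trig_sum_has_derivative, symmetric]
    by (simp add: trig_sum_def mult.commute)
qed

lemma trig_poly_differentiable: "trig_poly \<phi> \<Longrightarrow> \<phi> differentiable (at x)"
  unfolding trig_poly_def differentiable_def using trig_sum_has_derivative by blast

lemma trig_poly_continuous: "trig_poly \<phi> \<Longrightarrow> continuous_on S \<phi>"
  by (intro continuous_at_imp_continuous_on ballI differentiable_imp_continuous_within
      trig_poly_differentiable)

lemma trig_poly_partial: "trig_poly \<phi> \<Longrightarrow> trig_poly (partial i \<phi>)"
  unfolding trig_poly_def using partial_trig_sum by blast

lemma trig_poly_square_integrable:
  assumes "trig_poly \<phi>"
  shows "square_integrable \<phi>" "integrable torus \<phi>"
proof -
  note c = trig_poly_continuous[OF assms, of "cbox 0 1"]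
  have I: "integrable torus g" if "continuous_on (cbox 0 1) g" for g :: "real^3 \<Rightarrow> 'a::euclidean_space"
    unfolding torus_def by (rule continuous_imp_integrable[OF that])
  show "integrable torus \<phi>" by (rule I[OF c])
  then have "\<phi> \<in> borel_measurable torus" by (rule borel_measurable_integrable)
  moreover have "integrable torus (\<lambda>x. (norm (\<phi> x))\<^sup>2)"
    by (rule I) (intro continuous_intros c)
  ultimately show "square_integrable \<phi>" by (simp add: square_integrable_def)
qed

lemma trig_poly_zero: "trig_poly (\<lambda>x. 0)"
  unfolding trig_poly_def by (intro exI[of _ "{}"]) (auto simp: trig_sum_def[abs_def])

lemma trig_poly_add:
  assumes "trig_poly \<phi>" "trig_poly \<psi>"
  shows "trig_poly (\<lambda>x. \<phi> x + \<psi> x)"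
proof -
  obtain K a b where 1: "finite K" "\<phi> = trig_sum K a b" using assms(1) by (auto simp: trig_poly_def)
  obtain L c d where 2: "finite L" "\<psi> = trig_sum L c d" using assms(2) by (auto simp: trig_poly_def)
  have extend: "trig_sum M p q x =
      trig_sum (K \<union> L) (\<lambda>k. if k \<in> M then p k else 0) (\<lambda>k. if k \<in> M then q k else 0) x"
    if "M \<subseteq> K \<union> L" for M p q x
    unfolding trig_sum_def using that 1 2 by (intro sum.mono_neutral_cong_left) auto
  have "(\<lambda>x. \<phi> x + \<psi> x) = trig_sum (K \<union> L)
      (\<lambda>k. (if k \<in> K then a k else 0) + (if k \<in> L then c k else 0))
      (\<lambda>k. (if k \<in> K then b k else 0) + (if k \<in> L then d k else 0))"
    unfolding 1(2) 2(2) extend[of K, OF Un_upper1] extend[of L, OF Un_upper2]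
    unfolding trig_sum_def[abs_def] sum.distrib[symmetric]
    by (intro ext sum.cong refl) (simp only: scaleR_add_right ac_simps)
  with 1(1) 2(1) show ?thesis unfolding trig_poly_def by blast
qed

lemma trig_poly_scaleR:
  assumes "trig_poly \<phi>"
  shows "trig_poly (\<lambda>x. r *\<^sub>R \<phi> x)"
proof -
  obtain K a b where K: "finite K" "\<phi> = trig_sum K a b" using assms by (auto simp: trig_poly_def)
  have "(\<lambda>x. r *\<^sub>R \<phi> x) = trig_sum K (\<lambda>k. r *\<^sub>R a k) (\<lambda>k. r *\<^sub>R b k)"
    unfolding K(2) trig_sum_def scaleR_sum_right
    by (intro ext sum.cong refl) (simp add: scaleR_add_right mult.commute)
  with K(1) show ?thesis unfolding trig_poly_def by blast
qed

lemma partial_add: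
  assumes "trig_poly \<phi>" "trig_poly \<psi>"
  shows "partial i (\<lambda>x. \<phi> x + \<psi> x) = (\<lambda>x. partial i \<phi> x + partial i \<psi> x)"
proof
  fix x
  have "(\<phi> has_derivative frechet_derivative \<phi> (at x)) (at x)"
    "(\<psi> has_derivative frechet_derivative \<psi> (at x)) (at x)"
    using trig_poly_differentiable assms frechet_derivative_works by blast+
  from frechet_derivative_at[OF has_derivative_add[OF this]]
  show "partial i (\<lambda>x. \<phi> x + \<psi> x) x = partial i \<phi> x + partial i \<psi> x"
    unfolding partial_def by (rule fun_cong[OF sym])
qed

lemma partial_scaleR:
  assumes "trig_poly \<phi>"
  shows "partial i (\<lambda>x. r *\<^sub>R \<phi> x) = (\<lambda>x. r *\<^sub>R partial i \<phi> x)"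
proof
  fix x
  have "(\<phi> has_derivative frechet_derivative \<phi> (at x)) (at x)"
    using trig_poly_differentiable[OF assms] frechet_derivative_works by blast
  from frechet_derivative_at[OF has_derivative_scaleR_right[OF this, of r]]
  show "partial i (\<lambda>x. r *\<^sub>R \<phi> x) x = r *\<^sub>R partial i \<phi> x"
    unfolding partial_def by (rule fun_cong[OF sym])
qed

lemma calV_zero: "(\<lambda>x. 0) \<in> calV"
  by (auto simp: calV_def trig_poly_zero divergence_def partial_def)

lemma calV_add: "\<phi> \<in> calV \<Longrightarrow> \<psi> \<in> calV \<Longrightarrow> (\<lambda>x. \<phi> x + \<psi> x) \<in> calV"
  by (auto simp: calV_def trig_poly_add divergence_def partial_add sum.distrib
      trig_poly_square_integrable(2))

lemma calV_scaleR: "\<phi> \<in> calV \<Longrightarrow> (\<lambda>x. r *\<^sub>R \<phi> x) \<in> calV"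
  by (auto simp: calV_def trig_poly_scaleR divergence_def partial_scaleR sum_distrib_left[symmetric])


section \<open>The spaces \<open>H\<close> and \<open>V\<close>\<close>

definition H :: "L2 set"
  where "H = closure (L2_of ` calV)"

text \<open>Test functions on the torus: periodic functions all of whose iterated partial derivatives are
  (Frechet) differentiable everywhere.\<close>

definition torus_test_function :: "(real^3 \<Rightarrow> real^3) \<Rightarrow> bool"
  where "torus_test_function \<psi> \<longleftrightarrow>
    (\<forall>i x. \<psi> (x + axis i 1) = \<psi> x) \<and> (\<forall>is x. foldr partial is \<psi> differentiable (at x))"

definition weak_partial :: "3 \<Rightarrow> L2 \<Rightarrow> L2 \<Rightarrow> bool"
  where "weak_partial i u g \<longleftrightarrow>
    (\<forall>\<psi>. torus_test_function \<psi> \<longrightarrow> u \<bullet> L2_of (partial i \<psi>) = - (g \<bullet> L2_of \<psi>))"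

text \<open>An element of \<open>H\<^sup>1\<close> is carried together with its (uniquely determined) weak gradient
  \<open>(\<partial>\<^sub>1u, \<partial>\<^sub>2u, \<partial>\<^sub>3u)\<close>, so that the norm of \<open>L2 \<times> L2^3\<close> is exactly the \<open>H\<^sup>1\<close> norm
  \<open>(\<parallel>u\<parallel>\<^sup>2 + \<Sum>\<^sub>i \<parallel>\<partial>\<^sub>iu\<parallel>\<^sup>2)\<^sup>1\<^sup>/\<^sup>2\<close>.\<close>

definition H1 :: "(L2 \<times> (L2^3)) set"
  where "H1 = {(u, G). \<forall>i. weak_partial i u (G $ i)}"

definition H1_of :: "(real^3 \<Rightarrow> real^3) \<Rightarrow> L2 \<times> (L2^3)"
  where "H1_of \<phi> = (L2_of \<phi>, \<chi> i. L2_of (partial i \<phi>))"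

definition V_set :: "(L2 \<times> (L2^3)) set"
  where "V_set = H1 \<inter> closure (H1_of ` calV)"

lemma subspace_H1: "subspace H1"
  by (rule subspaceI)
    (auto simp: H1_def weak_partial_def inner_add_left zero_prod_def)

lemma H1_of_add:
  assumes "\<phi> \<in> calV" "\<psi> \<in> calV"
  shows "H1_of (\<lambda>x. \<phi> x + \<psi> x) = H1_of \<phi> + H1_of \<psi>"
  using assms
  by (auto simp: H1_of_def calV_def vec_eq_iff partial_add trig_poly_partial
      trig_poly_square_integrable(1) L2_of_add)

lemma H1_of_scaleR:
  assumes "\<phi> \<in> calV"
  shows "H1_of (\<lambda>x. r *\<^sub>R \<phi> x) = r *\<^sub>R H1_of \<phi>"
  using assms
  by (auto simp: H1_of_def calV_def vec_eq_iff partial_scaleR trig_poly_partial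
      trig_poly_square_integrable(1) L2_of_scaleR)

lemma subspace_V_set: "subspace V_set"
  unfolding V_set_def
proof (rule subspace_inter[OF subspace_H1])
  let ?S = "H1_of ` calV"
  have S1: "x + y \<in> ?S" if "x \<in> ?S" "y \<in> ?S" for x y
    using that by (auto simp: H1_of_add[symmetric] calV_add)
  have S2: "r *\<^sub>R x \<in> ?S" if "x \<in> ?S" for x r
    using that by (auto simp: H1_of_scaleR[symmetric] calV_scaleR)
  have "H1_of (\<lambda>x. 0) \<in> ?S" using calV_zero by blast
  from S2[OF this, of 0] have "0 \<in> ?S" by simp
  show "subspace (closure ?S)"
  proof (rule subspaceI)
    show "0 \<in> closure ?S" by (rule subsetD[OF closure_subset \<open>0 \<in> ?S\<close>])
  next
    fix x y assume "x \<in> closure ?S" "y \<in> closure ?S"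
    then obtain p q where p: "\<forall>n. p n \<in> ?S" "p \<longlonglongrightarrow> x" and q: "\<forall>n. q n \<in> ?S" "q \<longlonglongrightarrow> y"
      unfolding closure_sequential by blast
    have "\<forall>n. p n + q n \<in> ?S" by (intro allI S1) (use p(1) q(1) in simp_all)
    moreover have "(\<lambda>n. p n + q n) \<longlonglongrightarrow> x + y" by (rule tendsto_add[OF p(2) q(2)])
    ultimately show "x + y \<in> closure ?S"
      unfolding closure_sequential by (intro exI conjI)
  next
    fix c x assume "x \<in> closure ?S"
    then obtain p where p: "\<forall>n. p n \<in> ?S" "p \<longlonglongrightarrow> x"
      unfolding closure_sequential by blast
    have "\<forall>n. c *\<^sub>R p n \<in> ?S" by (intro allI S2) (use p(1) in simp_all)
    moreover have "(\<lambda>n. c *\<^sub>R p n) \<longlonglongrightarrow> c *\<^sub>R x" by (rule tendsto_scaleR[OF tendsto_const p(2)])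
    ultimately show "c *\<^sub>R x \<in> closure ?S"
      unfolding closure_sequential by (intro exI conjI)
  qed
qed

typedef V = V_set
  morphisms rep_V abs_V
  by (rule exI, rule subspace_0[OF subspace_V_set])

setup_lifting type_definition_V

instantiation V :: real_inner
begin

lift_definition zero_V :: V is 0
  by (rule subspace_0[OF subspace_V_set])

lift_definition plus_V :: "V \<Rightarrow> V \<Rightarrow> V" is "(+)"
  by (rule subspace_add[OF subspace_V_set])

lift_definition minus_V :: "V \<Rightarrow> V \<Rightarrow> V" is "(-)"
  by (rule subspace_diff[OF subspace_V_set])

lift_definition uminus_V :: "V \<Rightarrow> V" is uminus
  by (rule subspace_neg[OF subspace_V_set])

lift_definition scaleR_V :: "real \<Rightarrow> V \<Rightarrow> V" is "(*\<^sub>R)"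
  by (rule subspace_scale[OF subspace_V_set])

lift_definition inner_V :: "V \<Rightarrow> V \<Rightarrow> real" is "(\<bullet>)" .

lift_definition norm_V :: "V \<Rightarrow> real" is norm .

lift_definition dist_V :: "V \<Rightarrow> V \<Rightarrow> real" is dist .

definition sgn_V :: "V \<Rightarrow> V"
  where "sgn_V u = inverse (norm u) *\<^sub>R u"

definition uniformity_V :: "(V \<times> V) filter"
  where "uniformity_V = (INF e\<in>{0<..}. principal {(u, w). dist u w < e})"

definition open_V :: "V set \<Rightarrow> bool"
  where "open_V U \<longleftrightarrow> (\<forall>u\<in>U. \<forall>\<^sub>F (u', w) in uniformity. u' = u \<longrightarrow> w \<in> U)"

instance
proof
  fix u w z :: V and r s :: real
  show "u + w + z = u + (w + z)" by transfer (simp add: add.assoc)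
  show "u + w = w + u" by transfer (simp add: add.commute)
  show "0 + u = u" by transfer simp
  show "- u + u = 0" by transfer simp
  show "u - w = u + - w" by transfer simp
  show "r *\<^sub>R (u + w) = r *\<^sub>R u + r *\<^sub>R w" by transfer (simp add: scaleR_add_right)
  show "(r + s) *\<^sub>R u = r *\<^sub>R u + s *\<^sub>R u" by transfer (simp add: scaleR_add_left)
  show "r *\<^sub>R s *\<^sub>R u = (r * s) *\<^sub>R u" by transfer simp
  show "1 *\<^sub>R u = u" by transfer simp
  show "dist u w = norm (u - w)" by transfer (rule dist_norm)
  show "sgn u = inverse (norm u) *\<^sub>R u" by (rule sgn_V_def)
  show "(uniformity :: (V \<times> V) filter) = (INF e\<in>{0<..}. principal {(u, w). dist u w < e})"
    by (rule uniformity_V_def)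
  show "open U \<longleftrightarrow> (\<forall>u\<in>U. \<forall>\<^sub>F (u', w) in uniformity. u' = u \<longrightarrow> w \<in> U)" for U :: "V set"
    by (rule open_V_def)
  show "u \<bullet> w = w \<bullet> u" by transfer (rule inner_commute)
  show "(u + w) \<bullet> z = u \<bullet> z + w \<bullet> z" by transfer (rule inner_add_left)
  show "r *\<^sub>R u \<bullet> w = r * (u \<bullet> w)" by transfer simp
  show "0 \<le> u \<bullet> u" by transfer simp
  show "u \<bullet> u = 0 \<longleftrightarrow> u = 0" by transfer simp
  show "norm u = sqrt (u \<bullet> u)" by transfer (rule norm_eq_sqrt_inner)
qed

end

definition V_fun :: "V \<Rightarrow> L2"
  where "V_fun u = fst (rep_V u)"

text \<open>By integration by parts, \<open>H1_of \<phi>\<close> lies in \<open>H1\<close>, hence in \<open>V_set\<close>, for every \<open>\<phi>\<close> in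
  \<open>calV\<close>.\<close>

definition V_of :: "(real^3 \<Rightarrow> real^3) \<Rightarrow> V"
  where "V_of \<phi> = abs_V (H1_of \<phi>)"


section \<open>The operators \<open>P\<^sub>\<sigma>\<close>, \<open>A\<close> and \<open>B\<close>\<close>

type_synonym V_dual = "V \<Rightarrow>\<^sub>L real"

text \<open>The embedding \<open>L\<^sup>2 \<rightarrow> V'\<close> given by the \<open>L\<^sup>2\<close> pairing; on \<open>H\<close> it is the
  usual identification \<open>H \<subseteq> V'\<close> of the Gelfand triple \<open>V \<subseteq> H = H' \<subseteq> V'\<close>.\<close>

lift_definition L2_dual :: "L2 \<Rightarrow> V_dual" is "\<lambda>f w. f \<bullet> V_fun w"
proof
  fix f :: L2 and w z :: V and r :: real
  show "f \<bullet> V_fun (w + z) = f \<bullet> V_fun w + f \<bullet> V_fun z"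
    by (simp add: V_fun_def plus_V.rep_eq inner_add_right)
  show "f \<bullet> V_fun (r *\<^sub>R w) = r *\<^sub>R (f \<bullet> V_fun w)"
    by (simp add: V_fun_def scaleR_V.rep_eq)
  have "norm (f \<bullet> V_fun w) \<le> norm w * norm f" for w
  proof -
    have "norm (V_fun w) \<le> norm w"
      unfolding V_fun_def norm_V.rep_eq using norm_fst_le[of "fst (rep_V w)" "snd (rep_V w)"] by simp
    then have "norm f * norm (V_fun w) \<le> norm f * norm w"
      by (intro mult_left_mono) auto
    then show ?thesis
      using Cauchy_Schwarz_ineq2[of f "V_fun w"] by (simp add: mult.commute)
  qed
  then show "\<exists>K. \<forall>w. norm (f \<bullet> V_fun w) \<le> norm w * K" by blast
qed

definition leray :: "L2 \<Rightarrow> L2"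
  where "leray f = (THE h. h \<in> H \<and> (\<forall>g\<in>H. (f - h) \<bullet> g = 0))"

text \<open>\<open>A\<close> and \<open>B\<close> are the unique continuous extensions of the classical expressions from the dense
  subspace \<open>calV\<close> to \<open>V\<close>.\<close>

definition stokes :: "V \<Rightarrow> V_dual"
  where "stokes = (THE A. bounded_linear A \<and>
    (\<forall>\<phi>\<in>calV. A (V_of \<phi>) = L2_dual (- leray (L2_of (laplacian \<phi>)))))"

definition bilin :: "V \<Rightarrow> V \<Rightarrow> V_dual"
  where "bilin = (THE B. bounded_bilinear B \<and>
    (\<forall>\<phi>\<in>calV. \<forall>\<psi>\<in>calV. B (V_of \<phi>) (V_of \<psi>) = L2_dual (leray (L2_of (convect \<phi> \<psi>)))))"

text \<open>\<open>voigt \<alpha>\<close> is \<open>\<alpha>\<^sup>2 A + I : V \<rightarrow> V'\<close>.\<close>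

definition voigt :: "real \<Rightarrow> V \<Rightarrow> V_dual"
  where "voigt \<alpha> u = \<alpha>\<^sup>2 *\<^sub>R stokes u + L2_dual (V_fun u)"


section \<open>The MHD-Voigt system\<close>

text \<open>Relation between \<open>(v, Z)\<close> and \<open>(u, \<B>)\<close>; the magnetic field is written \<open>b\<close>.\<close>

definition voigt_related ::
    "real \<Rightarrow> real \<Rightarrow> (real \<Rightarrow> V_dual) \<Rightarrow> (real \<Rightarrow> V_dual) \<Rightarrow> (real \<Rightarrow> V) \<Rightarrow> (real \<Rightarrow> V) \<Rightarrow> bool"
  where "voigt_related \<alpha> \<alpha>\<^sub>M v Z u b \<longleftrightarrow>
    (\<forall>t. v t = voigt \<alpha> (u t) \<and> Z t = voigt \<alpha>\<^sub>M (b t))"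

definition mhd_voigt_system ::
    "V_dual \<Rightarrow> V_dual \<Rightarrow> (real \<Rightarrow> V_dual) \<Rightarrow> (real \<Rightarrow> V_dual) \<Rightarrow> (real \<Rightarrow> V) \<Rightarrow> (real \<Rightarrow> V) \<Rightarrow> bool"
  where "mhd_voigt_system v_in Z_in v Z u b \<longleftrightarrow>
    (\<forall>t. (v has_vector_derivative bilin (b t) (b t) - bilin (u t) (u t)) (at t)) \<and>
    (\<forall>t. (Z has_vector_derivative bilin (b t) (u t) - bilin (u t) (b t)) (at t)) \<and>
    v 0 = v_in \<and> Z 0 = Z_in"

end

theory Submission
  imports Defs
begin

text \<open>Applying the inverses of \<open>\<alpha>\<^sup>2 A + I\<close> and \<open>\<alpha>\<^sub>M\<^sup>2 A + I\<close> turns the system into the ordinary differential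
  equation \<open>x' = Q(x, x)\<close> for \<open>x = (u, b)\<close> in the Hilbert space \<open>V \<times> V\<close>. Here \<open>Q\<close> is bounded and
  bilinear: \<open>B\<close> maps \<open>V \<times> V\<close> into the larger space \<open>V'\<close>, and the inverse Voigt operators lead back
  from \<open>V'\<close> to \<open>V\<close> (\<open>voigt_inverse\<close>). Hence the right-hand side is locally Lipschitz, and only
  blow-up in finite time has to be excluded. The energy
  \<open>\<langle>(\<alpha>\<^sup>2 A + I) u, u\<rangle> + \<langle>(\<alpha>\<^sub>M\<^sup>2 A + I) b, b\<rangle>\<close> is equivalent to the squared norm, and it is conserved
  because \<open>\<langle>B(u, w), z\<rangle> = - \<langle>B(u, z), w\<rangle>\<close> (\<open>bilin_antisymmetric\<close>), which makes the four terms of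
  its time derivative cancel. For a quadratic field that conserves a coercive energy,
  \<open>conservative_quadratic_ODE\<close> gives a unique global solution: composing the field with the
  radial retraction onto a large ball makes it bounded and globally Lipschitz without destroying
  the conservation law, so that solutions never leave the ball, where the field is the original one.

  The analytic core is the continuity of \<open>B\<close> on \<open>V \<times> V\<close>. It rests on the estimate
  \<open>\<parallel>\<phi>\<^sub>i w\<^sub>j\<parallel> \<le> C \<parallel>\<nabla>\<phi>\<parallel> \<parallel>\<nabla>w\<parallel>\<close> in \<open>L\<^sup>2\<close> (\<open>product_estimate\<close>), which takes the place of the
  Sobolev embedding of \<open>H\<^sup>1\<close> into \<open>L\<^sup>4\<close>. For trigonometric polynomials without mean it is a weighted
  Cauchy-Schwarz inequality for the convolution of Fourier coefficients, and the constant is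
  governed by the sum of \<open>1 / \<bar>k\<bar>\<^sup>4\<close> over the nonzero points of the lattice, finite in three dimensions. The
  trilinear form is then extended from \<open>calV\<close> to \<open>V\<close> by density.

  Behind all this stand the completeness of \<open>L\<^sup>2\<close>, and hence of \<open>H\<close> and \<open>V\<close>, and integration by
  parts on the torus. The latter places \<open>calV\<close> inside \<open>V\<close>, identifies \<open>A\<close> with the Dirichlet
  form, and yields the antisymmetry of \<open>B\<close>. The Leray projection never has to be computed: it
  disappears in every pairing with an element of \<open>V\<close> (\<open>L2_dual_leray\<close>).\<close>

section \<open>Variational problems and extension by density\<close>

text \<open>The quadratic functional \<open>J(u) = a(u, u) - 2 F(u)\<close> is minimised over \<open>S\<close>. By the parallelogram
  identity for \<open>a\<close> a minimising sequence is Cauchy, and the equation says that \<open>J\<close> is stationary at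
  its limit. With the inner product for \<open>a\<close> this is the orthogonal projection onto \<open>S\<close>; with
  the form of \<open>\<alpha>\<^sup>2 A + I\<close> and \<open>S = V\<close> it is the solvability of the Voigt equation.\<close>

lemma symmetric_Lax_Milgram:
  fixes a :: "'a::real_normed_vector \<Rightarrow> 'a \<Rightarrow> real"
  assumes a: "bounded_bilinear a" and sym: "\<And>x y. a x y = a y x"
    and c: "c > 0" and coercive: "\<And>x. c * (norm x)\<^sup>2 \<le> a x x"
    and S: "subspace S" "complete S" and F: "bounded_linear F"
  shows "\<exists>u\<in>S. \<forall>w\<in>S. a u w = F w"
proof -
  interpret a: bounded_bilinear a by fact
  interpret F: bounded_linear F by fact
  define J where "J u = a u u - 2 * F u" for u
  obtain K where K: "\<And>x. norm (F x) \<le> norm x * K" using F.bounded by blast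
  have J_ge: "J u \<ge> - (K\<^sup>2 / c)" for u
  proof -
    have "0 \<le> (c * norm u - K)\<^sup>2 / c" using c by simp
    also have "\<dots> = c * (norm u)\<^sup>2 - 2 * (norm u * K) + K\<^sup>2 / c"
      using c by (simp add: field_simps power2_eq_square)
    also have "\<dots> \<le> J u + K\<^sup>2 / c"
      using coercive[of u] K[of u] by (simp add: J_def)
    finally show ?thesis by simp
  qed
  have bdd: "bdd_below (J ` S)" using J_ge by (auto intro!: bdd_belowI2)
  have ne: "J ` S \<noteq> {}" using subspace_0[OF S(1)] by auto
  define m where "m = Inf (J ` S)"
  have m_le: "m \<le> J u" if "u \<in> S" for u
    unfolding m_def using that by (intro cInf_lower bdd) auto
  have "\<exists>u\<in>S. J u < m + 1 / Suc n" for n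
    using cInf_lessD[OF ne, of "m + 1 / Suc n"] by (auto simp: m_def)
  then obtain u where u: "\<And>n. u n \<in> S" "\<And>n. J (u n) < m + 1 / Suc n" by metis
  have d: "c * (norm (u n - u k))\<^sup>2 \<le> 2 / Suc n + 2 / Suc k" for n k
  proof -
    let ?mid = "(1/2) *\<^sub>R (u n + u k)"
    have mid: "?mid \<in> S" using u(1) S(1) by (intro subspace_scale subspace_add) auto
    have "a (u n - u k) (u n - u k) = 2 * J (u n) + 2 * J (u k) - 4 * J ?mid"
      by (simp add: J_def a.add_left a.add_right a.diff_left a.diff_right a.scaleR_left
          a.scaleR_right F.add F.scaleR sym[of "u k" "u n"] algebra_simps)
    with coercive[of "u n - u k"] m_le[OF mid] u(2)[of n] u(2)[of k]
    show ?thesis by simp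
  qed
  have "Cauchy u"
  proof (rule metric_CauchyI)
    fix e :: real assume e: "e > 0"
    obtain N where N: "4 / (c * e\<^sup>2) < real N" using reals_Archimedean2 by blast
    have "dist (u n) (u k) < e" if "n \<ge> N" "k \<ge> N" for n k
    proof -
      have "0 < c * e\<^sup>2" using c e by simp
      then have "0 < 4 / (c * e\<^sup>2)" "4 < real N * (c * e\<^sup>2)"
        using N by (simp_all add: pos_divide_less_eq)
      then have N0: "4 < real N * (c * e\<^sup>2)" "real N > 0" using N by linarith+
      have "2 / Suc n \<le> 2 / real N" "2 / Suc k \<le> 2 / real N"
        using that N0 by (intro divide_left_mono; simp)+
      then have "c * (norm (u n - u k))\<^sup>2 \<le> 4 / real N" using d[of n k] by simp
      also have "\<dots> < c * e\<^sup>2" using N0 by (simp add: field_simps)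
      finally have "(norm (u n - u k))\<^sup>2 < e\<^sup>2" using c by simp
      then show ?thesis unfolding dist_norm using e by (simp add: power2_less_imp_less)
    qed
    then show "\<exists>M. \<forall>m\<ge>M. \<forall>n\<ge>M. dist (u m) (u n) < e" by blast
  qed
  then obtain l where l: "l \<in> S" "u \<longlonglongrightarrow> l" using S(2) u(1) unfolding complete_def by blast
  have "(\<lambda>n. J (u n)) \<longlonglongrightarrow> J l"
    unfolding J_def by (intro tendsto_intros a.tendsto F.tendsto l)
  moreover have "(\<lambda>n. m + 1 / Suc n) \<longlonglongrightarrow> m + 0"
    by (intro tendsto_intros LIMSEQ_Suc lim_1_over_n)
  ultimately have Jl: "J l \<le> m"
    using u(2) by (intro LIMSEQ_le[where X = "\<lambda>n. J (u n)"]) (auto intro: less_imp_le)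
  have "a l w = F w" if w: "w \<in> S" for w
  proof -
    define p where "p = a l w - F w"
    have ineq: "0 \<le> 2 * t * p + t\<^sup>2 * a w w" for t
    proof -
      have "l + t *\<^sub>R w \<in> S" using l w S by (intro subspace_add subspace_scale) auto
      from m_le[OF this] Jl have "0 \<le> J (l + t *\<^sub>R w) - J l" by simp
      also have "\<dots> = 2 * t * p + t\<^sup>2 * a w w"
        by (simp add: J_def p_def a.add_left a.add_right a.scaleR_left
          a.scaleR_right F.add F.scaleR sym[of w l] algebra_simps power2_eq_square)
      finally show ?thesis .
    qed
    \<comment> \<open>The polynomial in \<open>t\<close> is evaluated near its minimum; the summand 1 keeps \<open>q\<close> positive when \<open>w = 0\<close>.\<close>
    define q where "q = a w w + 1"
    have q: "q > 0" using coercive[of w] c unfolding q_def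
      by (smt (verit) mult_nonneg_nonneg zero_le_power2)
    define s where "s = p / q"
    have "p = s * q" "a w w = q - 1" using q by (simp_all add: s_def q_def)
    with ineq[of "- s"] have "0 \<le> - (s\<^sup>2 * (q + 1))"
      by (simp add: power2_eq_square algebra_simps)
    then have "s = 0" using q by (simp add: mult_le_0_iff)
    then have "p = 0" using q by (simp add: s_def)
    then show ?thesis by (simp add: p_def)
  qed
  with l(1) show ?thesis by blast
qed

text \<open>Describing the map on the dense subspace by its graph spares a separate proof that it is well
  defined: by linearity the bound makes the relation single-valued. This suits the maps below,
  which are given in terms of a function \<open>\<phi>\<close> and not of the point of \<open>V\<close> that it represents.\<close>

lemma bounded_linear_extension_from_dense_graph:
  fixes R :: "('a::real_normed_vector \<times> 'b::banach) set"
  assumes R: "subspace R" and dense: "closure (fst ` R) = UNIV"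
    and bound: "\<And>x y. (x, y) \<in> R \<Longrightarrow> norm y \<le> K * norm x"
  shows "\<exists>g. bounded_linear g \<and> (\<forall>(x, y)\<in>R. g x = y)"
proof -
  define D where "D = fst ` R"
  have unique: "y = y'" if "(x, y) \<in> R" "(x, y') \<in> R" for x y y'
    using bound[of 0 "y - y'"] subspace_diff[OF R that] by simp
  define f where "f x = (THE y. (x, y) \<in> R)" for x
  have f_eq: "f x = y" if "(x, y) \<in> R" for x y
    unfolding f_def using that unique by blast
  have f_in: "(x, f x) \<in> R" if "x \<in> D" for x
    using that f_eq by (auto simp: D_def)
  have Lip: "norm (f x - f y) \<le> K * norm (x - y)" if "x \<in> D" "y \<in> D" for x y
    using bound[of "x - y" "f x - f y"] subspace_diff[OF R f_in[OF that(1)] f_in[OF that(2)]] by simp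
  define L where "L = max K 1"
  have LipL: "dist (f x) (f y) \<le> L * dist x y" if "x \<in> D" "y \<in> D" for x y
  proof -
    have "K * norm (x - y) \<le> L * norm (x - y)" unfolding L_def by (intro mult_right_mono) auto
    with Lip[OF that] show ?thesis by (simp add: dist_norm)
  qed
  have "L-lipschitz_on D f" using LipL by (auto simp: lipschitz_on_def L_def)
  then have "uniformly_continuous_on D f" by (rule lipschitz_on_uniformly_continuous)
  from uniformly_continuous_on_extension_on_closure[OF this] obtain g where
    g: "uniformly_continuous_on (closure D) g" "\<And>x. x \<in> D \<Longrightarrow> f x = g x" by metis
  have cont: "continuous_on UNIV g"
    using uniformly_continuous_imp_continuous[OF g(1)] dense by (simp add: D_def)
  have seq: "\<exists>p. (\<forall>n. p n \<in> D) \<and> p \<longlonglongrightarrow> x" for x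
    using dense closure_sequential[of x D] by (auto simp: D_def)
  have g_tendsto: "(\<lambda>n. g (p n)) \<longlonglongrightarrow> g x" if "p \<longlonglongrightarrow> x" for p x
    using cont that by (auto intro: continuous_on_tendsto_compose)
  have "bounded_linear g"
  proof (rule bounded_linear_intro)
    fix x y
    obtain p q where p: "\<forall>n. p n \<in> D" "p \<longlonglongrightarrow> x" and q: "\<forall>n. q n \<in> D" "q \<longlonglongrightarrow> y"
      using seq by metis
    have "g (p n + q n) = g (p n) + g (q n)" for n
    proof -
      have *: "(p n + q n, f (p n) + f (q n)) \<in> R"
        using subspace_add[OF R f_in[of "p n"] f_in[of "q n"]] p q by simp
      then have "p n + q n \<in> D" by (force simp: D_def)
      with f_eq[OF *] g(2) p q show ?thesis by metis
    qed
    then have "(\<lambda>n. g (p n + q n)) \<longlonglongrightarrow> g x + g y"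
      using tendsto_add[OF g_tendsto[OF p(2)] g_tendsto[OF q(2)]] by simp
    with g_tendsto[OF tendsto_add[OF p(2) q(2)]] show "g (x + y) = g x + g y"
      by (rule LIMSEQ_unique)
  next
    fix r x
    obtain p where p: "\<forall>n. p n \<in> D" "p \<longlonglongrightarrow> x" using seq by metis
    have "g (r *\<^sub>R p n) = r *\<^sub>R g (p n)" for n
    proof -
      have *: "(r *\<^sub>R p n, r *\<^sub>R f (p n)) \<in> R"
        using subspace_scale[OF R f_in[of "p n"], of r] p by simp
      then have "r *\<^sub>R p n \<in> D" by (force simp: D_def)
      with f_eq[OF *] g(2) p show ?thesis by metis
    qed
    then have "(\<lambda>n. g (r *\<^sub>R p n)) \<longlonglongrightarrow> r *\<^sub>R g x"
      using tendsto_scaleR[OF tendsto_const[of r] g_tendsto[OF p(2)]] by simp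
    with g_tendsto[OF tendsto_scaleR[OF tendsto_const[of r] p(2)]]
    show "g (r *\<^sub>R x) = r *\<^sub>R g x"
      by (rule LIMSEQ_unique)
  next
    fix x
    obtain p where p: "\<forall>n. p n \<in> D" "p \<longlonglongrightarrow> x" using seq by metis
    have "norm (g (p n)) \<le> norm (p n) * K" for n
      using bound[OF f_in[of "p n"]] g(2)[of "p n"] p by (simp add: mult.commute)
    then show "norm (g x) \<le> norm x * K"
      by (intro LIMSEQ_le[OF tendsto_norm[OF g_tendsto[OF p(2)]] tendsto_mult[OF tendsto_norm[OF p(2)] tendsto_const]]) auto
  qed
  moreover have "g x = y" if "(x, y) \<in> R" for x y
    using g(2)[of x] f_eq[OF that] that by (force simp: D_def)
  ultimately show ?thesis by blast
qed

section \<open>Combinations of bounded bilinear maps\<close>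

lemma bounded_bilinear_add:
  assumes "bounded_bilinear f" "bounded_bilinear g"
  shows "bounded_bilinear (\<lambda>x y. f x y + g x y)"
proof -
  interpret f: bounded_bilinear f by fact
  interpret g: bounded_bilinear g by fact
  obtain K L where K: "\<And>x y. norm (f x y) \<le> norm x * norm y * K"
    and L: "\<And>x y. norm (g x y) \<le> norm x * norm y * L"
    using f.bounded g.bounded by blast
  show ?thesis
  proof
    have "norm (f x y + g x y) \<le> norm x * norm y * (K + L)" for x y
      using norm_triangle_ineq[of "f x y" "g x y"] K[of x y] L[of x y] by (simp add: distrib_left)
    then show "\<exists>K. \<forall>x y. norm (f x y + g x y) \<le> norm x * norm y * K" by blast
  qed (simp_all add: f.add_left f.add_right g.add_left g.add_right f.scaleR_left f.scaleR_right
      g.scaleR_left g.scaleR_right scaleR_add_right)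
qed

lemma bounded_linear_compose_bilinear:
  assumes "bounded_linear h" "bounded_bilinear f"
  shows "bounded_bilinear (\<lambda>x y. h (f x y))"
proof -
  interpret h: bounded_linear h by fact
  interpret f: bounded_bilinear f by fact
  obtain K L where K: "\<And>x. norm (h x) \<le> norm x * K" "K > 0"
    and L: "\<And>x y. norm (f x y) \<le> norm x * norm y * L"
    using h.pos_bounded f.bounded by blast
  show ?thesis
  proof
    have "norm (h (f x y)) \<le> norm x * norm y * (L * K)" for x y
      using K(1)[of "f x y"] mult_right_mono[OF L[of x y] less_imp_le[OF K(2)]] by (simp add: mult.assoc)
    then show "\<exists>K. \<forall>x y. norm (h (f x y)) \<le> norm x * norm y * K" by blast
  qed (simp_all add: f.add_left f.add_right f.scaleR_left f.scaleR_right h.add h.scaleR)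
qed

lemma bounded_bilinear_diff:
  assumes "bounded_bilinear f" "bounded_bilinear g"
  shows "bounded_bilinear (\<lambda>x y. f x y - g x y)"
  using bounded_bilinear_add[OF assms(1) bounded_linear_compose_bilinear[OF bounded_linear_minus[OF bounded_linear_ident] assms(2)]]
  by simp

lemma bounded_bilinear_Pair:
  assumes "bounded_bilinear f" "bounded_bilinear g"
  shows "bounded_bilinear (\<lambda>x y. (f x y, g x y))"
proof -
  have "bounded_bilinear (\<lambda>x y. (f x y, 0) + (0, g x y))"
    by (intro bounded_bilinear_add bounded_linear_compose_bilinear[OF _ assms(1)]
        bounded_linear_compose_bilinear[OF _ assms(2)] bounded_linear_Pair bounded_linear_ident bounded_linear_zero)
  then show ?thesis by simp
qed

section \<open>Ordinary differential equations in Banach and Hilbert spaces\<close>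

lemma primitive_exists:
  fixes g :: "real \<Rightarrow> 'a::banach"
  assumes g: "continuous_on UNIV g"
  shows "\<exists>G. G 0 = 0 \<and> (\<forall>t. (G has_vector_derivative g t) (at t))"
proof -
  define G where "G t = (if t \<ge> 0 then integral {0..t} g else - integral {t..0} g)" for t
  have cont: "continuous_on {a..b} g" for a b using g continuous_on_subset by blast
  have int: "g integrable_on {a..b}" for a b
    by (rule integrable_continuous_real[OF cont])
  have "(G has_vector_derivative g t) (at t)" for t
  proof -
    define n where "n = \<bar>t\<bar> + 1"
    have G_eq: "integral {-n..s} g - integral {-n..0} g = G s" if "s \<in> {-n<..<n}" for s
      using Henstock_Kurzweil_Integration.integral_combine[of "-n" 0 s g]
        Henstock_Kurzweil_Integration.integral_combine[of "-n" s 0 g] that int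
      by (auto simp: G_def n_def algebra_simps)
    have t: "t \<in> {-n<..<n}" by (auto simp: n_def)
    have "((\<lambda>s. integral {-n..s} g) has_vector_derivative g t) (at t within {-n..n})"
      using t by (intro integral_has_vector_derivative cont) auto
    then have "((\<lambda>s. integral {-n..s} g) has_vector_derivative g t) (at t within {-n<..<n})"
      by (rule has_vector_derivative_within_subset) auto
    then have "((\<lambda>s. integral {-n..s} g) has_vector_derivative g t) (at t)"
      using t by (simp add: at_within_open[OF _ open_greaterThanLessThan])
    then have "((\<lambda>s. integral {-n..s} g - integral {-n..0} g) has_vector_derivative g t) (at t)"
      by (auto intro!: derivative_eq_intros)
    then show ?thesis
      by (rule has_vector_derivative_transform_within_open[OF _ open_greaterThanLessThan t G_eq])
  qed
  moreover have "G 0 = 0" by (simp add: G_def)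
  ultimately show ?thesis by blast
qed

lemma has_vector_derivative_imp_continuous_on:
  assumes "\<And>t. (G has_vector_derivative g t) (at t)"
  shows "continuous_on S G"
  by (intro continuous_at_imp_continuous_on ballI)
    (rule has_vector_derivative_continuous[OF assms])

lemma has_vector_derivative_reflect:
  assumes "\<And>t. (G has_vector_derivative g t) (at t)"
  shows "((\<lambda>t. G (- t)) has_vector_derivative - g (- t)) (at t)"
proof -
  have "((G \<circ> uminus) has_vector_derivative (- 1) *\<^sub>R g (- t)) (at t)"
    by (rule vector_diff_chain_at) (auto intro!: derivative_eq_intros assms)
  then show ?thesis by (simp add: o_def)
qed

text \<open>Integral estimates are replaced by the mean value inequality, so that no integral of a
  vector-valued function has to be bounded. Negative times are reduced to positive ones by
  reflection.\<close>

lemma primitive_norm_le: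
  fixes G :: "real \<Rightarrow> 'a::real_normed_vector" and \<Phi> :: "real \<Rightarrow> real"
  assumes G: "\<And>t. (G has_vector_derivative g t) (at t)" "G 0 = 0"
    and \<Phi>: "\<And>t. (\<Phi> has_real_derivative \<phi> t) (at t)" "\<Phi> 0 \<ge> 0"
    and bound: "\<And>t. norm (g t) \<le> \<phi> \<bar>t\<bar>"
  shows "norm (G t) \<le> \<Phi> \<bar>t\<bar>"
proof -
  have pos: "norm (G t) \<le> \<Phi> t"
    if G: "\<And>t. (G has_vector_derivative g t) (at t)" "G 0 = 0"
      and bound: "\<And>t. norm (g t) \<le> \<phi> \<bar>t\<bar>" and t: "t > 0" for G g t
  proof -
    have \<Phi>': "(\<Phi> has_vector_derivative \<phi> t) (at t)" for t
      using \<Phi>(1) by (simp add: has_real_derivative_iff_has_vector_derivative)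
    have "norm (G t - G 0) \<le> \<Phi> t - \<Phi> 0"
    proof (rule differentiable_bound_general[OF t])
      show "continuous_on {0..t} G" "continuous_on {0..t} \<Phi>"
        using has_vector_derivative_imp_continuous_on G(1) \<Phi>' by blast+
      show "norm (g s) \<le> \<phi> s" if "0 < s" "s < t" for s using bound[of s] that by simp
    qed (use G \<Phi>' in auto)
    with G(2) \<Phi>(2) show ?thesis by simp
  qed
  consider "t > 0" | "t < 0" | "t = 0" by linarith
  then show ?thesis
  proof cases
    case 1 then show ?thesis using pos[OF G bound, of t] by simp
  next
    case 2
    then show ?thesis
      using pos[of "\<lambda>t. G (- t)" "\<lambda>t. - g (- t)" "- t"] has_vector_derivative_reflect[OF G(1)] G(2)
        bound[of "- s" for s] by simp
  next
    case 3 then show ?thesis using G \<Phi> by simp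
  qed
qed

text \<open>Picard's fixed point argument on the whole time axis at once, with the exponentially weighted
  norm of Bielecki: the unknown is \<open>y(t) = exp (- M \<bar>t\<bar>) x(t)\<close> in the complete space of bounded
  continuous functions. Integrating the weight gains a factor \<open>1 / M\<close>, which for \<open>M \<ge> 2 L\<close> beats
  the Lipschitz constant. Boundedness of the field keeps the iterates in this space.\<close>

lemma bounded_Lipschitz_ODE_exists:
  fixes f :: "'a::banach \<Rightarrow> 'a"
  assumes Lip: "\<And>x y. norm (f x - f y) \<le> L * norm (x - y)" and bounded: "\<And>x. norm (f x) \<le> K"
  shows "\<exists>x. x 0 = x0 \<and> (\<forall>t. (x has_vector_derivative f (x t)) (at t))"
proof -
  \<comment> \<open>The maximum with 1 keeps the exponent positive when \<open>L \<le> 0\<close>.\<close>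
  define M where "M = 2 * max L 1"
  have M: "M > 0" "L \<le> M / 2" by (auto simp: M_def)
  have LipM: "norm (f x - f y) \<le> M / 2 * norm (x - y)" for x y
    using Lip[of x y] mult_right_mono[OF M(2) norm_ge_zero[of "x - y"]] by linarith
  have f_cont: "continuous_on UNIV f"
    using LipM M by (intro lipschitz_on_continuous_on[of "M / 2"]) (auto simp: lipschitz_on_def dist_norm)
  define w where "w t = exp (M * \<bar>t\<bar>)" for t :: real
  have w: "w t > 0" "w t \<noteq> 0" for t by (simp_all add: w_def)
  have w_cont: "continuous_on UNIV w" unfolding w_def by (intro continuous_intros)
  define g where "g y s = f (w s *\<^sub>R apply_bcontfun y s)" for y and s :: real
  have g_cont: "continuous_on UNIV (g y)" for y
    unfolding g_def
    by (rule continuous_on_compose2[OF f_cont]) (auto intro!: continuous_intros w_cont)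
  define prim where "prim y = (SOME G. G 0 = 0 \<and> (\<forall>t. (G has_vector_derivative g y t) (at t)))" for y
  have prim: "prim y 0 = 0" "(prim y has_vector_derivative g y t) (at t)" for y t
    using someI_ex[OF primitive_exists[OF g_cont[of y]]] by (auto simp: prim_def)
  define T where "T y = Bcontfun (\<lambda>t. (1 / w t) *\<^sub>R (x0 + prim y t))" for y
  have T: "apply_bcontfun (T y) t = (1 / w t) *\<^sub>R (x0 + prim y t)" for y t
  proof -
    have "(\<lambda>t. (1 / w t) *\<^sub>R (x0 + prim y t)) \<in> bcontfun"
    proof (rule bcontfun_normI)
      show "continuous_on UNIV (\<lambda>t. (1 / w t) *\<^sub>R (x0 + prim y t))"
        by (intro continuous_intros w_cont has_vector_derivative_imp_continuous_on[OF prim(2)]) (simp add: w)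
      fix t
      have K: "K \<ge> 0" using bounded[of 0] norm_ge_zero order_trans by blast
      have "norm (prim y t) \<le> K * \<bar>t\<bar>"
        by (rule primitive_norm_le[OF prim(2,1), of "\<lambda>t. K * t" "\<lambda>_. K"])
          (auto intro!: derivative_eq_intros simp: g_def bounded)
      also have "\<dots> \<le> K / M * w t"
      proof -
        have "M * \<bar>t\<bar> \<le> w t"
          using exp_ge_add_one_self[of "M * \<bar>t\<bar>"] unfolding w_def by linarith
        then have "K / M * (M * \<bar>t\<bar>) \<le> K / M * w t" using K M by (intro mult_left_mono) auto
        then show ?thesis using M by simp
      qed
      finally have "norm (prim y t) \<le> K / M * w t" .
      moreover have "norm x0 \<le> norm x0 * w t"
        using M by (simp add: w_def mult_le_cancel_left1)
      ultimately have "norm (x0 + prim y t) \<le> (norm x0 + K / M) * w t"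
        using norm_triangle_ineq[of x0 "prim y t"] by (simp add: algebra_simps)
      then show "norm ((1 / w t) *\<^sub>R (x0 + prim y t)) \<le> norm x0 + K / M"
        using w[of t] unfolding norm_scaleR by (simp add: pos_divide_le_eq)
    qed
    then show ?thesis unfolding T_def by (simp add: Bcontfun_inverse)
  qed
  have "\<exists>!y. T y = y"
  proof (rule banach_fix_type)
    show "(0::real) \<le> 1/2" "1/2 < (1::real)" by auto
    show "\<forall>y z. dist (T y) (T z) \<le> 1 / 2 * dist y z"
    proof (intro allI dist_bound)
      fix y z :: "real \<Rightarrow>\<^sub>C 'a" and t
      define d where "d = dist y z"
      have "norm (prim y t - prim z t) \<le> d / 2 * exp (M * \<bar>t\<bar>)"
      proof (rule primitive_norm_le)
        show "((\<lambda>t. prim y t - prim z t) has_vector_derivative g y t - g z t) (at t)" for t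
          by (intro derivative_intros prim)
        show "((\<lambda>t. d / 2 * exp (M * t)) has_real_derivative M / 2 * exp (M * t) * d) (at t)" for t
          by (auto intro!: derivative_eq_intros)
        fix t
        have "norm (g y t - g z t) \<le> M / 2 * norm (w t *\<^sub>R apply_bcontfun y t - w t *\<^sub>R apply_bcontfun z t)"
          unfolding g_def by (rule LipM)
        also have "\<dots> = M / 2 * (w t * dist (apply_bcontfun y t) (apply_bcontfun z t))"
          using w[of t] by (simp add: dist_norm scaleR_diff_right[symmetric])
        also have "\<dots> \<le> M / 2 * (w t * d)"
          unfolding d_def using w(1)[of t] M(1) by (intro mult_left_mono dist_bounded) auto
        finally show "norm (g y t - g z t) \<le> M / 2 * exp (M * \<bar>t\<bar>) * d" by (simp add: w_def)
      qed (auto simp: prim d_def)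
      then have *: "norm (prim y t - prim z t) \<le> d / 2 * w t" by (simp add: w_def)
      have "dist (apply_bcontfun (T y) t) (apply_bcontfun (T z) t) = norm (prim y t - prim z t) / w t"
        using w[of t] by (simp add: T dist_norm scaleR_diff_right[symmetric] del: scaleR_diff_right)
      also have "\<dots> \<le> d / 2" using * w[of t] by (simp add: field_simps)
      finally show "dist (apply_bcontfun (T y) t) (apply_bcontfun (T z) t) \<le> 1 / 2 * dist y z"
        by (simp add: d_def)
    qed
  qed
  then obtain y where y: "T y = y" by blast
  have "x0 + prim y t = w t *\<^sub>R apply_bcontfun y t" for t
    using T[of y t] w[of t] by (simp add: y)
  then have "g y t = f (x0 + prim y t)" for t by (simp add: g_def)
  then have "((\<lambda>t. x0 + prim y t) has_vector_derivative f (x0 + prim y t)) (at t)" for t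
    using prim(2)[of y t] by (auto intro!: derivative_eq_intros)
  then show ?thesis using prim(1) by (intro exI[of _ "\<lambda>t. x0 + prim y t"]) simp
qed

text \<open>Gronwall's argument: \<open>exp (- 2 L t) \<parallel>x(t) - y(t)\<parallel>\<^sup>2\<close> does not increase.\<close>

lemma Lipschitz_ODE_unique_forward:
  fixes x y :: "real \<Rightarrow> 'a::real_inner"
  assumes Lip: "\<And>x y. norm (f x - f y) \<le> L * norm (x - y)"
    and x: "\<And>t. (x has_vector_derivative f (x t)) (at t)"
    and y: "\<And>t. (y has_vector_derivative f (y t)) (at t)"
    and "x 0 = y 0" "t \<ge> 0"
  shows "x t = y t"
proof -
  define e where "e t = exp (- 2 * L * t) * ((x t - y t) \<bullet> (x t - y t))" for t
  have d: "(e has_real_derivative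
      exp (- 2 * L * t) * (2 * ((x t - y t) \<bullet> (f (x t) - f (y t)))
        - 2 * L * ((x t - y t) \<bullet> (x t - y t)))) (at t)" for t
  proof -
    have "((\<lambda>t. (x t - y t) \<bullet> (x t - y t)) has_vector_derivative
      (x t - y t) \<bullet> (f (x t) - f (y t)) + (f (x t) - f (y t)) \<bullet> (x t - y t)) (at t)"
      by (rule bounded_bilinear.has_vector_derivative[OF bounded_bilinear_inner])
        (intro derivative_intros x y)+
    then have "((\<lambda>t. (x t - y t) \<bullet> (x t - y t)) has_real_derivative
      2 * ((x t - y t) \<bullet> (f (x t) - f (y t)))) (at t)"
      by (simp add: has_real_derivative_iff_has_vector_derivative inner_commute)
    note [derivative_intros] = this
    show ?thesis unfolding e_def
      by (rule derivative_eq_intros refl | simp add: algebra_simps)+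
  qed
  have "e t \<le> e 0"
  proof (rule DERIV_nonpos_imp_nonincreasing[OF \<open>t \<ge> 0\<close>])
    fix s
    have "(x s - y s) \<bullet> (f (x s) - f (y s)) \<le> norm (x s - y s) * norm (f (x s) - f (y s))"
      by (rule norm_cauchy_schwarz)
    also have "\<dots> \<le> norm (x s - y s) * (L * norm (x s - y s))"
      by (intro mult_left_mono Lip) auto
    also have "\<dots> = L * ((x s - y s) \<bullet> (x s - y s))"
      by (simp add: power2_norm_eq_inner[symmetric] power2_eq_square)
    finally have "exp (- 2 * L * s) * (2 * ((x s - y s) \<bullet> (f (x s) - f (y s)))
        - 2 * L * ((x s - y s) \<bullet> (x s - y s))) \<le> 0"
      by (intro mult_nonneg_nonpos) auto
    with d show "\<exists>y. (e has_real_derivative y) (at s) \<and> y \<le> 0" by blast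
  qed
  moreover have "e 0 = 0" using assms(4) by (simp add: e_def)
  ultimately have "(x t - y t) \<bullet> (x t - y t) \<le> 0" by (simp add: e_def mult_le_0_iff)
  then have "x t - y t = 0" by (metis inner_ge_zero inner_eq_zero_iff order_antisym)
  then show ?thesis by simp
qed

lemma Lipschitz_ODE_unique:
  fixes x y :: "real \<Rightarrow> 'a::real_inner"
  assumes Lip: "\<And>x y. norm (f x - f y) \<le> L * norm (x - y)"
    and x: "\<And>t. (x has_vector_derivative f (x t)) (at t)"
    and y: "\<And>t. (y has_vector_derivative f (y t)) (at t)"
    and "x 0 = y 0"
  shows "x = y"
proof
  fix t
  show "x t = y t"
  proof (cases "t \<ge> 0")
    case True
    then show ?thesis using Lipschitz_ODE_unique_forward[OF Lip x y] assms(4) by blast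
  next
    case False
    have "x (- (- t)) = y (- (- t))"
      using Lipschitz_ODE_unique_forward[of "\<lambda>z. - f z" L "\<lambda>t. x (- t)" "\<lambda>t. y (- t)" "- t"]
        has_vector_derivative_reflect[OF x] has_vector_derivative_reflect[OF y] Lip assms(4) False
      by (simp add: norm_minus_commute)
    then show ?thesis by simp
  qed
qed

definition radial_retraction :: "real \<Rightarrow> 'a::real_normed_vector \<Rightarrow> 'a"
  where "radial_retraction r x = (if norm x \<le> r then x else (r / norm x) *\<^sub>R x)"

lemma norm_radial_retraction: "r \<ge> 0 \<Longrightarrow> norm (radial_retraction r x) \<le> r"
  by (auto simp: radial_retraction_def)

text \<open>Scaling the longer vector down to the length of the shorter one moves it by the difference of
  the norms, that is, by at most the distance of the two vectors. Scaling two vectors of equal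
  length by the same factor below one brings them closer.\<close>

lemma radial_retraction_Lipschitz:
  assumes "r \<ge> 0"
  shows "norm (radial_retraction r x - radial_retraction r y) \<le> 2 * norm (x - y)"
proof -
  have shrink: "norm (x - (s / norm y) *\<^sub>R y) \<le> norm (x - y) + (norm y - s)"
    if "0 \<le> s" "s \<le> norm y" for s and x y :: 'a
  proof (cases "norm y = 0")
    case False
    have "norm (y - (s / norm y) *\<^sub>R y) = \<bar>1 - s / norm y\<bar> * norm y"
      using norm_scaleR[of "1 - s / norm y" y] by (simp add: scaleR_diff_left)
    also have "\<dots> = norm y - s" using that False by (simp add: abs_if field_simps)
    finally show ?thesis using norm_triangle_ineq[of "x - y" "y - (s / norm y) *\<^sub>R y"] by simp
  qed (use that in auto)
  have main: "norm (radial_retraction r x - radial_retraction r y) \<le> 2 * norm (x - y)"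
    if xy: "norm x \<le> norm y" for x y :: 'a
  proof -
    have tri: "norm y - norm x \<le> norm (x - y)"
      using norm_triangle_ineq2[of y x] by (simp add: norm_minus_commute)
    consider "norm y \<le> r" | "norm x \<le> r" "r < norm y" | "r < norm x" by linarith
    then show ?thesis
    proof cases
      case 1 then show ?thesis using xy by (simp add: radial_retraction_def)
    next
      case 2 then show ?thesis using shrink[of r y x] assms tri by (simp add: radial_retraction_def)
    next
      case 3
      then have x0: "norm x > 0" "norm y > 0" using assms xy by linarith+
      have "radial_retraction r x - radial_retraction r y
          = (r / norm x) *\<^sub>R (x - (norm x / norm y) *\<^sub>R y)"
        using 3 xy x0 by (simp add: radial_retraction_def scaleR_diff_right)
      then have "norm (radial_retraction r x - radial_retraction r y)
          = (r / norm x) * norm (x - (norm x / norm y) *\<^sub>R y)"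
        using assms x0 by simp
      also have "\<dots> \<le> 1 * norm (x - (norm x / norm y) *\<^sub>R y)"
        using 3 x0 by (intro mult_right_mono) auto
      also have "\<dots> \<le> 2 * norm (x - y)" using shrink[of "norm x" y x] xy tri by simp
      finally show ?thesis .
    qed
  qed
  show ?thesis
    using main[of x y] main[of y x] by (cases "norm x \<le> norm y") (auto simp: norm_minus_commute)
qed

text \<open>The retraction multiplies \<open>x\<close> by a scalar, and \<open>Q\<close> is quadratic, so the truncated field is a
  scalar multiple of \<open>Q(x, x)\<close> and conserves the same energy. Conservation and coercivity confine
  every solution, of the truncated and of the original equation alike, to the ball of radius
  \<open>R\<close> fixed by the initial energy. There the two equations agree, so that existence and uniqueness
  carry over from the truncated one.\<close>

lemma conservative_quadratic_ODE:
  fixes Q :: "'a::{real_inner, banach} \<Rightarrow> 'a \<Rightarrow> 'a" and e :: "'a \<Rightarrow> 'a \<Rightarrow> real"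
  assumes Q: "bounded_bilinear Q" and e: "bounded_bilinear e" and sym: "\<And>x y. e x y = e y x"
    and c: "c > 0" and coercive: "\<And>x. c * (norm x)\<^sup>2 \<le> e x x"
    and conserved: "\<And>x. e x (Q x x) = 0"
  shows "\<exists>!x. x 0 = x0 \<and> (\<forall>t. (x has_vector_derivative Q (x t) (x t)) (at t))"
proof -
  interpret Q: bounded_bilinear Q by fact
  interpret e: bounded_bilinear e by fact
  define R where "R = sqrt (e x0 x0 / c)"
  have ex0: "0 \<le> e x0 x0" using coercive[of x0] c by (smt (verit) mult_nonneg_nonneg zero_le_power2)
  have R: "R \<ge> 0" "c * R\<^sup>2 = e x0 x0" using c ex0 by (auto simp: R_def)
  define f where "f x = Q (radial_retraction R x) (radial_retraction R x)" for x
  have energy: "norm (x t) \<le> R"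
    if x0: "x 0 = x0" and x: "\<And>t. (x has_vector_derivative h (x t)) (at t)"
      and h: "\<And>z. e z (h z) = 0" for x h t
  proof -
    have "((\<lambda>t. e (x t) (x t)) has_vector_derivative e (x t) (h (x t)) + e (h (x t)) (x t)) (at t)" for t
      by (rule bounded_bilinear.has_vector_derivative[OF e x x])
    moreover have "e (h z) z = 0" for z using h[of z] sym[of z "h z"] by simp
    ultimately have "((\<lambda>t. e (x t) (x t)) has_real_derivative 0) (at t)" for t
      using h by (simp add: has_real_derivative_iff_has_vector_derivative)
    then have "e (x t) (x t) = e (x 0) (x 0)" by (rule DERIV_isconst_all[rule_format])
    then have "c * (norm (x t))\<^sup>2 \<le> c * R\<^sup>2" using coercive[of "x t"] x0 R by simp
    then show ?thesis using c R(1) by (simp add: power2_le_iff_abs_le)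
  qed
  obtain K where K: "K > 0" "\<And>x y. norm (Q x y) \<le> norm x * norm y * K" using Q.pos_bounded by blast
  have f_conserved: "e z (f z) = 0" for z
  proof -
    have "\<exists>s. radial_retraction R z = s *\<^sub>R z" by (auto simp: radial_retraction_def intro: exI[of _ 1])
    then obtain s where "radial_retraction R z = s *\<^sub>R z" by blast
    then show ?thesis by (simp add: f_def Q.scaleR_left Q.scaleR_right e.scaleR_right conserved)
  qed
  have f_bound: "norm (f x) \<le> R * R * K" for x
  proof -
    have "norm (f x) \<le> norm (radial_retraction R x) * norm (radial_retraction R x) * K"
      unfolding f_def by (rule K)
    also have "\<dots> \<le> R * R * K"
      using K(1) R(1) norm_radial_retraction[OF R(1), of x] by (intro mult_right_mono mult_mono) auto
    finally show ?thesis .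
  qed
  have f_Lip: "norm (f x - f y) \<le> (4 * R * K) * norm (x - y)" for x y
  proof -
    let ?p = "radial_retraction R x" and ?q = "radial_retraction R y"
    have "f x - f y = Q ?p (?p - ?q) + Q (?p - ?q) ?q"
      by (simp add: f_def Q.diff_left Q.diff_right)
    then have "norm (f x - f y) \<le> norm ?p * norm (?p - ?q) * K + norm (?p - ?q) * norm ?q * K"
      using norm_triangle_ineq[of "Q ?p (?p - ?q)" "Q (?p - ?q) ?q"] K(2)[of ?p "?p - ?q"]
        K(2)[of "?p - ?q" ?q] by simp
    also have "\<dots> \<le> R * (2 * norm (x - y)) * K + (2 * norm (x - y)) * R * K"
      using K(1) R(1) norm_radial_retraction[OF R(1)] radial_retraction_Lipschitz[OF R(1), of x y]
      by (intro add_mono mult_right_mono mult_mono) auto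
    finally show ?thesis by (simp add: algebra_simps)
  qed
  have f_eq: "f z = Q z z" if "norm z \<le> R" for z
    using that by (simp add: f_def radial_retraction_def)
  show ?thesis
  proof (rule ex_ex1I)
    obtain x where x: "x 0 = x0" "\<And>t. (x has_vector_derivative f (x t)) (at t)"
      using bounded_Lipschitz_ODE_exists[OF f_Lip f_bound] by blast
    then have "norm (x t) \<le> R" for t using energy f_conserved by blast
    with x show "\<exists>x. x 0 = x0 \<and> (\<forall>t. (x has_vector_derivative Q (x t) (x t)) (at t))"
      by (metis f_eq)
  next
    fix x y
    assume x: "x 0 = x0 \<and> (\<forall>t. (x has_vector_derivative Q (x t) (x t)) (at t))"
      and y: "y 0 = x0 \<and> (\<forall>t. (y has_vector_derivative Q (y t) (y t)) (at t))"
    have "norm (x t) \<le> R" "norm (y t) \<le> R" for t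
      using energy[of x "\<lambda>z. Q z z"] energy[of y "\<lambda>z. Q z z"] x y conserved by auto
    then have "(x has_vector_derivative f (x t)) (at t)" "(y has_vector_derivative f (y t)) (at t)" for t
      using x y by (simp_all add: f_eq)
    then show "x = y" using Lipschitz_ODE_unique[OF f_Lip] x y by metis
  qed
qed

section \<open>Completeness of \<open>L\<^sup>2\<close> and of \<open>V\<close>\<close>

lemma emeasure_torus: "emeasure torus (space torus) = 1"
proof -
  have b: "(1::real^3) \<bullet> b = 1" if "b \<in> Basis" for b
    using that by (auto simp: Basis_vec_def inner_axis)
  have "emeasure lebesgue (cbox 0 (1::real^3)) = ennreal (\<Prod>b\<in>Basis. ((1::real^3) - 0) \<bullet> b)"
    using b by (simp add: emeasure_lborel_cbox)
  also have "\<dots> = 1" using b by simp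
  finally show ?thesis by (simp add: torus_def emeasure_restrict_space)
qed

interpretation torus: finite_measure torus
  by standard (simp add: emeasure_torus)

lemma square_integrable_rep_L2: "square_integrable (rep_L2 f)"
  using Quotient_rep_reflp[OF Quotient_L2, of f] by (simp add: L2_eq_def)

lemma L2_of_rep_L2: "L2_of (rep_L2 f) = f"
  by (rule Quotient_abs_rep[OF Quotient_L2])

lemma square_integrable_diff:
  assumes "square_integrable f" "square_integrable g"
  shows "square_integrable (\<lambda>x. f x - g x)"
  using square_integrable_add[OF assms(1) square_integrable_scaleR[OF assms(2), of "- 1"]] by simp

lemma L2_of_diff:
  assumes "square_integrable f" "square_integrable g"
  shows "L2_of (\<lambda>x. f x - g x) = L2_of f - L2_of g"
  using L2_of_add[OF assms(1) square_integrable_scaleR[OF assms(2), of "- 1"]]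
    L2_of_scaleR[OF assms(2), of "- 1"] by simp

lemma norm_L2_of:
  assumes "square_integrable f"
  shows "(norm (L2_of f))\<^sup>2 = (\<integral>x. (norm (f x))\<^sup>2 \<partial>torus)"
  using inner_L2_of[OF assms assms] by (simp add: power2_norm_eq_inner)

text \<open>The torus has measure one, so the \<open>L\<^sup>1\<close> norm is at most the \<open>L\<^sup>2\<close> norm; this follows by
  integrating \<open>t \<le> \<epsilon> / 2 + t\<^sup>2 / (2 \<epsilon>)\<close>.\<close>

lemma integral_norm_le_L2:
  assumes f: "square_integrable f" and \<epsilon>: "norm (L2_of f) \<le> \<epsilon>" "\<epsilon> > 0"
  shows "integrable torus (\<lambda>x. norm (f x))" "(\<integral>x. norm (f x) \<partial>torus) \<le> \<epsilon>"
proof -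
  let ?h = "\<lambda>x. \<epsilon> / 2 + (norm (f x))\<^sup>2 / (2 * \<epsilon>)"
  have h: "integrable torus ?h" using f by (auto simp: square_integrable_def)
  have le: "norm (f x) \<le> ?h x" for x
  proof -
    have "0 \<le> (norm (f x) - \<epsilon>)\<^sup>2 / (2 * \<epsilon>)" using \<epsilon> by simp
    also have "\<dots> = ?h x - norm (f x)" using \<epsilon> by (simp add: power2_eq_square field_simps)
    finally show ?thesis by simp
  qed
  show i: "integrable torus (\<lambda>x. norm (f x))"
    by (rule Bochner_Integration.integrable_bound[OF h])
      (use f le in \<open>auto simp: square_integrable_def intro!: order_trans[OF le]\<close>)
  have "(\<integral>x. norm (f x) \<partial>torus) \<le> (\<integral>x. ?h x \<partial>torus)"
    by (rule integral_mono[OF i h le])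
  also have "\<dots> = \<epsilon> / 2 + (norm (L2_of f))\<^sup>2 / (2 * \<epsilon>)"
    using f by (simp add: norm_L2_of square_integrable_def emeasure_torus measure_def)
  also have "\<dots> \<le> \<epsilon> / 2 + \<epsilon>\<^sup>2 / (2 * \<epsilon>)"
    using \<epsilon> by (intro add_left_mono divide_right_mono power_mono) auto
  also have "\<dots> = \<epsilon>" using \<epsilon> by (simp add: power2_eq_square)
  finally show "(\<integral>x. norm (f x) \<partial>torus) \<le> \<epsilon>" .
qed

lemma square_integrable_Fatou:
  assumes F: "\<And>n. square_integrable (F n)" and lim: "AE x in torus. (\<lambda>n. F n x) \<longlonglongrightarrow> g x"
    and g: "g \<in> borel_measurable torus"
    and bound: "\<forall>\<^sub>F n in sequentially. norm (L2_of (F n)) \<le> c"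
  shows "square_integrable g" "norm (L2_of g) \<le> c"
proof -
  have c: "c \<ge> 0" using eventually_happens[OF bound] norm_ge_zero order_trans by (metis sequentially_bot)
  have [measurable]: "F n \<in> borel_measurable torus" for n using F by (simp add: square_integrable_def)
  have "(\<integral>\<^sup>+x. ennreal ((norm (g x))\<^sup>2) \<partial>torus) = (\<integral>\<^sup>+x. liminf (\<lambda>n. ennreal ((norm (F n x))\<^sup>2)) \<partial>torus)"
  proof (rule nn_integral_cong_AE, use lim in eventually_elim)
    fix x assume "(\<lambda>n. F n x) \<longlonglongrightarrow> g x"
    then have "(\<lambda>n. ennreal ((norm (F n x))\<^sup>2)) \<longlonglongrightarrow> ennreal ((norm (g x))\<^sup>2)"
      by (intro tendsto_ennrealI tendsto_intros)
    then show "ennreal ((norm (g x))\<^sup>2) = liminf (\<lambda>n. ennreal ((norm (F n x))\<^sup>2))"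
      by (intro lim_imp_Liminf[symmetric]) auto
  qed
  also have "\<dots> \<le> liminf (\<lambda>n. \<integral>\<^sup>+x. ennreal ((norm (F n x))\<^sup>2) \<partial>torus)"
    by (rule nn_integral_liminf) measurable
  also have "\<dots> = liminf (\<lambda>n. ennreal ((norm (L2_of (F n)))\<^sup>2))"
    using F by (intro arg_cong[where f=liminf] ext)
      (simp add: norm_L2_of nn_integral_eq_integral square_integrable_def)
  also have "\<dots> \<le> liminf (\<lambda>n. ennreal (c\<^sup>2))"
    by (rule Liminf_mono, use bound in eventually_elim) (auto intro!: ennreal_leI power_mono)
  also have "\<dots> = ennreal (c\<^sup>2)" by (simp add: Liminf_const)
  finally have le: "(\<integral>\<^sup>+x. ennreal ((norm (g x))\<^sup>2) \<partial>torus) \<le> ennreal (c\<^sup>2)" .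
  then have int: "integrable torus (\<lambda>x. (norm (g x))\<^sup>2)"
    using g by (intro integrableI_bounded) (auto intro: le_less_trans)
  then show sq: "square_integrable g" using g by (simp add: square_integrable_def)
  from int have "(norm (L2_of g))\<^sup>2 \<le> c\<^sup>2"
    using le by (simp add: norm_L2_of[OF sq] nn_integral_eq_integral)
  then show "norm (L2_of g) \<le> c" using c by (rule power2_le_imp_le)
qed

text \<open>The Riesz-Fischer theorem. Along a subsequence with geometrically decreasing increments the
  increments are summable in \<open>L\<^sup>1\<close>, hence almost everywhere absolutely summable, which gives a
  pointwise limit. Fatou's lemma, applied to the differences of the subsequence, shows that the limit is
  square integrable and that it is approached in norm.\<close>

instance L2 :: banach
proof
  fix X :: "nat \<Rightarrow> L2"
  assume "Cauchy X"
  then have "\<exists>N. \<forall>m\<ge>N. \<forall>k\<ge>N. norm (X m - X k) < (1/2)^n" for n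
    unfolding Cauchy_def dist_norm by simp
  then obtain N where N: "\<And>n m k. m \<ge> N n \<Longrightarrow> k \<ge> N n \<Longrightarrow> norm (X m - X k) < (1/2)^n" by metis
  \<comment> \<open>The partial sums of \<open>N\<close> dominate \<open>N n\<close> at every index from \<open>n\<close> on.\<close>
  define r where "r n = n + (\<Sum>i\<le>n. N i)" for n
  have r: "r m \<ge> N n" if "m \<ge> n" for m n
    using member_le_sum[of n "{..m}" N] that by (auto simp: r_def)
  define F where "F n = rep_L2 (X (r n))" for n
  have F: "square_integrable (F n)" "L2_of (F n) = X (r n)" for n
    by (simp_all add: F_def square_integrable_rep_L2 L2_of_rep_L2)
  then have [measurable]: "F n \<in> borel_measurable torus" for n by (simp add: square_integrable_def)
  define D where "D n x = F (Suc n) x - F n x" for n x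
  have D: "square_integrable (D n)" "norm (L2_of (D n)) \<le> (1/2)^n" for n
    unfolding D_def using F N[OF r r, of n "Suc n" n]
    by (auto simp: square_integrable_diff L2_of_diff intro: less_imp_le)
  have [measurable]: "D n \<in> borel_measurable torus" for n using D by (simp add: square_integrable_def)
  have "(\<integral>\<^sup>+x. (\<Sum>n. ennreal (norm (D n x))) \<partial>torus) = (\<Sum>n. \<integral>\<^sup>+x. ennreal (norm (D n x)) \<partial>torus)"
    by (rule nn_integral_suminf) measurable
  also have "\<dots> \<le> (\<Sum>n. ennreal ((1/2)^n))"
    using integral_norm_le_L2[OF D]
    by (intro suminf_le) (auto simp: nn_integral_eq_integral intro!: ennreal_leI)
  also have "\<dots> = ennreal (\<Sum>n. (1/2)^n)"
    by (intro suminf_ennreal2 summable_geometric) auto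
  also have "\<dots> < \<infinity>" by simp
  finally have "AE x in torus. (\<Sum>n. ennreal (norm (D n x))) \<noteq> \<infinity>"
    by (intro nn_integral_noteq_infinite) auto
  then have conv: "AE x in torus. convergent (\<lambda>n. F n x)"
  proof eventually_elim
    fix x assume "(\<Sum>n. ennreal (norm (D n x))) \<noteq> \<infinity>"
    then have "summable (\<lambda>n. norm (D n x))" by (intro summable_suminf_not_top) auto
    then have "summable (\<lambda>n. D n x)" by (rule summable_norm_cancel)
    then have "convergent (\<lambda>n. F 0 x + (\<Sum>k<n. D k x))"
      by (intro convergent_add convergent_const) (simp add: summable_iff_convergent)
    moreover have "F 0 x + (\<Sum>k<n. D k x) = F n x" for n
      unfolding D_def by (subst sum_lessThan_telescope) simp
    ultimately show "convergent (\<lambda>n. F n x)" by simp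
  qed
  define g where "g x = lim (\<lambda>n. F n x)" for x
  have g [measurable]: "g \<in> borel_measurable torus" unfolding g_def by measurable
  have F_lim: "AE x in torus. (\<lambda>n. F n x) \<longlonglongrightarrow> g x"
    using conv by eventually_elim (simp add: g_def convergent_LIMSEQ_iff)
  have *: "square_integrable (\<lambda>x. g x - F n x) \<and> norm (L2_of (\<lambda>x. g x - F n x)) \<le> (1/2)^n" for n
  proof -
    have 1: "AE x in torus. (\<lambda>m. F m x - F n x) \<longlonglongrightarrow> g x - F n x"
      using F_lim by eventually_elim (intro tendsto_intros)
    have 2: "\<forall>\<^sub>F m in sequentially. norm (L2_of (\<lambda>x. F m x - F n x)) \<le> (1/2)^n"
      using eventually_ge_at_top[of n]
    proof eventually_elim
      fix m assume "n \<le> m"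
      with N[OF r r, of n m n] show "norm (L2_of (\<lambda>x. F m x - F n x)) \<le> (1/2)^n"
        using F by (simp add: L2_of_diff)
    qed
    show ?thesis
      using square_integrable_Fatou[OF square_integrable_diff[OF F(1) F(1)] 1 _ 2] by simp
  qed
  have g_sq: "square_integrable g"
    using square_integrable_add[OF conjunct1[OF *[of 0]] F(1)[of 0]] by simp
  have close: "norm (X k - L2_of g) \<le> 2 * (1/2)^n" if "k \<ge> N n" for k n
  proof -
    have "norm (L2_of g - X (r n)) \<le> (1/2)^n"
      using *[of n] by (simp add: L2_of_diff g_sq F)
    moreover have "norm (X k - X (r n)) < (1/2)^n" using N[OF that r] by simp
    ultimately show ?thesis
      using norm_triangle_ineq[of "X k - X (r n)" "X (r n) - L2_of g"]
      by (simp add: norm_minus_commute)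
  qed
  have "X \<longlonglongrightarrow> L2_of g"
  proof (rule metric_LIMSEQ_I)
    fix e :: real assume "e > 0"
    then obtain n where "(1/2)^n < e / 2" using real_arch_pow_inv[of "e/2" "1/2"] by auto
    then show "\<exists>no. \<forall>k\<ge>no. dist (X k) (L2_of g) < e"
      using close[of n] by (intro exI[of _ "N n"]) (force simp: dist_norm)
  qed
  then show "convergent X" by (auto simp: convergent_def)
qed

text \<open>A weak derivative is characterised by pairings with fixed test functions, a closed condition.\<close>

lemma closed_V_set: "closed V_set"
proof -
  have "closed H1"
  proof -
    have "H1 = (\<Inter>i. \<Inter>\<psi>\<in>Collect torus_test_function.
        {p. fst p \<bullet> L2_of (partial i \<psi>) = - (snd p $ i \<bullet> L2_of \<psi>)})"
      by (auto simp: H1_def weak_partial_def)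
    also have "closed \<dots>"
      by (intro closed_INT ballI closed_Collect_eq continuous_intros)
    finally show ?thesis .
  qed
  then show ?thesis unfolding V_set_def by (intro closed_Int) auto
qed

instance V :: banach
proof
  fix X :: "nat \<Rightarrow> V"
  assume "Cauchy X"
  then have "Cauchy (\<lambda>n. rep_V (X n))" by (simp add: Cauchy_def dist_V.rep_eq)
  then obtain l where l: "(\<lambda>n. rep_V (X n)) \<longlonglongrightarrow> l"
    unfolding Cauchy_convergent_iff convergent_def by blast
  have "l \<in> V_set" by (rule closed_sequentially[OF closed_V_set rep_V l])
  then have "rep_V (abs_V l) = l" by (rule abs_V_inverse)
  with l have "X \<longlonglongrightarrow> abs_V l" by (simp add: lim_sequentially dist_V.rep_eq)
  then show "convergent X" by (auto simp: convergent_def)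
qed

section \<open>Integration by parts on the torus\<close>

lemma integrable_torus_continuous:
  fixes f :: "real^3 \<Rightarrow> 'a::euclidean_space"
  assumes "continuous_on UNIV f"
  shows "integrable torus f"
  unfolding torus_def by (rule continuous_imp_integrable, rule continuous_on_subset[OF assms]) auto

lemma integral_torus_continuous:
  fixes f :: "real^3 \<Rightarrow> 'a::euclidean_space"
  assumes "continuous_on UNIV f"
  shows "(\<integral>x. f x \<partial>torus) = integral (cbox 0 1) f"
  using integrable_torus_continuous[OF assms] unfolding torus_def
  by (intro lebesgue_integral_eq_integral) auto

lemma square_integrable_continuous:
  assumes "continuous_on UNIV f"
  shows "square_integrable f"
proof -
  have "continuous_on UNIV (\<lambda>x. (norm (f x))\<^sup>2)" by (intro continuous_intros assms)
  then show ?thesis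
    unfolding square_integrable_def
    using borel_measurable_integrable[OF integrable_torus_continuous[OF assms]]
      integrable_torus_continuous by blast
qed

text \<open>The unit cube and the shifted cube have a slab in common, and the two slabs that remain differ
  by exactly one period.\<close>

lemma integral_shift_periodic:
  fixes h :: "real^3 \<Rightarrow> real"
  assumes h: "continuous_on UNIV h" and per: "\<And>x. h (x + axis i 1) = h x" and s: "0 \<le> s" "s \<le> 1"
  shows "integral (cbox 0 1) (\<lambda>x. h (x + s *\<^sub>R axis i 1)) = integral (cbox 0 1) h"
proof -
  define e :: "real^3" where "e = axis i 1"
  have e_nth: "e $ j = (if j = i then 1 else 0)" for j by (simp add: e_def axis_def)
  have e: "e \<in> Basis" by (auto simp: e_def Basis_vec_def)
  have inner_e: "x \<bullet> e = x $ i" for x by (simp add: e_def inner_axis)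
  have int: "h integrable_on cbox a b" for a b
    by (rule integrable_continuous[OF continuous_on_subset[OF h]]) simp
  define slab where "slab l u = {x::real^3. l \<le> x $ i \<and> x $ i \<le> u \<and> (\<forall>j. j \<noteq> i \<longrightarrow> 0 \<le> x $ j \<and> x $ j \<le> 1)}"
    for l u
  have slab: "cbox a b = slab (a $ i) (b $ i)" if "\<And>j. j \<noteq> i \<Longrightarrow> a $ j = 0 \<and> b $ j = 1" for a b
  proof -
    have "(\<forall>j. P j) \<longleftrightarrow> P i \<and> (\<forall>j. j \<noteq> i \<longrightarrow> P j)" for P by metis
    from this[of "\<lambda>j. a $ j \<le> x $ j \<and> x $ j \<le> b $ j" for x] show ?thesis
      using that by (auto simp: slab_def mem_box_cart)
  qed
  define A where "A = slab s 1"
  define b' :: "real^3" where "b' = (\<chi> j. if j = i then s else 1)"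
  have cubes: "cbox (s *\<^sub>R e) (1 + s *\<^sub>R e) = slab s (1 + s)" "cbox (0 + e) (b' + e) = slab 1 (1 + s)"
    "cbox 0 b' = slab 0 s" "cbox 0 (1::real^3) = slab 0 1"
    by (subst slab; simp add: e_nth b'_def add.commute)+
  have sets: "cbox (s *\<^sub>R e) (1 + s *\<^sub>R e) \<inter> {x. x \<bullet> e \<le> 1} = A"
    "cbox (s *\<^sub>R e) (1 + s *\<^sub>R e) \<inter> {x. x \<bullet> e \<ge> 1} = cbox (0 + e) (b' + e)"
    "cbox 0 1 \<inter> {x. x \<bullet> e \<le> s} = cbox 0 b'" "cbox 0 1 \<inter> {x. x \<bullet> e \<ge> s} = A"
    unfolding cubes A_def using s by (auto simp: inner_e slab_def)
  have "integral (cbox 0 1) (\<lambda>x. h (x + s *\<^sub>R e)) = integral (cbox 0 1) (h \<circ> ((+) (s *\<^sub>R e)))"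
    by (simp add: o_def add.commute)
  also have "\<dots> = integral (cbox (s *\<^sub>R e) (1 + s *\<^sub>R e)) h"
    by (subst integral_shift_cbox_plus) simp
  also have "\<dots> = integral A h + integral (cbox (0 + e) (b' + e)) h"
    using integral_split[OF int e, of "s *\<^sub>R e" "1 + s *\<^sub>R e" 1] by (simp only: sets)
  also have "integral (cbox (0 + e) (b' + e)) h = integral (cbox 0 b') (h \<circ> ((+) e))"
    by (rule integral_shift_cbox_plus[symmetric])
  also have "h \<circ> ((+) e) = h"
    using per by (auto simp: e_def add.commute)
  also have "integral A h + integral (cbox 0 b') h = integral (cbox 0 1) h"
    using integral_split[OF int e, of 0 1 s] by (simp only: sets add.commute)
  finally show ?thesis by (simp add: e_def)
qed

text \<open>By translation invariance the integral of \<open>f(x + s e)\<close> over the cube does not depend on \<open>s\<close>;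
  its derivative in \<open>s\<close> is computed under the integral sign.\<close>

lemma integral_torus_derivative_eq_0:
  fixes f :: "real^3 \<Rightarrow> real"
  assumes f: "\<And>x. (f has_derivative f' x) (at x)"
    and f': "continuous_on UNIV (\<lambda>x. f' x (axis i 1))"
    and per: "\<And>x. f (x + axis i 1) = f x"
  shows "(\<integral>x. f' x (axis i 1) \<partial>torus) = 0"
proof -
  define e :: "real^3" where "e = axis i 1"
  define g where "g x = f' x e" for x
  have g: "continuous_on UNIV g" using f' by (simp add: g_def e_def)
  have f_cont: "continuous_on UNIV f"
    by (intro continuous_at_imp_continuous_on ballI has_derivative_continuous[OF f])
  have g_per: "g (x + axis i 1) = g x" for x
  proof -
    have "((\<lambda>y. f (y + e)) has_derivative f' (x + e)) (at x)"
      by (rule has_derivative_compose[of "\<lambda>y. y + e" "\<lambda>h. h"]) (auto intro!: derivative_eq_intros f)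
    then have "(f has_derivative f' (x + e)) (at x)" using per by (simp add: e_def)
    then show ?thesis using has_derivative_unique[OF _ f[of x]] by (simp add: g_def e_def)
  qed
  have D: "((\<lambda>s. f (x + s *\<^sub>R e)) has_field_derivative g (x + s *\<^sub>R e)) (at s within S)" for x s S
  proof -
    have "((\<lambda>s. x + s *\<^sub>R e) has_vector_derivative e) (at s within S)"
      by (auto intro!: derivative_eq_intros)
    then have "((f \<circ> (\<lambda>s. x + s *\<^sub>R e)) has_vector_derivative f' (x + s *\<^sub>R e) e) (at s within S)"
      by (rule vector_derivative_diff_chain_within)
        (rule has_derivative_at_withinI[OF f])
    then show ?thesis by (simp add: o_def g_def has_real_derivative_iff_has_vector_derivative)
  qed
  \<comment> \<open>Shifts by \<open>s \<in> [0, 1]\<close> leave the integral unchanged, so it is differentiated at an interior point.\<close>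
  have "((\<lambda>s. integral (cbox 0 1) (\<lambda>x. f (x + s *\<^sub>R e))) has_field_derivative
      integral (cbox 0 1) (\<lambda>x. g (x + (1/2) *\<^sub>R e))) (at (1/2) within {0..1})"
  proof (rule leibniz_rule_field_derivative)
    show "(\<lambda>x. f (x + s *\<^sub>R e)) integrable_on cbox 0 1" for s
      by (intro integrable_continuous continuous_on_compose2[OF f_cont] continuous_intros) auto
    show "continuous_on ({0..1} \<times> cbox 0 1) (\<lambda>(s, x). g (x + s *\<^sub>R e))"
      unfolding split_beta by (intro continuous_on_compose2[OF g] continuous_intros) auto
  qed (auto intro: D)
  then have 1: "((\<lambda>s. integral (cbox 0 1) (\<lambda>x. f (x + s *\<^sub>R e))) has_field_derivative
      integral (cbox 0 1) g) (at (1/2))"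
    using integral_shift_periodic[OF g g_per, where s = "1/2"]
    by (simp add: at_within_interior[of "1/2" "{0..1::real}"] e_def)
  have 2: "((\<lambda>s. integral (cbox 0 1) (\<lambda>x. f (x + s *\<^sub>R e))) has_field_derivative 0) (at (1/2))"
  proof (rule has_field_derivative_transform_within_open)
    show "((\<lambda>s. integral (cbox 0 1) f) has_field_derivative 0) (at (1/2::real))" by simp
    show "integral (cbox 0 1) f = integral (cbox 0 1) (\<lambda>x. f (x + s *\<^sub>R e))" if "s \<in> {0<..<1}" for s
      using integral_shift_periodic[OF f_cont per, where s = s] that by (simp add: e_def)
  qed auto
  show ?thesis
    using DERIV_unique[OF 1 2] integral_torus_continuous[OF g] by (simp add: g_def e_def)
qed

text \<open>The regularity that integration by parts needs, shared by trigonometric polynomials and by test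
  functions.\<close>

definition periodic_C1 :: "(real^3 \<Rightarrow> real^3) \<Rightarrow> bool"
  where "periodic_C1 \<phi> \<longleftrightarrow> (\<forall>x. \<phi> differentiable at x) \<and> (\<forall>i. continuous_on UNIV (partial i \<phi>))
    \<and> (\<forall>i x. \<phi> (x + axis i 1) = \<phi> x)"

lemma periodic_C1_has_derivative:
  "periodic_C1 \<phi> \<Longrightarrow> (\<phi> has_derivative frechet_derivative \<phi> (at x)) (at x)"
  using frechet_derivative_works by (auto simp: periodic_C1_def)

lemma periodic_C1_continuous: "periodic_C1 \<phi> \<Longrightarrow> continuous_on S \<phi>"
  by (intro continuous_at_imp_continuous_on ballI)
    (auto intro: has_derivative_continuous[OF periodic_C1_has_derivative])

lemma integral_by_parts_torus:
  assumes \<phi>: "periodic_C1 \<phi>" and \<psi>: "periodic_C1 \<psi>"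
  shows "(\<integral>x. \<phi> x \<bullet> partial i \<psi> x \<partial>torus) = - (\<integral>x. partial i \<phi> x \<bullet> \<psi> x \<partial>torus)"
proof -
  note c = periodic_C1_continuous[OF \<phi>] periodic_C1_continuous[OF \<psi>]
  have c': "continuous_on UNIV (partial i \<phi>)" "continuous_on UNIV (partial i \<psi>)"
    using \<phi> \<psi> by (auto simp: periodic_C1_def)
  have "(\<integral>x. \<phi> x \<bullet> frechet_derivative \<psi> (at x) (axis i 1)
      + frechet_derivative \<phi> (at x) (axis i 1) \<bullet> \<psi> x \<partial>torus) = 0"
  proof (rule integral_torus_derivative_eq_0)
    show "((\<lambda>x. \<phi> x \<bullet> \<psi> x) has_derivative (\<lambda>h. \<phi> x \<bullet> frechet_derivative \<psi> (at x) h
        + frechet_derivative \<phi> (at x) h \<bullet> \<psi> x)) (at x)" for x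
      by (intro has_derivative_inner periodic_C1_has_derivative \<phi> \<psi>)
    show "continuous_on UNIV (\<lambda>x. \<phi> x \<bullet> frechet_derivative \<psi> (at x) (axis i 1)
        + frechet_derivative \<phi> (at x) (axis i 1) \<bullet> \<psi> x)"
      using c' c[of UNIV] unfolding partial_def by (intro continuous_intros) auto
  qed (use \<phi> \<psi> in \<open>auto simp: periodic_C1_def\<close>)
  moreover have "integrable torus (\<lambda>x. \<phi> x \<bullet> partial i \<psi> x)" "integrable torus (\<lambda>x. partial i \<phi> x \<bullet> \<psi> x)"
    by (intro integrable_torus_continuous continuous_intros c c')+
  ultimately show ?thesis by (simp add: partial_def[symmetric])
qed

lemma phase_add: "phase k (x + y) = phase k x + phase k y"
  by (simp add: phase_def sum.distrib distrib_left)

lemma phase_axis: "phase k (axis i 1) = of_int (k $ i) * (2 * pi)"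
  by (simp add: phase_def axis_def if_distrib cong: if_cong)

lemma trig_poly_periodic:
  assumes "trig_poly \<phi>"
  shows "\<phi> (x + axis i 1) = \<phi> x"
proof -
  have "cos (phase k (x + axis i 1)) = cos (phase k x)"
    "sin (phase k (x + axis i 1)) = sin (phase k x)" for k
    using cos.plus_of_int[of "phase k x" "k $ i"] sin.plus_of_int[of "phase k x" "k $ i"]
    by (simp_all add: phase_add phase_axis)
  then show ?thesis using assms by (auto simp: trig_poly_def trig_sum_def)
qed

lemma trig_poly_test_function:
  assumes "trig_poly \<phi>"
  shows "torus_test_function \<phi>"
proof -
  have "trig_poly (foldr partial is \<phi>)" for "is"
    by (induction "is") (auto simp: assms trig_poly_partial)
  then show ?thesis
    using trig_poly_differentiable trig_poly_periodic[OF assms] by (auto simp: torus_test_function_def)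
qed

lemma torus_test_function_periodic_C1:
  assumes "torus_test_function \<psi>"
  shows "periodic_C1 \<psi>"
proof -
  have *: "foldr partial is \<psi> differentiable at x" for "is" x
    using assms by (auto simp: torus_test_function_def)
  have "continuous_on UNIV (partial i \<psi>)" for i
    using *[of "[i]"] by (intro continuous_at_imp_continuous_on ballI differentiable_imp_continuous_within) simp
  then show ?thesis using assms *[of "[]"] by (auto simp: periodic_C1_def torus_test_function_def)
qed

lemmas trig_poly_periodic_C1 = torus_test_function_periodic_C1[OF trig_poly_test_function]

section \<open>The dense subspace of solenoidal trigonometric polynomials\<close>

lemma weak_partial_trig_poly:
  assumes "trig_poly \<phi>"
  shows "weak_partial i (L2_of \<phi>) (L2_of (partial i \<phi>))"
  unfolding weak_partial_def
proof (intro allI impI)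
  fix \<psi> assume "torus_test_function \<psi>"
  then have \<psi>: "periodic_C1 \<psi>" by (rule torus_test_function_periodic_C1)
  have "square_integrable \<psi>" "square_integrable (partial i \<psi>)"
    using \<psi> periodic_C1_continuous[OF \<psi>]
    by (auto intro!: square_integrable_continuous simp: periodic_C1_def)
  then show "L2_of \<phi> \<bullet> L2_of (partial i \<psi>) = - (L2_of (partial i \<phi>) \<bullet> L2_of \<psi>)"
    using integral_by_parts_torus[OF trig_poly_periodic_C1[OF assms] \<psi>] assms
    by (simp add: inner_L2_of trig_poly_square_integrable trig_poly_partial)
qed

lemma calV_trig_poly: "\<phi> \<in> calV \<Longrightarrow> trig_poly \<phi>"
  by (simp add: calV_def)

lemma rep_V_of:
  assumes "\<phi> \<in> calV"
  shows "rep_V (V_of \<phi>) = H1_of \<phi>"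
proof -
  have "H1_of \<phi> \<in> V_set"
    using assms closure_subset weak_partial_trig_poly[OF calV_trig_poly[OF assms]]
    by (force simp: V_set_def H1_def H1_of_def)
  then show ?thesis unfolding V_of_def by (rule abs_V_inverse)
qed

lemma V_of_add: "\<phi> \<in> calV \<Longrightarrow> \<psi> \<in> calV \<Longrightarrow> V_of (\<lambda>x. \<phi> x + \<psi> x) = V_of \<phi> + V_of \<psi>"
  by (simp add: rep_V_inject[symmetric] plus_V.rep_eq rep_V_of calV_add H1_of_add)

lemma V_of_scaleR: "\<phi> \<in> calV \<Longrightarrow> V_of (\<lambda>x. r *\<^sub>R \<phi> x) = r *\<^sub>R V_of \<phi>"
  by (simp add: rep_V_inject[symmetric] scaleR_V.rep_eq rep_V_of calV_scaleR H1_of_scaleR)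

lemma V_approximation:
  obtains \<phi> where "\<And>n. \<phi> n \<in> calV" "(\<lambda>n. V_of (\<phi> n)) \<longlonglongrightarrow> u"
proof -
  have "rep_V u \<in> closure (H1_of ` calV)" using rep_V[of u] by (simp add: V_set_def)
  then obtain p where p: "\<forall>n. p n \<in> H1_of ` calV" "p \<longlonglongrightarrow> rep_V u"
    unfolding closure_sequential by blast
  then have "\<forall>n. \<exists>\<phi>. \<phi> \<in> calV \<and> p n = H1_of \<phi>" by blast
  from choice[OF this] obtain \<phi> where \<phi>: "\<And>n. \<phi> n \<in> calV" "\<And>n. p n = H1_of (\<phi> n)" by blast
  have "dist (V_of (\<phi> n)) u = dist (p n) (rep_V u)" for n
    by (simp add: dist_V.rep_eq rep_V_of[OF \<phi>(1)] \<phi>(2))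
  with p(2) have "(\<lambda>n. V_of (\<phi> n)) \<longlonglongrightarrow> u" by (simp add: lim_sequentially)
  with \<phi>(1) that show thesis by blast
qed

lemma V_of_calV_dense: "closure (V_of ` calV) = UNIV"
proof -
  have "u \<in> closure (V_of ` calV)" for u
    unfolding closure_sequential using V_approximation[of u] by (metis image_eqI)
  then show ?thesis by auto
qed

lemma continuous_eq_on_V:
  fixes f g :: "V \<Rightarrow> 'a::t2_space"
  assumes "continuous_on UNIV f" "continuous_on UNIV g"
    and "\<And>\<phi>. \<phi> \<in> calV \<Longrightarrow> f (V_of \<phi>) = g (V_of \<phi>)"
  shows "f u = g u"
proof -
  obtain \<phi> where \<phi>: "\<And>n. \<phi> n \<in> calV" "(\<lambda>n. V_of (\<phi> n)) \<longlonglongrightarrow> u" using V_approximation by blast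
  have "(\<lambda>n. f (V_of (\<phi> n))) \<longlonglongrightarrow> f u" "(\<lambda>n. g (V_of (\<phi> n))) \<longlonglongrightarrow> g u"
    using assms(1,2) \<phi>(2) by (auto intro: continuous_on_tendsto_compose)
  then show ?thesis using assms(3) \<phi>(1) LIMSEQ_unique by fastforce
qed

definition V_grad :: "V \<Rightarrow> L2^3"
  where "V_grad u = snd (rep_V u)"

lemma norm_V_fun_le: "norm (V_fun u) \<le> norm u"
  unfolding V_fun_def norm_V.rep_eq using norm_fst_le[of "fst (rep_V u)" "snd (rep_V u)"] by simp

lemma norm_V_grad_le: "norm (V_grad u) \<le> norm u"
  unfolding V_grad_def norm_V.rep_eq using norm_snd_le[of "snd (rep_V u)" "fst (rep_V u)"] by simp

lemma bounded_linear_V_fun: "bounded_linear V_fun"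
  by (rule bounded_linear_intro[of _ 1])
    (simp_all add: norm_V_fun_le, simp_all add: V_fun_def plus_V.rep_eq scaleR_V.rep_eq)

lemma bounded_linear_V_grad: "bounded_linear V_grad"
  by (rule bounded_linear_intro[of _ 1])
    (simp_all add: norm_V_grad_le, simp_all add: V_grad_def plus_V.rep_eq scaleR_V.rep_eq)

lemma inner_V: "u \<bullet> w = V_fun u \<bullet> V_fun w + V_grad u \<bullet> V_grad w"
  by (simp add: inner_V.rep_eq V_fun_def V_grad_def inner_prod_def)

lemma V_fun_of: "\<phi> \<in> calV \<Longrightarrow> V_fun (V_of \<phi>) = L2_of \<phi>"
  by (simp add: V_fun_def rep_V_of H1_of_def)

lemma V_grad_of: "\<phi> \<in> calV \<Longrightarrow> V_grad (V_of \<phi>) $ i = L2_of (partial i \<phi>)"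
  by (simp add: V_grad_def rep_V_of H1_of_def)

lemma weak_partial_V: "weak_partial i (V_fun u) (V_grad u $ i)"
proof -
  have "(V_fun u, V_grad u) \<in> H1"
    using rep_V[of u] by (simp add: V_set_def V_fun_def V_grad_def)
  then show ?thesis by (simp add: H1_def)
qed

lemma V_fun_in_H: "V_fun u \<in> H"
proof -
  obtain \<phi> where \<phi>: "\<And>n. \<phi> n \<in> calV" "(\<lambda>n. V_of (\<phi> n)) \<longlonglongrightarrow> u" using V_approximation by blast
  have "(\<lambda>n. V_fun (V_of (\<phi> n))) \<longlonglongrightarrow> V_fun u"
    by (rule bounded_linear.tendsto[OF bounded_linear_V_fun \<phi>(2)])
  then show ?thesis
    using \<phi>(1) unfolding H_def closure_sequential
    by (intro exI[of _ "\<lambda>n. V_fun (V_of (\<phi> n))"]) (auto simp: V_fun_of)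
qed

section \<open>The Leray projection and the Stokes operator\<close>

lemma subspace_H: "subspace H"
proof (rule subspaceI)
  show "0 \<in> H" using V_fun_in_H[of 0] bounded_linear_V_fun by (simp add: linear_simps)
next
  fix f g assume "f \<in> H" "g \<in> H"
  then obtain p q where p: "\<forall>n. p n \<in> L2_of ` calV" "p \<longlonglongrightarrow> f"
    and q: "\<forall>n. q n \<in> L2_of ` calV" "q \<longlonglongrightarrow> g"
    unfolding H_def closure_sequential by blast
  have "a + b \<in> L2_of ` calV" if "a \<in> L2_of ` calV" "b \<in> L2_of ` calV" for a b
    using that by (auto simp: L2_of_add[symmetric] trig_poly_square_integrable calV_trig_poly calV_add)
  with p(1) q(1) have "\<forall>n. p n + q n \<in> L2_of ` calV" by blast
  with tendsto_add[OF p(2) q(2)] show "f + g \<in> H"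
    unfolding H_def closure_sequential by (intro exI conjI)
next
  fix r f assume "f \<in> H"
  then obtain p where p: "\<forall>n. p n \<in> L2_of ` calV" "p \<longlonglongrightarrow> f"
    unfolding H_def closure_sequential by blast
  have "r *\<^sub>R a \<in> L2_of ` calV" if "a \<in> L2_of ` calV" for a
    using that by (auto simp: L2_of_scaleR[symmetric] trig_poly_square_integrable calV_trig_poly calV_scaleR)
  with p(1) have "\<forall>n. r *\<^sub>R p n \<in> L2_of ` calV" by blast
  with tendsto_scaleR[OF tendsto_const[of r] p(2)] show "r *\<^sub>R f \<in> H"
    unfolding H_def closure_sequential by (intro exI conjI)
qed

lemma leray: "leray f \<in> H" "g \<in> H \<Longrightarrow> leray f \<bullet> g = f \<bullet> g"
proof -
  have "complete H" unfolding complete_eq_closed H_def by simp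
  then have "\<exists>h\<in>H. \<forall>g\<in>H. h \<bullet> g = f \<bullet> g"
    by (intro symmetric_Lax_Milgram[OF bounded_bilinear_inner inner_commute zero_less_one _ subspace_H]
        bounded_linear_inner_right) (simp_all add: power2_norm_eq_inner)
  then obtain h where h: "h \<in> H" "\<And>g. g \<in> H \<Longrightarrow> (f - h) \<bullet> g = 0" by (auto simp: inner_diff_left)
  have "leray f = h"
    unfolding leray_def
  proof (rule the_equality)
    fix k assume k: "k \<in> H \<and> (\<forall>g\<in>H. (f - k) \<bullet> g = 0)"
    have "k - h \<in> H" using k h subspace_diff[OF subspace_H] by blast
    then have "(f - h) \<bullet> (k - h) = 0" "(f - k) \<bullet> (k - h) = 0" using h k by auto
    then have "(k - h) \<bullet> (k - h) = 0" by (simp add: inner_diff_left)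
    then show "k = h" by simp
  qed (use h in auto)
  with h show "leray f \<in> H" "g \<in> H \<Longrightarrow> leray f \<bullet> g = f \<bullet> g" by (auto simp: inner_diff_left)
qed

text \<open>Since \<open>V\<close> lies in \<open>H\<close>, the projection onto \<open>H\<close> is invisible to the pairing with elements of \<open>V\<close>.\<close>

lemma L2_dual_leray: "L2_dual (leray f) = L2_dual f"
proof (rule blinfun_eqI)
  show "blinfun_apply (L2_dual (leray f)) w = blinfun_apply (L2_dual f) w" for w
    by (simp add: L2_dual.rep_eq leray(2) V_fun_in_H)
qed

lemma bounded_linear_L2_dual: "bounded_linear L2_dual"
proof (rule bounded_linear_intro[of _ 1])
  fix f g :: L2 and r
  show "L2_dual (f + g) = L2_dual f + L2_dual g"
    by (rule blinfun_eqI) (simp add: L2_dual.rep_eq inner_add_left blinfun.add_left)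
  show "L2_dual (r *\<^sub>R f) = r *\<^sub>R L2_dual f"
    by (rule blinfun_eqI) (simp add: L2_dual.rep_eq blinfun.scaleR_left)
  have "norm (f \<bullet> V_fun w) \<le> norm f * norm w" for w
    using Cauchy_Schwarz_ineq2[of f "V_fun w"] mult_left_mono[OF norm_V_fun_le[of w], of "norm f"]
    by simp
  then show "norm (L2_dual f) \<le> norm f * 1"
    by (intro norm_blinfun_bound) (auto simp: L2_dual.rep_eq)
qed

definition grad_form :: "V \<Rightarrow> V_dual"
  where "grad_form u = blinfun_inner_right (V_grad u) o\<^sub>L Blinfun V_grad"

lemma grad_form_apply: "blinfun_apply (grad_form u) w = V_grad u \<bullet> V_grad w"
proof -
  have "blinfun_apply (Blinfun V_grad) w = V_grad w"
    by (simp add: bounded_linear_Blinfun_apply bounded_linear_V_grad)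
  then show ?thesis by (simp add: grad_form_def)
qed

lemma bounded_linear_grad_form: "bounded_linear grad_form"
proof -
  have "bounded_linear (\<lambda>T. T o\<^sub>L Blinfun V_grad :: V_dual)"
    by (rule bounded_bilinear.bounded_linear_left[OF bounded_bilinear_blinfun_compose])
  moreover have "bounded_linear (\<lambda>u. blinfun_inner_right (V_grad u))"
    by (rule bounded_linear_compose[OF bounded_linear_blinfun_inner_right bounded_linear_V_grad])
  ultimately have "bounded_linear (\<lambda>u. blinfun_inner_right (V_grad u) o\<^sub>L Blinfun V_grad)"
    by (rule bounded_linear_compose)
  then show ?thesis by (simp add: grad_form_def[abs_def])
qed

lemma trig_poly_laplacian_L2:
  assumes "trig_poly \<phi>"
  shows "L2_of (laplacian \<phi>) = (\<Sum>i\<in>UNIV. L2_of (partial i (partial i \<phi>)))"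
proof -
  have t: "square_integrable (partial i (partial i \<phi>))" for i
    by (intro trig_poly_square_integrable trig_poly_partial assms)
  have "square_integrable (\<lambda>x. \<Sum>i\<in>I. partial i (partial i \<phi>) x) \<and>
    L2_of (\<lambda>x. \<Sum>i\<in>I. partial i (partial i \<phi>) x) = (\<Sum>i\<in>I. L2_of (partial i (partial i \<phi>)))"
    if "finite I" for I
    using that
    by induction (auto simp: square_integrable_zero zero_L2.abs_eq[symmetric] L2_of_add square_integrable_add t)
  then show ?thesis by (simp add: laplacian_def[abs_def])
qed

text \<open>The weak derivative of \<open>w\<close> is tested against the derivatives of \<open>\<phi>\<close>, which are trigonometric
  polynomials and hence test functions.\<close>

lemma grad_form_V_of:
  assumes "\<phi> \<in> calV"
  shows "grad_form (V_of \<phi>) = L2_dual (- leray (L2_of (laplacian \<phi>)))"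
proof (rule blinfun_eqI)
  fix w
  note t = calV_trig_poly[OF assms]
  have "V_fun w \<bullet> L2_of (partial i (partial i \<phi>)) = - (V_grad w $ i \<bullet> L2_of (partial i \<phi>))" for i
    using weak_partial_V[of i w] trig_poly_test_function[OF trig_poly_partial[OF t]]
    by (simp add: weak_partial_def)
  then have "blinfun_apply (grad_form (V_of \<phi>)) w = - (\<Sum>i\<in>UNIV. V_fun w \<bullet> L2_of (partial i (partial i \<phi>)))"
    by (simp add: grad_form_apply inner_vec_def V_grad_of assms inner_commute sum_negf)
  also have "\<dots> = - (L2_of (laplacian \<phi>) \<bullet> V_fun w)"
    by (simp add: trig_poly_laplacian_L2[OF t] inner_sum_right inner_commute)
  also have "\<dots> = blinfun_apply (L2_dual (- leray (L2_of (laplacian \<phi>)))) w"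
    by (simp add: L2_dual.rep_eq leray V_fun_in_H)
  finally show "blinfun_apply (grad_form (V_of \<phi>)) w = \<dots>" .
qed

lemma stokes_eq_grad_form: "stokes = grad_form"
  unfolding stokes_def
proof (rule the_equality)
  fix A assume A: "bounded_linear A \<and>
    (\<forall>\<phi>\<in>calV. A (V_of \<phi>) = L2_dual (- leray (L2_of (laplacian \<phi>))))"
  show "A = grad_form"
  proof
    fix u
    have "continuous_on UNIV A" "continuous_on UNIV grad_form"
      using linear_continuous_on[OF conjunct1[OF A], of UNIV]
        linear_continuous_on[OF bounded_linear_grad_form, of UNIV] .
    then show "A u = grad_form u"
    proof (rule continuous_eq_on_V[where f = A and g = grad_form])
      fix \<phi> assume "\<phi> \<in> calV"
      with A show "A (V_of \<phi>) = grad_form (V_of \<phi>)" by (metis grad_form_V_of)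
    qed
  qed
qed (auto simp: bounded_linear_grad_form grad_form_V_of)

lemma voigt_apply:
  "blinfun_apply (voigt \<alpha> u) w = \<alpha>\<^sup>2 * (V_grad u \<bullet> V_grad w) + V_fun u \<bullet> V_fun w"
  unfolding voigt_def stokes_eq_grad_form blinfun.add_left blinfun.scaleR_left
    grad_form_apply L2_dual.rep_eq by simp

lemma bounded_linear_voigt: "bounded_linear (voigt \<alpha>)"
proof -
  have "bounded_linear (\<lambda>u. \<alpha>\<^sup>2 *\<^sub>R grad_form u)"
    using bounded_linear_compose[OF bounded_linear_scaleR_right[of "\<alpha>\<^sup>2"] bounded_linear_grad_form] .
  moreover have "bounded_linear (\<lambda>u. L2_dual (V_fun u))"
    using bounded_linear_compose[OF bounded_linear_L2_dual bounded_linear_V_fun] .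
  ultimately show ?thesis
    unfolding voigt_def[abs_def] stokes_eq_grad_form by (rule bounded_linear_add)
qed

section \<open>A lattice sum\<close>

definition freq_sq :: "int^3 \<Rightarrow> real"
  where "freq_sq k = (\<Sum>i\<in>UNIV. (of_int (k $ i))\<^sup>2)"

lemma freq_sq_ge_1:
  assumes "k \<noteq> 0"
  shows "freq_sq k \<ge> 1"
proof -
  obtain i where i: "k $ i \<noteq> 0" using assms by (auto simp: vec_eq_iff)
  then have "1 \<le> \<bar>k $ i\<bar>" by simp
  then have "1 \<le> \<bar>real_of_int (k $ i)\<bar>" by linarith
  then have "1 \<le> (real_of_int (k $ i))\<^sup>2" by (simp add: abs_le_square_iff[of 1, simplified])
  also have "\<dots> \<le> freq_sq k" unfolding freq_sq_def by (rule member_le_sum) auto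
  finally show ?thesis .
qed

lemma inverse_square_powr_sum_bounded:
  obtains W :: real where "\<And>n::nat. (\<Sum>m\<in>{- int n..int n}. (1 + (of_int m)\<^sup>2) powr (- 2 / 3)) \<le> W"
proof -
  define v where "v m = (1 + (real m)\<^sup>2) powr (- 2 / 3)" for m
  have v0: "v m \<ge> 0" for m by (simp add: v_def)
  have "summable v"
  proof (rule summable_comparison_test')
    show "summable (\<lambda>m. real m powr (- 4 / 3))" by (subst summable_real_powr_iff) simp
    fix m :: nat assume m: "m \<ge> 1"
    have "v m \<le> ((real m)\<^sup>2) powr (- 2 / 3)"
      unfolding v_def using m by (intro powr_mono2') auto
    also have "(real m)\<^sup>2 = real m powr 2" using m by simp
    also have "(real m powr 2) powr (- 2 / 3) = real m powr (- 4 / 3)" by (subst powr_powr) simp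
    finally show "norm (v m) \<le> real m powr (- 4 / 3)" using v0 by simp
  qed
  then have v: "sum v {..n} \<le> suminf v" for n by (rule sum_le_suminf) (auto simp: v0)
  have "(\<Sum>m\<in>{- int n..int n}. (1 + (of_int m)\<^sup>2) powr (- 2 / 3)) \<le> 2 * suminf v" for n :: nat
  proof -
    let ?g = "\<lambda>m::int. (1 + (of_int m)\<^sup>2) powr (- 2 / 3 :: real)"
    have eq: "{- int n..int n} = int ` {..n} \<union> (\<lambda>m. - int m) ` {..n}"
    proof (intro equalityI subsetI)
      fix m assume "m \<in> {- int n..int n}"
      then have "m = int (nat m) \<and> nat m \<le> n \<or> m = - int (nat (- m)) \<and> nat (- m) \<le> n" by auto
      then show "m \<in> int ` {..n} \<union> (\<lambda>m. - int m) ` {..n}" by blast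
    qed auto
    have "sum ?g {- int n..int n} \<le> sum ?g (int ` {..n}) + sum ?g ((\<lambda>m. - int m) ` {..n})"
      unfolding eq by (subst sum_Un) (auto intro!: sum_nonneg)
    also have "\<dots> = sum v {..n} + sum v {..n}"
      by (simp add: sum.reindex inj_on_def v_def o_def)
    finally show ?thesis using v[of n] by simp
  qed
  with that show thesis by blast
qed

text \<open>As \<open>1 + \<bar>k\<bar>\<^sup>2\<close> dominates each factor \<open>1 + k\<^sub>i\<^sup>2\<close>, its power \<open>-2\<close> is at most the product of the powers
  \<open>(1 + k\<^sub>i\<^sup>2) powr (- 2 / 3)\<close>. The sum over a cube then factorises into three one-dimensional sums,
  which converge because the decay exponent \<open>4 / 3\<close> exceeds one.\<close>

lemma lattice_sum_bounded:
  obtains C :: real where "C > 0"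
    "\<And>S. finite S \<Longrightarrow> 0 \<notin> S \<Longrightarrow> (\<Sum>k\<in>S. 1 / (freq_sq k)\<^sup>2) \<le> C"
proof -
  define g where "g m = (1 + (of_int m)\<^sup>2) powr (- 2 / 3 :: real)" for m :: int
  obtain W where W: "\<And>n::nat. (\<Sum>m\<in>{- int n..int n}. g m) \<le> W"
    unfolding g_def using inverse_square_powr_sum_bounded by blast
  have g0: "g m \<ge> 0" for m by (simp add: g_def)
  have W0: "W \<ge> 0" using W[of 0] g0[of 0] by simp
  have term_le: "1 / (freq_sq k)\<^sup>2 \<le> 4 * (g (k $ 1) * g (k $ 2) * g (k $ 3))" if "k \<noteq> 0" for k
  proof -
    let ?q = "1 + freq_sq k"
    have q: "freq_sq k \<ge> 1" by (rule freq_sq_ge_1[OF that])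
    have ge: "?q powr (- 2 / 3) \<le> g (k $ i)" for i
      unfolding g_def freq_sq_def
      by (intro powr_mono2' add_left_mono member_le_sum add_pos_nonneg) auto
    have "1 / (freq_sq k)\<^sup>2 \<le> 4 / ?q\<^sup>2"
    proof -
      have "?q\<^sup>2 \<le> (2 * freq_sq k)\<^sup>2" using q by (intro power_mono) auto
      then show ?thesis using q by (simp add: divide_simps power_mult_distrib)
    qed
    also have "\<dots> = 4 * (?q powr (- 2 / 3) * ?q powr (- 2 / 3) * ?q powr (- 2 / 3))"
    proof -
      have "?q powr (- 2 / 3) * ?q powr (- 2 / 3) * ?q powr (- 2 / 3) = ?q powr (- 2)"
        by (simp add: powr_add[symmetric])
      also have "\<dots> = 1 / ?q\<^sup>2" using q by (simp add: powr_minus powr_numeral divide_inverse)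
      finally show ?thesis by simp
    qed
    also have "\<dots> \<le> 4 * (g (k $ 1) * g (k $ 2) * g (k $ 3))"
      by (intro mult_left_mono mult_mono ge) (auto simp: g0)
    finally show ?thesis .
  qed
  have "(\<Sum>k\<in>S. 1 / (freq_sq k)\<^sup>2) \<le> 4 * (W * W * W) + 1" if S: "finite S" "0 \<notin> S" for S
  proof -
    define p where "p k = (k $ 1, k $ 2, k $ 3)" for k :: "int^3"
    have inj: "inj p" by (auto simp: inj_def p_def vec_eq_iff forall_3)
    define n where "n = (\<Sum>k\<in>S. \<Sum>i\<in>UNIV. nat \<bar>k $ i\<bar>)"
    have n: "\<bar>k $ i\<bar> \<le> int n" if "k \<in> S" for k i
    proof -
      have "nat \<bar>k $ i\<bar> \<le> (\<Sum>i\<in>UNIV. nat \<bar>k $ i\<bar>)" by (rule member_le_sum) auto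
      also have "\<dots> \<le> n" unfolding n_def using that S by (intro member_le_sum) auto
      finally show ?thesis by linarith
    qed
    let ?I = "{- int n..int n}"
    have sub: "p ` S \<subseteq> ?I \<times> ?I \<times> ?I"
    proof (rule image_subsetI)
      fix k assume "k \<in> S"
      then show "p k \<in> ?I \<times> ?I \<times> ?I" using n[of k 1] n[of k 2] n[of k 3] by (simp add: p_def abs_le_iff)
    qed
    have "(\<Sum>k\<in>S. 1 / (freq_sq k)\<^sup>2) \<le> (\<Sum>k\<in>S. 4 * (g (k $ 1) * g (k $ 2) * g (k $ 3)))"
      using S by (intro sum_mono term_le) auto
    also have "\<dots> = 4 * (\<Sum>(a, b, c)\<in>p ` S. g a * g b * g c)"
      using inj by (subst sum.reindex) (auto simp: p_def sum_distrib_left intro: inj_on_subset)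
    also have "\<dots> \<le> 4 * (\<Sum>(a, b, c)\<in>?I \<times> ?I \<times> ?I. g a * g b * g c)"
      using sub by (intro mult_left_mono sum_mono2) (auto simp: g0)
    also have "(\<Sum>(a, b, c)\<in>?I \<times> ?I \<times> ?I. g a * g b * g c) = sum g ?I * sum g ?I * sum g ?I"
      by (simp add: sum.cartesian_product[symmetric] flip: sum_distrib_left sum_distrib_right)
    also have "\<dots> \<le> W * W * W"
      by (intro mult_mono W) (auto intro!: sum_nonneg mult_nonneg_nonneg simp: g0 W0)
    finally show ?thesis by simp
  qed
  moreover have "4 * (W * W * W) + 1 > 0" using W0 by (simp add: add_nonneg_pos)
  ultimately show thesis using that by blast
qed

text \<open>The Cauchy-Schwarz inequality with the weight \<open>\<bar>k\<bar> \<bar>l\<bar>\<close> bounds the squared coefficient at \<open>n\<close> by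
  the desired weighted sum over \<open>k + l = n\<close>, times the sum of \<open>1 / (\<bar>k\<bar>\<^sup>2 \<bar>l\<bar>\<^sup>2)\<close>. By the inequality
  between the geometric and the arithmetic mean the latter is at most half the sum of
  \<open>1 / \<bar>k\<bar>\<^sup>4 + 1 / \<bar>l\<bar>\<^sup>4\<close>, and for fixed \<open>n\<close> each of \<open>k\<close> and \<open>l\<close> determines the other.\<close>

lemma convolution_bound:
  fixes c d :: "int^3 \<Rightarrow> complex"
  assumes M: "finite M" "0 \<notin> M" and N: "finite N" "0 \<notin> N"
    and C: "C \<ge> 0" "\<And>S. finite S \<Longrightarrow> 0 \<notin> S \<Longrightarrow> (\<Sum>k\<in>S. 1 / (freq_sq k)\<^sup>2) \<le> C"
  shows "(\<Sum>n\<in>(\<lambda>(k, l). k + l) ` (M \<times> N). (cmod (\<Sum>(k, l)\<in>{p \<in> M \<times> N. (case p of (k, l) \<Rightarrow> k + l) = n}. c k * d l))\<^sup>2)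
    \<le> C * ((\<Sum>k\<in>M. freq_sq k * (cmod (c k))\<^sup>2) * (\<Sum>l\<in>N. freq_sq l * (cmod (d l))\<^sup>2))"
proof -
  define P where "P n = {p \<in> M \<times> N. (case p of (k, l) \<Rightarrow> k + l) = n}" for n
  have P: "finite (P n)" for n using M N by (auto simp: P_def)
  define h where "h = (\<lambda>(k, l). freq_sq k * (cmod (c k))\<^sup>2 * (freq_sq l * (cmod (d l))\<^sup>2))"
  have h0: "h p \<ge> 0" for p
    by (auto simp: h_def freq_sq_def split: prod.splits intro!: mult_nonneg_nonneg sum_nonneg)
  have "(cmod (\<Sum>(k, l)\<in>P n. c k * d l))\<^sup>2 \<le> C * sum h (P n)" for n
  proof -
    have q: "freq_sq k \<ge> 1" "freq_sq l \<ge> 1" if "(k, l) \<in> P n" for k l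
      using that M N by (auto simp: P_def intro!: freq_sq_ge_1)
    define a where "a = (\<lambda>(k, l). sqrt (freq_sq k * freq_sq l) * (cmod (c k) * cmod (d l)))"
    define b where "b = (\<lambda>(k, l). 1 / sqrt (freq_sq k * freq_sq l))"
    have b_le: "(\<Sum>p\<in>P n. (b p)\<^sup>2) \<le> C"
    proof -
      have "(\<Sum>p\<in>P n. (b p)\<^sup>2) \<le> (\<Sum>p\<in>P n. (1 / (freq_sq (fst p))\<^sup>2 + 1 / (freq_sq (snd p))\<^sup>2) / 2)"
      proof (rule sum_mono)
        fix p assume p: "p \<in> P n"
        obtain k l where kl: "p = (k, l)" by fastforce
        have k: "freq_sq k \<ge> 1" "freq_sq l \<ge> 1" using q p kl by auto
        then have "(b p)\<^sup>2 = (1 / freq_sq k) * (1 / freq_sq l)"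
          by (simp add: kl b_def power_divide)
        also have "\<dots> \<le> ((1 / freq_sq k)\<^sup>2 + (1 / freq_sq l)\<^sup>2) / 2"
          using sum_squares_bound[of "1 / freq_sq k" "1 / freq_sq l"] by simp
        finally show "(b p)\<^sup>2 \<le> (1 / (freq_sq (fst p))\<^sup>2 + 1 / (freq_sq (snd p))\<^sup>2) / 2"
          by (simp add: kl power_divide)
      qed
      also have "\<dots> = ((\<Sum>p\<in>P n. 1 / (freq_sq (fst p))\<^sup>2) + (\<Sum>p\<in>P n. 1 / (freq_sq (snd p))\<^sup>2)) / 2"
        by (simp add: sum.distrib sum_divide_distrib[symmetric])
      also have "(\<Sum>p\<in>P n. 1 / (freq_sq (fst p))\<^sup>2) = (\<Sum>k\<in>fst ` P n. 1 / (freq_sq k)\<^sup>2)"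
        by (subst sum.reindex) (auto simp: inj_on_def P_def)
      also have "\<dots> \<le> C" using P M by (intro C) (auto simp: P_def)
      also have "(\<Sum>p\<in>P n. 1 / (freq_sq (snd p))\<^sup>2) = (\<Sum>k\<in>snd ` P n. 1 / (freq_sq k)\<^sup>2)"
        by (subst sum.reindex) (auto simp: inj_on_def P_def)
      also have "\<dots> \<le> C" using P N by (intro C) (auto simp: P_def)
      finally show ?thesis by simp
    qed
    have "cmod (\<Sum>(k, l)\<in>P n. c k * d l) \<le> (\<Sum>p\<in>P n. a p * b p)"
    proof (rule sum_norm_le)
      fix p assume p: "p \<in> P n"
      obtain k l where kl: "p = (k, l)" by fastforce
      have "freq_sq k \<noteq> 0" "freq_sq l \<noteq> 0" using q[of k l] p kl by auto
      then show "norm (case p of (k, l) \<Rightarrow> c k * d l) \<le> a p * b p"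
        by (simp add: kl a_def b_def norm_mult)
    qed
    then have "(cmod (\<Sum>(k, l)\<in>P n. c k * d l))\<^sup>2 \<le> (\<Sum>p\<in>P n. a p * b p)\<^sup>2"
      by (intro power_mono) auto
    also have "\<dots> \<le> (\<Sum>p\<in>P n. (a p)\<^sup>2) * (\<Sum>p\<in>P n. (b p)\<^sup>2)" by (rule Cauchy_Schwarz_ineq_sum)
    also have "(\<Sum>p\<in>P n. (a p)\<^sup>2) = sum h (P n)"
      using q by (intro sum.cong refl)
        (force simp: a_def h_def power_mult_distrib algebra_simps real_sqrt_mult split: prod.splits)
    also have "sum h (P n) * (\<Sum>p\<in>P n. (b p)\<^sup>2) \<le> sum h (P n) * C"
      by (intro mult_left_mono b_le sum_nonneg h0)
    finally show ?thesis by (simp add: mult.commute)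
  qed
  then have "(\<Sum>n\<in>(\<lambda>(k, l). k + l) ` (M \<times> N). (cmod (\<Sum>(k, l)\<in>P n. c k * d l))\<^sup>2)
      \<le> (\<Sum>n\<in>(\<lambda>(k, l). k + l) ` (M \<times> N). C * sum h (P n))"
    by (intro sum_mono) auto
  also have "\<dots> = C * (\<Sum>n\<in>(\<lambda>(k, l). k + l) ` (M \<times> N). sum h (P n))"
    by (simp add: sum_distrib_left)
  also have "(\<Sum>n\<in>(\<lambda>(k, l). k + l) ` (M \<times> N). sum h (P n)) = sum h (M \<times> N)"
    unfolding P_def using M N by (intro sum.group) auto
  also have "\<dots> = (\<Sum>k\<in>M. freq_sq k * (cmod (c k))\<^sup>2) * (\<Sum>l\<in>N. freq_sq l * (cmod (d l))\<^sup>2)"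
    by (simp add: h_def sum_product sum.cartesian_product)
  finally show ?thesis by (simp add: P_def)
qed

section \<open>Fourier sums on the torus\<close>

definition fourier_sum :: "(int^3) set \<Rightarrow> (int^3 \<Rightarrow> complex) \<Rightarrow> real^3 \<Rightarrow> complex"
  where "fourier_sum M c x = (\<Sum>k\<in>M. c k * cis (phase k x))"

lemma phase_has_derivative: "(phase k has_derivative phase k) (at x)"
  unfolding phase_def[abs_def]
  by (intro has_derivative_mult_right has_derivative_sum
      bounded_linear_imp_has_derivative[OF bounded_linear_vec_nth])

lemma phase_continuous [continuous_intros]: "continuous_on S (phase k)"
  by (intro continuous_at_imp_continuous_on ballI has_derivative_continuous[OF phase_has_derivative])

lemma phase_add_freq: "phase (k + l) x = phase k x + phase l x"
  by (simp add: phase_def sum.distrib distrib_left distrib_right)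

lemma phase_minus_freq: "phase (- k) x = - phase k x"
  by (simp add: phase_def sum_negf)

lemma phase_zero_freq [simp]: "phase 0 x = 0"
  by (simp add: phase_def)

lemma integral_cos_sin_phase:
  assumes "k \<noteq> 0"
  shows "(\<integral>x. cos (phase k x) \<partial>torus) = 0" "(\<integral>x. sin (phase k x) \<partial>torus) = 0"
proof -
  obtain i where i: "k $ i \<noteq> 0" using assms by (auto simp: vec_eq_iff)
  define q where "q = of_int (k $ i) * (2 * pi)"
  have q: "q \<noteq> 0" "phase k (axis i 1) = q" using i by (auto simp: q_def phase_axis)
  have per: "cos (phase k (x + axis i 1)) = cos (phase k x)"
    "sin (phase k (x + axis i 1)) = sin (phase k x)" for x
    using cos.plus_of_int[of "phase k x" "k $ i"] sin.plus_of_int[of "phase k x" "k $ i"]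
    by (simp_all add: phase_add phase_axis)
  have "(\<integral>x. cos (phase k x) * phase k (axis i 1) / q \<partial>torus) = 0"
    by (rule integral_torus_derivative_eq_0[of "\<lambda>x. sin (phase k x) / q"])
      (use q in \<open>auto intro!: derivative_eq_intros phase_has_derivative continuous_intros simp: per\<close>)
  then show "(\<integral>x. cos (phase k x) \<partial>torus) = 0" using q by simp
  have "(\<integral>x. sin (phase k x) * phase k (axis i 1) / q \<partial>torus) = 0"
    by (rule integral_torus_derivative_eq_0[of "\<lambda>x. - cos (phase k x) / q"])
      (use q in \<open>auto intro!: derivative_eq_intros phase_has_derivative continuous_intros simp: per\<close>)
  then show "(\<integral>x. sin (phase k x) \<partial>torus) = 0" using q by simp
qed

lemma integral_torus_const: "(\<integral>x. c \<partial>torus) = (c :: 'a::{banach, second_countable_topology})"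
  by (simp add: emeasure_torus measure_def)

lemma continuous_cis_phase: "continuous_on UNIV (\<lambda>x. cis (phase k x))"
  by (intro continuous_intros continuous_on_compose2[of UNIV cis])
    (auto intro!: continuous_intros simp: cis_conv_exp)

lemma integrable_cis_phase: "integrable torus (\<lambda>x. cis (phase k x))"
  by (rule integrable_torus_continuous[OF continuous_cis_phase])

lemma integral_cis_phase: "(\<integral>x. cis (phase k x) \<partial>torus) = (if k = 0 then 1 else 0)"
proof (cases "k = 0")
  case True
  then show ?thesis using integral_torus_const[of "1::complex"] by simp
next
  case False
  have int: "integrable torus (\<lambda>x. cos (phase k x))" "integrable torus (\<lambda>x. sin (phase k x))"
    by (intro integrable_torus_continuous continuous_intros)+
  have "cis (phase k x) = of_real (cos (phase k x)) + \<i> * of_real (sin (phase k x))" for x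
    by (simp add: complex_eq_iff)
  then show ?thesis using False int by (simp add: integral_cos_sin_phase)
qed

lemma integral_fourier_sum:
  assumes "finite M"
  shows "(\<integral>x. fourier_sum M c x \<partial>torus) = (if 0 \<in> M then c 0 else 0)"
proof -
  have "(\<integral>x. fourier_sum M c x \<partial>torus) = (\<Sum>k\<in>M. \<integral>x. c k * cis (phase k x) \<partial>torus)"
    unfolding fourier_sum_def
    by (intro Bochner_Integration.integral_sum integrable_mult_right integrable_cis_phase)
  also have "\<dots> = (\<Sum>k\<in>M. if k = 0 then c 0 else 0)"
    by (intro sum.cong refl) (simp add: integral_cis_phase)
  finally show ?thesis using assms by simp
qed

lemma Parseval:
  assumes M: "finite M"
  shows "(\<integral>x. (cmod (fourier_sum M c x))\<^sup>2 \<partial>torus) = (\<Sum>k\<in>M. (cmod (c k))\<^sup>2)"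
proof -
  have "complex_of_real ((cmod (fourier_sum M c x))\<^sup>2)
      = (\<Sum>k\<in>M. \<Sum>l\<in>M. c k * cnj (c l) * cis (phase (k - l) x))" for x
  proof -
    have "complex_of_real ((cmod (fourier_sum M c x))\<^sup>2) = fourier_sum M c x * cnj (fourier_sum M c x)"
      by (rule complex_norm_square)
    also have "\<dots> = (\<Sum>k\<in>M. \<Sum>l\<in>M. (c k * cis (phase k x)) * (cnj (c l) * cis (- phase l x)))"
      by (simp add: fourier_sum_def sum_product cis_cnj)
    also have "\<dots> = (\<Sum>k\<in>M. \<Sum>l\<in>M. c k * cnj (c l) * cis (phase (k - l) x))"
    proof (intro sum.cong refl)
      fix k l
      have "phase (k - l) x = phase k x + - phase l x"
        using phase_add_freq[of k "- l" x] by (simp add: phase_minus_freq)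
      then show "(c k * cis (phase k x)) * (cnj (c l) * cis (- phase l x)) = c k * cnj (c l) * cis (phase (k - l) x)"
        by (simp only: cis_mult[symmetric] mult_ac)
    qed
    finally show ?thesis .
  qed
  then have "complex_of_real (\<integral>x. (cmod (fourier_sum M c x))\<^sup>2 \<partial>torus)
      = (\<integral>x. (\<Sum>k\<in>M. \<Sum>l\<in>M. c k * cnj (c l) * cis (phase (k - l) x)) \<partial>torus)"
    by (simp flip: integral_complex_of_real)
  also have "\<dots> = (\<Sum>k\<in>M. \<integral>x. (\<Sum>l\<in>M. c k * cnj (c l) * cis (phase (k - l) x)) \<partial>torus)"
    by (intro Bochner_Integration.integral_sum Bochner_Integration.integrable_sum integrable_mult_right
        integrable_cis_phase)
  also have "\<dots> = (\<Sum>k\<in>M. \<Sum>l\<in>M. \<integral>x. c k * cnj (c l) * cis (phase (k - l) x) \<partial>torus)"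
    by (intro sum.cong refl Bochner_Integration.integral_sum integrable_mult_right
        integrable_cis_phase)
  also have "\<dots> = (\<Sum>k\<in>M. \<Sum>l\<in>M. if l = k then c k * cnj (c k) else 0)"
    by (intro sum.cong refl) (auto simp: integral_cis_phase)
  also have "\<dots> = (\<Sum>k\<in>M. complex_of_real ((cmod (c k))\<^sup>2))"
    using M by (intro sum.cong refl) (simp add: complex_norm_square del: of_real_power)
  finally show ?thesis by (metis of_real_eq_iff of_real_sum)
qed

text \<open>In a representation of a trigonometric polynomial by cosines and sines both \<open>k\<close> and \<open>- k\<close> may
  occur in \<open>K\<close>. Parseval's identity needs one coefficient for each frequency, so the contributions
  of the two are added up.\<close>

definition trig_coeff :: "(int^3) set \<Rightarrow> (int^3 \<Rightarrow> real) \<Rightarrow> (int^3 \<Rightarrow> real) \<Rightarrow> int^3 \<Rightarrow> complex"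
  where "trig_coeff K a b k = ((if k \<in> K then of_real (a k) - \<i> * of_real (b k) else 0)
    + (if - k \<in> K then of_real (a (- k)) + \<i> * of_real (b (- k)) else 0)) / 2"

lemma fourier_sum_trig_coeff:
  assumes K: "finite K"
  shows "fourier_sum (K \<union> uminus ` K) (trig_coeff K a b) x
    = of_real (\<Sum>k\<in>K. cos (phase k x) * a k + sin (phase k x) * b k)"
proof -
  let ?M = "K \<union> uminus ` K"
  define p where "p k = (of_real (a k) - \<i> * of_real (b k)) * cis (phase k x)" for k
  define q where "q k = (of_real (a k) + \<i> * of_real (b k)) * cis (- phase k x)" for k
  have fin: "finite ?M" using K by simp
  have "fourier_sum ?M (trig_coeff K a b) x
      = (\<Sum>k\<in>?M. ((if k \<in> K then p k else 0) + (if - k \<in> K then q (- k) else 0)) / 2)"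
    unfolding fourier_sum_def
    by (intro sum.cong refl) (auto simp: trig_coeff_def p_def q_def phase_minus_freq algebra_simps)
  also have "\<dots> = ((\<Sum>k\<in>?M. if k \<in> K then p k else 0) + (\<Sum>k\<in>?M. if - k \<in> K then q (- k) else 0)) / 2"
    by (simp add: sum.distrib sum_divide_distrib[symmetric])
  also have "(\<Sum>k\<in>?M. if k \<in> K then p k else 0) = sum p K"
    using fin by (subst sum.inter_restrict[symmetric]) (auto intro!: arg_cong[where f = "sum p"])
  also have "(\<Sum>k\<in>?M. if - k \<in> K then q (- k) else 0) = (\<Sum>k\<in>uminus ` K. q (- k))"
  proof -
    have "- k \<in> K \<longleftrightarrow> k \<in> uminus ` K" for k by (metis image_iff minus_minus)
    then show ?thesis using fin by (intro sum.mono_neutral_cong_right) simp_all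
  qed
  also have "\<dots> = sum q K" by (subst sum.reindex) (auto simp: inj_on_def)
  also have "(sum p K + sum q K) / 2 = (\<Sum>k\<in>K. (p k + q k) / 2)"
    by (simp add: sum.distrib sum_divide_distrib[symmetric])
  also have "\<dots> = (\<Sum>k\<in>K. of_real (cos (phase k x) * a k + sin (phase k x) * b k))"
    by (intro sum.cong refl) (simp add: p_def q_def complex_eq_iff algebra_simps)
  finally show ?thesis by simp
qed

lemma trig_coeff_derivative:
  "trig_coeff K (\<lambda>k. of_int (k $ i) * r * b k) (\<lambda>k. - (of_int (k $ i) * r * a k)) k
    = \<i> * of_real (of_int (k $ i) * r) * trig_coeff K a b k"
  by (simp add: trig_coeff_def algebra_simps add_divide_distrib diff_divide_distrib)

text \<open>The coefficient at frequency zero is the mean of \<open>\<phi>\<close>, which vanishes; this is what makes the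
  weights \<open>1 / \<bar>k\<bar>\<close> of the product estimate available.\<close>

lemma calV_fourier:
  assumes "\<phi> \<in> calV"
  obtains M c where "finite M" "0 \<notin> M"
    "\<And>x j. of_real (\<phi> x $ j) = fourier_sum M (c j) x"
    "\<And>x i j. of_real (partial i \<phi> x $ j) = fourier_sum M (\<lambda>k. \<i> * of_real (of_int (k $ i) * (2 * pi)) * c j k) x"
proof -
  obtain K a b where K: "finite K" "\<phi> = trig_sum K a b"
    using calV_trig_poly[OF assms] by (auto simp: trig_poly_def)
  define M where "M = K \<union> uminus ` K"
  define c where "c j = trig_coeff K (\<lambda>k. a k $ j) (\<lambda>k. b k $ j)" for j
  have fin: "finite M" using K by (simp add: M_def)
  have 1: "of_real (\<phi> x $ j) = fourier_sum M (c j) x" for x j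
    by (simp add: M_def c_def fourier_sum_trig_coeff K trig_sum_def sum_component)
  have 2: "of_real (partial i \<phi> x $ j) = fourier_sum M (\<lambda>k. \<i> * of_real (of_int (k $ i) * (2 * pi)) * c j k) x"
    for x i j
  proof -
    have "of_real (partial i \<phi> x $ j) = fourier_sum M
        (trig_coeff K (\<lambda>k. of_int (k $ i) * (2 * pi) * (b k $ j)) (\<lambda>k. - (of_int (k $ i) * (2 * pi) * (a k $ j)))) x"
      by (simp add: M_def fourier_sum_trig_coeff K(1) K(2) partial_trig_sum trig_sum_def[of K "\<lambda>k. _ k *\<^sub>R _ k"]
          trig_sum_def sum_component mult_ac)
    then show ?thesis unfolding trig_coeff_derivative c_def .
  qed
  have mean: "(if 0 \<in> M then c j 0 else 0) = 0" for j
  proof -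
    have int: "integrable torus \<phi>" by (rule trig_poly_square_integrable(2)[OF calV_trig_poly[OF assms]])
    have "(\<integral>x. \<phi> x $ j \<partial>torus) = (\<integral>x. \<phi> x \<partial>torus) $ j"
      by (rule integral_bounded_linear[OF bounded_linear_vec_nth int])
    also have "\<dots> = 0" using assms by (simp add: calV_def)
    finally have "(\<integral>x. complex_of_real (\<phi> x $ j) \<partial>torus) = 0" by simp
    then show ?thesis by (simp add: 1 integral_fourier_sum[OF fin])
  qed
  \<comment> \<open>The frequency zero may now be removed from \<open>M\<close>; the derivatives have coefficient zero there.\<close>
  have drop: "fourier_sum M d x = fourier_sum (M - {0}) d x" if "0 \<in> M \<Longrightarrow> d 0 = 0" for d x
    unfolding fourier_sum_def using that fin by (intro sum.mono_neutral_right) auto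
  show thesis
  proof (rule that[of "M - {0}" c])
    show "of_real (\<phi> x $ j) = fourier_sum (M - {0}) (c j) x" for x j
      using 1[of x j] drop[of "c j" x] mean[of j] by (simp split: if_splits)
    show "of_real (partial i \<phi> x $ j)
        = fourier_sum (M - {0}) (\<lambda>k. \<i> * of_real (of_int (k $ i) * (2 * pi)) * c j k) x" for x i j
      unfolding 2 by (rule drop) simp
  qed (use fin in auto)
qed

section \<open>A Ladyzhenskaya type product estimate\<close>

lemma norm_V_grad_of:
  assumes "\<phi> \<in> calV"
  shows "(norm (V_grad (V_of \<phi>)))\<^sup>2 = (\<Sum>i\<in>UNIV. (norm (L2_of (partial i \<phi>)))\<^sup>2)"
  by (simp add: norm_vec_def L2_set_def V_grad_of[OF assms] sum_nonneg)

text \<open>Parseval's identity for the partial derivatives, in which the factor \<open>(2 \<pi>)\<^sup>2 \<ge> 1\<close> is dropped.\<close>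

lemma calV_gradient_coefficients:
  assumes \<phi>: "\<phi> \<in> calV" and M: "finite M"
    and c: "\<And>x i. of_real (partial i \<phi> x $ j) = fourier_sum M (\<lambda>k. \<i> * of_real (of_int (k $ i) * (2 * pi)) * c k) x"
  shows "(\<Sum>k\<in>M. freq_sq k * (cmod (c k))\<^sup>2) \<le> (norm (V_grad (V_of \<phi>)))\<^sup>2"
proof -
  note t = trig_poly_partial[OF calV_trig_poly[OF \<phi>]]
  have le: "(\<Sum>k\<in>M. (of_int (k $ i))\<^sup>2 * (cmod (c k))\<^sup>2) \<le> (norm (L2_of (partial i \<phi>)))\<^sup>2" for i
  proof -
    have sq: "square_integrable (partial i \<phi>)" by (rule trig_poly_square_integrable[OF t])
    have cont: "continuous_on UNIV (partial i \<phi>)" by (rule trig_poly_continuous[OF t])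
    have "(\<Sum>k\<in>M. (of_int (k $ i))\<^sup>2 * (cmod (c k))\<^sup>2) \<le> (\<Sum>k\<in>M. (cmod (\<i> * of_real (of_int (k $ i) * (2 * pi)) * c k))\<^sup>2)"
    proof (rule sum_mono)
      fix k
      have "1 \<le> (2 * pi)\<^sup>2" using pi_ge_two by (intro one_le_power) simp
      then have "(of_int (k $ i))\<^sup>2 * (cmod (c k))\<^sup>2 * 1 \<le> (of_int (k $ i))\<^sup>2 * (cmod (c k))\<^sup>2 * (2 * pi)\<^sup>2"
        by (intro mult_left_mono) auto
      then show "(of_int (k $ i))\<^sup>2 * (cmod (c k))\<^sup>2 \<le> (cmod (\<i> * of_real (of_int (k $ i) * (2 * pi)) * c k))\<^sup>2"
        by (simp add: norm_mult power_mult_distrib abs_mult mult_ac)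
    qed
    also have "\<dots> = (\<integral>x. (cmod (of_real (partial i \<phi> x $ j)))\<^sup>2 \<partial>torus)"
      unfolding c by (rule Parseval[OF M, symmetric])
    also have "\<dots> \<le> (\<integral>x. (norm (partial i \<phi> x))\<^sup>2 \<partial>torus)"
    proof (rule integral_mono)
      show "integrable torus (\<lambda>x. (cmod (of_real (partial i \<phi> x $ j)))\<^sup>2)"
        by (intro integrable_torus_continuous continuous_intros cont)
      show "integrable torus (\<lambda>x. (norm (partial i \<phi> x))\<^sup>2)"
        using sq by (simp add: square_integrable_def)
      show "(cmod (of_real (partial i \<phi> x $ j)))\<^sup>2 \<le> (norm (partial i \<phi> x))\<^sup>2" for x
        by (intro power_mono) (auto simp: component_le_norm_cart)
    qed
    also have "\<dots> = (norm (L2_of (partial i \<phi>)))\<^sup>2" by (rule norm_L2_of[OF sq, symmetric])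
    finally show ?thesis .
  qed
  have "(\<Sum>k\<in>M. freq_sq k * (cmod (c k))\<^sup>2) = (\<Sum>i\<in>UNIV. \<Sum>k\<in>M. (of_int (k $ i))\<^sup>2 * (cmod (c k))\<^sup>2)"
    by (subst sum.swap) (simp add: freq_sq_def sum_distrib_right)
  also have "\<dots> \<le> (norm (V_grad (V_of \<phi>)))\<^sup>2"
    unfolding norm_V_grad_of[OF \<phi>] by (intro sum_mono le)
  finally show ?thesis .
qed

text \<open>The Fourier coefficients of a product are the convolution of those of its factors.\<close>

lemma product_estimate:
  obtains C :: real where "C > 0" "\<And>\<phi> w i j. \<phi> \<in> calV \<Longrightarrow> w \<in> calV \<Longrightarrow>
    (\<integral>x. (\<phi> x $ i * w x $ j)\<^sup>2 \<partial>torus) \<le> C * ((norm (V_grad (V_of \<phi>)))\<^sup>2 * (norm (V_grad (V_of w)))\<^sup>2)"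
proof -
  obtain C :: real where C: "C > 0" "\<And>S. finite S \<Longrightarrow> 0 \<notin> S \<Longrightarrow> (\<Sum>k\<in>S. 1 / (freq_sq k)\<^sup>2) \<le> C"
    using lattice_sum_bounded by blast
  have "(\<integral>x. (\<phi> x $ i * w x $ j)\<^sup>2 \<partial>torus) \<le> C * ((norm (V_grad (V_of \<phi>)))\<^sup>2 * (norm (V_grad (V_of w)))\<^sup>2)"
    if \<phi>: "\<phi> \<in> calV" and w: "w \<in> calV" for \<phi> w i j
  proof -
    obtain M c where M: "finite M" "0 \<notin> M" and c: "\<And>x j. of_real (\<phi> x $ j) = fourier_sum M (c j) x"
      "\<And>x i j. of_real (partial i \<phi> x $ j) = fourier_sum M (\<lambda>k. \<i> * of_real (of_int (k $ i) * (2 * pi)) * c j k) x"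
      using calV_fourier[OF \<phi>] by blast
    obtain N d where N: "finite N" "0 \<notin> N" and d: "\<And>x j. of_real (w x $ j) = fourier_sum N (d j) x"
      "\<And>x i j. of_real (partial i w x $ j) = fourier_sum N (\<lambda>k. \<i> * of_real (of_int (k $ i) * (2 * pi)) * d j k) x"
      using calV_fourier[OF w] by blast
    define P where "P = (\<lambda>(k, l). k + l) ` (M \<times> N)"
    define h where "h n = (\<Sum>(k, l)\<in>{p \<in> M \<times> N. (case p of (k, l) \<Rightarrow> k + l) = n}. c i k * d j l)" for n
    have P: "finite P" using M N by (simp add: P_def)
    have prod: "complex_of_real (\<phi> x $ i * w x $ j) = fourier_sum P h x" for x
    proof -
      have "complex_of_real (\<phi> x $ i * w x $ j) = fourier_sum M (c i) x * fourier_sum N (d j) x"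
        by (simp add: c(1) d(1))
      also have "\<dots> = (\<Sum>(k, l)\<in>M \<times> N. (c i k * d j l) * cis (phase (k + l) x))"
        by (simp add: fourier_sum_def sum_product sum.cartesian_product phase_add_freq cis_mult[symmetric] mult_ac)
      also have "\<dots> = (\<Sum>n\<in>P. \<Sum>(k, l)\<in>{p \<in> M \<times> N. (case p of (k, l) \<Rightarrow> k + l) = n}.
          (c i k * d j l) * cis (phase (k + l) x))"
        unfolding P_def using M N by (intro sum.group[symmetric]) auto
      also have "\<dots> = fourier_sum P h x"
        unfolding fourier_sum_def h_def sum_distrib_right
        by (intro sum.cong refl) auto
      finally show ?thesis .
    qed
    have "(\<integral>x. (\<phi> x $ i * w x $ j)\<^sup>2 \<partial>torus) = (\<integral>x. (cmod (complex_of_real (\<phi> x $ i * w x $ j)))\<^sup>2 \<partial>torus)"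
      by (simp only: norm_of_real power2_abs)
    also have "\<dots> = (\<Sum>n\<in>P. (cmod (h n))\<^sup>2)"
      unfolding prod by (rule Parseval[OF P])
    also have "\<dots> \<le> C * ((\<Sum>k\<in>M. freq_sq k * (cmod (c i k))\<^sup>2) * (\<Sum>l\<in>N. freq_sq l * (cmod (d j l))\<^sup>2))"
      unfolding P_def h_def using C by (intro convolution_bound M N) auto
    also have "\<dots> \<le> C * ((norm (V_grad (V_of \<phi>)))\<^sup>2 * (norm (V_grad (V_of w)))\<^sup>2)"
      using C by (intro mult_left_mono mult_mono calV_gradient_coefficients[OF \<phi> M(1) c(2)]
          calV_gradient_coefficients[OF w N(1) d(2)] sum_nonneg mult_nonneg_nonneg)
        (auto simp: freq_sq_def intro!: sum_nonneg)
    finally show ?thesis .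
  qed
  with C(1) that show thesis by blast
qed

section \<open>The convection form\<close>

lemma convect_continuous:
  assumes "trig_poly \<phi>" "trig_poly \<psi>"
  shows "continuous_on UNIV (convect \<phi> \<psi>)"
  unfolding convect_def[abs_def]
  by (intro continuous_intros trig_poly_continuous trig_poly_partial assms)

lemma convect_add_left: "convect (\<lambda>x. \<phi> x + \<phi>' x) \<psi> = (\<lambda>x. convect \<phi> \<psi> x + convect \<phi>' \<psi> x)"
  by (simp add: convect_def fun_eq_iff scaleR_add_left sum.distrib)

lemma convect_scaleR_left: "convect (\<lambda>x. r *\<^sub>R \<phi> x) \<psi> = (\<lambda>x. r *\<^sub>R convect \<phi> \<psi> x)"
  by (simp add: convect_def fun_eq_iff scaleR_sum_right)

lemma convect_add_right:
  "trig_poly \<psi> \<Longrightarrow> trig_poly \<psi>' \<Longrightarrow> convect \<phi> (\<lambda>x. \<psi> x + \<psi>' x) = (\<lambda>x. convect \<phi> \<psi> x + convect \<phi> \<psi>' x)"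
  by (simp add: convect_def fun_eq_iff partial_add scaleR_add_right sum.distrib)

lemma convect_scaleR_right:
  "trig_poly \<psi> \<Longrightarrow> convect \<phi> (\<lambda>x. r *\<^sub>R \<psi> x) = (\<lambda>x. r *\<^sub>R convect \<phi> \<psi> x)"
  by (simp add: convect_def fun_eq_iff partial_scaleR scaleR_sum_right mult.commute)

text \<open>The functional \<open>B(\<phi>, \<psi>)\<close> for classical arguments, with the projection removed in view of
  \<open>L2_dual_leray\<close>.\<close>

definition convect_dual :: "(real^3 \<Rightarrow> real^3) \<Rightarrow> (real^3 \<Rightarrow> real^3) \<Rightarrow> V_dual"
  where "convect_dual \<phi> \<psi> = L2_dual (L2_of (convect \<phi> \<psi>))"

lemma convect_square_integrable:
  "\<phi> \<in> calV \<Longrightarrow> \<psi> \<in> calV \<Longrightarrow> square_integrable (convect \<phi> \<psi>)"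
  by (intro square_integrable_continuous convect_continuous calV_trig_poly)

lemma convect_dual_add_left:
  "\<phi> \<in> calV \<Longrightarrow> \<phi>' \<in> calV \<Longrightarrow> \<psi> \<in> calV \<Longrightarrow>
    convect_dual (\<lambda>x. \<phi> x + \<phi>' x) \<psi> = convect_dual \<phi> \<psi> + convect_dual \<phi>' \<psi>"
  using bounded_linear_L2_dual
  by (simp add: convect_dual_def convect_add_left L2_of_add convect_square_integrable linear_simps)

lemma convect_dual_scaleR_left:
  "\<phi> \<in> calV \<Longrightarrow> \<psi> \<in> calV \<Longrightarrow> convect_dual (\<lambda>x. r *\<^sub>R \<phi> x) \<psi> = r *\<^sub>R convect_dual \<phi> \<psi>"
  using bounded_linear_L2_dual
  by (simp add: convect_dual_def convect_scaleR_left L2_of_scaleR convect_square_integrable linear_simps)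

lemma convect_dual_add_right:
  "\<phi> \<in> calV \<Longrightarrow> \<psi> \<in> calV \<Longrightarrow> \<psi>' \<in> calV \<Longrightarrow>
    convect_dual \<phi> (\<lambda>x. \<psi> x + \<psi>' x) = convect_dual \<phi> \<psi> + convect_dual \<phi> \<psi>'"
  using bounded_linear_L2_dual
  by (simp add: convect_dual_def convect_add_right calV_trig_poly L2_of_add convect_square_integrable linear_simps)

lemma convect_dual_scaleR_right:
  "\<phi> \<in> calV \<Longrightarrow> \<psi> \<in> calV \<Longrightarrow> convect_dual \<phi> (\<lambda>x. r *\<^sub>R \<psi> x) = r *\<^sub>R convect_dual \<phi> \<psi>"
  using bounded_linear_L2_dual
  by (simp add: convect_dual_def convect_scaleR_right calV_trig_poly L2_of_scaleR convect_square_integrable linear_simps)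

lemma convect_dual_apply:
  assumes "\<phi> \<in> calV" "\<psi> \<in> calV" "w \<in> calV"
  shows "blinfun_apply (convect_dual \<phi> \<psi>) (V_of w) = (\<Sum>i\<in>UNIV. \<integral>x. \<phi> x $ i * (partial i \<psi> x \<bullet> w x) \<partial>torus)"
proof -
  note t = assms[THEN calV_trig_poly]
  note c = t[THEN trig_poly_continuous]
  have "blinfun_apply (convect_dual \<phi> \<psi>) (V_of w) = (\<integral>x. convect \<phi> \<psi> x \<bullet> w x \<partial>torus)"
    by (simp add: convect_dual_def L2_dual.rep_eq V_fun_of assms inner_L2_of convect_square_integrable
        trig_poly_square_integrable t)
  also have "\<dots> = (\<integral>x. (\<Sum>i\<in>UNIV. \<phi> x $ i * (partial i \<psi> x \<bullet> w x)) \<partial>torus)"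
    by (simp add: convect_def inner_sum_left)
  also have "\<dots> = (\<Sum>i\<in>UNIV. \<integral>x. \<phi> x $ i * (partial i \<psi> x \<bullet> w x) \<partial>torus)"
    by (intro Bochner_Integration.integral_sum integrable_torus_continuous continuous_intros c
        trig_poly_continuous[OF trig_poly_partial[OF t(2)]])
  finally show ?thesis .
qed

text \<open>The undifferentiated factors are combined into \<open>\<phi>\<^sub>i w\<close>, which is controlled in \<open>L\<^sup>2\<close> by the product
  estimate, and paired with \<open>\<partial>\<^sub>i\<psi>\<close>.\<close>

lemma convect_dual_bound_on_calV:
  obtains K :: real where "K \<ge> 0" "\<And>\<phi> \<psi> w. \<phi> \<in> calV \<Longrightarrow> \<psi> \<in> calV \<Longrightarrow> w \<in> calV \<Longrightarrow>
    \<bar>blinfun_apply (convect_dual \<phi> \<psi>) (V_of w)\<bar> \<le> K * norm (V_of \<phi>) * norm (V_of \<psi>) * norm (V_of w)"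
proof -
  obtain C :: real where C: "C > 0" "\<And>\<phi> w i j. \<phi> \<in> calV \<Longrightarrow> w \<in> calV \<Longrightarrow>
    (\<integral>x. (\<phi> x $ i * w x $ j)\<^sup>2 \<partial>torus) \<le> C * ((norm (V_grad (V_of \<phi>)))\<^sup>2 * (norm (V_grad (V_of w)))\<^sup>2)"
    using product_estimate by blast
  define K where "K = 3 * sqrt (3 * C)"
  have "\<bar>blinfun_apply (convect_dual \<phi> \<psi>) (V_of w)\<bar> \<le> K * norm (V_of \<phi>) * norm (V_of \<psi>) * norm (V_of w)"
    if \<phi>: "\<phi> \<in> calV" and \<psi>: "\<psi> \<in> calV" and w: "w \<in> calV" for \<phi> \<psi> w
  proof -
    note t = \<phi>[THEN calV_trig_poly] \<psi>[THEN calV_trig_poly] w[THEN calV_trig_poly]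
    note c = t[THEN trig_poly_continuous]
    let ?a = "norm (V_of \<phi>)" and ?b = "norm (V_of \<psi>)" and ?c = "norm (V_of w)"
    have le: "\<bar>\<integral>x. \<phi> x $ i * (partial i \<psi> x \<bullet> w x) \<partial>torus\<bar> \<le> sqrt (3 * C) * ?a * ?c * ?b" for i
    proof -
      define F where "F x = \<phi> x $ i *\<^sub>R w x" for x
      have F: "square_integrable F" unfolding F_def
        by (intro square_integrable_continuous continuous_intros c)
      have sq: "square_integrable (partial i \<psi>)"
        by (intro trig_poly_square_integrable trig_poly_partial t)
      have "(norm (L2_of F))\<^sup>2 = (\<integral>x. (\<Sum>j\<in>UNIV. (\<phi> x $ i * w x $ j)\<^sup>2) \<partial>torus)"
      proof -
        have "(norm (F x))\<^sup>2 = (\<Sum>j\<in>UNIV. (\<phi> x $ i * w x $ j)\<^sup>2)" for x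
          unfolding power2_norm_eq_inner F_def inner_vec_def by (simp add: power2_eq_square)
        then show ?thesis by (simp add: norm_L2_of[OF F])
      qed
      also have "\<dots> = (\<Sum>j\<in>UNIV. \<integral>x. (\<phi> x $ i * w x $ j)\<^sup>2 \<partial>torus)"
        by (intro Bochner_Integration.integral_sum integrable_torus_continuous continuous_intros c)
      also have "\<dots> \<le> (\<Sum>j\<in>(UNIV::3 set). C * ((norm (V_grad (V_of \<phi>)))\<^sup>2 * (norm (V_grad (V_of w)))\<^sup>2))"
        by (intro sum_mono C \<phi> w)
      also have "\<dots> \<le> (\<Sum>j\<in>(UNIV::3 set). C * (?a\<^sup>2 * ?c\<^sup>2))"
        using C(1) by (intro sum_mono mult_left_mono mult_mono power_mono norm_V_grad_le) auto
      also have "\<dots> = (sqrt (3 * C) * ?a * ?c)\<^sup>2"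
        using C(1) by (simp add: power_mult_distrib)
      finally have F_le: "norm (L2_of F) \<le> sqrt (3 * C) * ?a * ?c"
        by (rule power2_le_imp_le) (use C(1) in simp)
      have "norm (L2_of (partial i \<psi>)) \<le> norm (V_grad (V_of \<psi>))"
        using Finite_Cartesian_Product.norm_nth_le[of "V_grad (V_of \<psi>)" i] by (simp add: V_grad_of \<psi>)
      also have "\<dots> \<le> ?b" by (rule norm_V_grad_le)
      finally have \<psi>_le: "norm (L2_of (partial i \<psi>)) \<le> ?b" .
      have "(\<integral>x. \<phi> x $ i * (partial i \<psi> x \<bullet> w x) \<partial>torus) = L2_of F \<bullet> L2_of (partial i \<psi>)"
        by (simp add: inner_L2_of F sq) (simp add: F_def inner_commute)
      then have "\<bar>\<integral>x. \<phi> x $ i * (partial i \<psi> x \<bullet> w x) \<partial>torus\<bar> \<le> norm (L2_of F) * norm (L2_of (partial i \<psi>))"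
        using Cauchy_Schwarz_ineq2 by metis
      also have "\<dots> \<le> (sqrt (3 * C) * ?a * ?c) * ?b"
        using C(1) by (intro mult_mono F_le \<psi>_le) auto
      finally show ?thesis .
    qed
    have "\<bar>blinfun_apply (convect_dual \<phi> \<psi>) (V_of w)\<bar> \<le> (\<Sum>i\<in>(UNIV::3 set). sqrt (3 * C) * ?a * ?c * ?b)"
      unfolding convect_dual_apply[OF \<phi> \<psi> w] by (intro order_trans[OF sum_abs] sum_mono le)
    then show ?thesis by (simp add: K_def mult_ac)
  qed
  moreover have "K \<ge> 0" using C(1) by (simp add: K_def)
  ultimately show thesis using that by blast
qed

lemma norm_blinfun_le_on_calV:
  fixes T :: "V \<Rightarrow>\<^sub>L 'b::real_normed_vector"
  assumes K: "K \<ge> 0" and le: "\<And>\<phi>. \<phi> \<in> calV \<Longrightarrow> norm (blinfun_apply T (V_of \<phi>)) \<le> K * norm (V_of \<phi>)"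
  shows "norm T \<le> K"
proof (rule norm_blinfun_bound[OF K])
  fix u
  obtain \<phi> where \<phi>: "\<And>n. \<phi> n \<in> calV" "(\<lambda>n. V_of (\<phi> n)) \<longlonglongrightarrow> u" using V_approximation by blast
  have "(\<lambda>n. norm (blinfun_apply T (V_of (\<phi> n)))) \<longlonglongrightarrow> norm (blinfun_apply T u)"
    "(\<lambda>n. K * norm (V_of (\<phi> n))) \<longlonglongrightarrow> K * norm u"
    by (intro tendsto_intros \<phi>)+
  then show "norm (blinfun_apply T u) \<le> K * norm u"
    by (rule LIMSEQ_le) (use le \<phi>(1) in blast)
qed

lemma blinfun_eq_on_calV:
  fixes S T :: "V \<Rightarrow>\<^sub>L 'b::real_normed_vector"
  assumes "\<And>\<phi>. \<phi> \<in> calV \<Longrightarrow> blinfun_apply S (V_of \<phi>) = blinfun_apply T (V_of \<phi>)"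
  shows "S = T"
proof -
  have "norm (S - T) \<le> 0"
    by (rule norm_blinfun_le_on_calV) (simp_all add: assms blinfun.diff_left)
  then show ?thesis by simp
qed

text \<open>The map is given on functions, as \<open>convect_dual\<close> is; by linearity the bound forces \<open>f \<phi>\<close> to depend
  on the point \<open>V_of \<phi>\<close> only.\<close>

lemma calV_linear_extension:
  fixes f :: "(real^3 \<Rightarrow> real^3) \<Rightarrow> 'b::banach"
  assumes add: "\<And>\<phi> \<psi>. \<phi> \<in> calV \<Longrightarrow> \<psi> \<in> calV \<Longrightarrow> f (\<lambda>x. \<phi> x + \<psi> x) = f \<phi> + f \<psi>"
    and scale: "\<And>r \<phi>. \<phi> \<in> calV \<Longrightarrow> f (\<lambda>x. r *\<^sub>R \<phi> x) = r *\<^sub>R f \<phi>"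
    and bound: "\<And>\<phi>. \<phi> \<in> calV \<Longrightarrow> norm (f \<phi>) \<le> K * norm (V_of \<phi>)" and K: "K \<ge> 0"
  shows "\<exists>T :: V \<Rightarrow>\<^sub>L 'b. (\<forall>\<phi>\<in>calV. blinfun_apply T (V_of \<phi>) = f \<phi>) \<and> norm T \<le> K"
proof -
  define R where "R = (\<lambda>\<phi>. (V_of \<phi>, f \<phi>)) ` calV"
  have R_add: "p + q \<in> R" if "p \<in> R" "q \<in> R" for p q
    using that by (auto simp: R_def V_of_add[symmetric] add[symmetric] calV_add)
  have R_scale: "r *\<^sub>R p \<in> R" if "p \<in> R" for r p
    using that by (auto simp: R_def V_of_scaleR[symmetric] scale[symmetric] calV_scaleR)
  have "(V_of (\<lambda>x. 0), f (\<lambda>x. 0)) \<in> R" unfolding R_def using calV_zero by blast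
  from R_scale[OF this, of 0] have "0 \<in> R" by (simp add: zero_prod_def)
  then have "subspace R" using R_add R_scale by (intro subspaceI)
  moreover have "closure (fst ` R) = UNIV" by (simp add: R_def image_image V_of_calV_dense)
  moreover have "norm y \<le> K * norm x" if "(x, y) \<in> R" for x y
    using that bound by (auto simp: R_def)
  ultimately have "\<exists>g. bounded_linear g \<and> (\<forall>(x, y)\<in>R. g x = y)"
    by (rule bounded_linear_extension_from_dense_graph)
  then obtain g where g: "bounded_linear g" "\<forall>(x, y)\<in>R. g x = y" by blast
  have T: "blinfun_apply (Blinfun g) (V_of \<phi>) = f \<phi>" if "\<phi> \<in> calV" for \<phi>
    using g that by (simp add: bounded_linear_Blinfun_apply R_def)
  moreover have "norm (Blinfun g) \<le> K" using T bound by (intro norm_blinfun_le_on_calV K) simp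
  ultimately show ?thesis by blast
qed

text \<open>One argument is extended at a time: for fixed \<open>\<phi>\<close> the map \<open>\<psi> \<mapsto> B(\<phi>, \<psi>)\<close> extends to a bounded
  operator from \<open>V\<close> to \<open>V'\<close>, and the operator obtained depends linearly and boundedly on \<open>\<phi>\<close>, so
  the same lemma applies to it, with values in the space of operators.\<close>

lemma convect_dual_extension:
  "\<exists>B. bounded_bilinear B \<and> (\<forall>\<phi>\<in>calV. \<forall>\<psi>\<in>calV. B (V_of \<phi>) (V_of \<psi>) = convect_dual \<phi> \<psi>)"
proof -
  obtain K :: real where K: "K \<ge> 0" "\<And>\<phi> \<psi> w. \<phi> \<in> calV \<Longrightarrow> \<psi> \<in> calV \<Longrightarrow> w \<in> calV \<Longrightarrow>
    \<bar>blinfun_apply (convect_dual \<phi> \<psi>) (V_of w)\<bar> \<le> K * norm (V_of \<phi>) * norm (V_of \<psi>) * norm (V_of w)"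
    using convect_dual_bound_on_calV by blast
  have bound: "norm (convect_dual \<phi> \<psi>) \<le> K * norm (V_of \<phi>) * norm (V_of \<psi>)"
    if "\<phi> \<in> calV" "\<psi> \<in> calV" for \<phi> \<psi>
    by (rule norm_blinfun_le_on_calV) (use K that in auto)
  have "\<exists>T :: V \<Rightarrow>\<^sub>L V_dual. (\<forall>\<psi>\<in>calV. blinfun_apply T (V_of \<psi>) = convect_dual \<phi> \<psi>)
      \<and> norm T \<le> K * norm (V_of \<phi>)" if \<phi>: "\<phi> \<in> calV" for \<phi>
    by (rule calV_linear_extension)
      (use \<phi> K(1) in \<open>simp_all add: convect_dual_add_right convect_dual_scaleR_right bound\<close>)
  then obtain G :: "_ \<Rightarrow> V \<Rightarrow>\<^sub>L V_dual" where
    G: "\<And>\<phi> \<psi>. \<phi> \<in> calV \<Longrightarrow> \<psi> \<in> calV \<Longrightarrow> blinfun_apply (G \<phi>) (V_of \<psi>) = convect_dual \<phi> \<psi>"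
      "\<And>\<phi>. \<phi> \<in> calV \<Longrightarrow> norm (G \<phi>) \<le> K * norm (V_of \<phi>)" by metis
  have "G (\<lambda>x. \<phi> x + \<phi>' x) = G \<phi> + G \<phi>'" if "\<phi> \<in> calV" "\<phi>' \<in> calV" for \<phi> \<phi>'
    using that by (intro blinfun_eq_on_calV) (simp add: G(1) calV_add blinfun.add_left convect_dual_add_left)
  moreover have "G (\<lambda>x. r *\<^sub>R \<phi> x) = r *\<^sub>R G \<phi>" if "\<phi> \<in> calV" for r \<phi>
    using that by (intro blinfun_eq_on_calV) (simp add: G(1) calV_scaleR blinfun.scaleR_left convect_dual_scaleR_left)
  ultimately obtain T :: "V \<Rightarrow>\<^sub>L V \<Rightarrow>\<^sub>L V_dual" where T: "\<And>\<phi>. \<phi> \<in> calV \<Longrightarrow> blinfun_apply T (V_of \<phi>) = G \<phi>"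
    using calV_linear_extension[of G K] G(2) K(1) by blast
  have "bounded_bilinear (\<lambda>u w. blinfun_apply (blinfun_apply T u) w)"
    by (rule bounded_bilinear.comp[OF bounded_bilinear_blinfun_apply blinfun.bounded_linear_right bounded_linear_ident])
  with T G(1) show ?thesis by (intro exI[of _ "\<lambda>u w. blinfun_apply (blinfun_apply T u) w"]) simp
qed

lemma bounded_bilinear_bilin: "bounded_bilinear bilin"
  and bilin_V_of: "\<phi> \<in> calV \<Longrightarrow> \<psi> \<in> calV \<Longrightarrow> bilin (V_of \<phi>) (V_of \<psi>) = convect_dual \<phi> \<psi>"
proof -
  have eq: "L2_dual (leray (L2_of (convect \<phi> \<psi>))) = convect_dual \<phi> \<psi>" for \<phi> \<psi>
    by (simp add: L2_dual_leray convect_dual_def)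
  obtain B where B: "bounded_bilinear B" "\<forall>\<phi>\<in>calV. \<forall>\<psi>\<in>calV. B (V_of \<phi>) (V_of \<psi>) = convect_dual \<phi> \<psi>"
    using convect_dual_extension by blast
  have "bilin = B"
    unfolding bilin_def eq
  proof (rule the_equality)
    fix B' assume B': "bounded_bilinear B' \<and> (\<forall>\<phi>\<in>calV. \<forall>\<psi>\<in>calV. B' (V_of \<phi>) (V_of \<psi>) = convect_dual \<phi> \<psi>)"
    show "B' = B"
    proof (intro ext)
      fix u w
      have right: "B' (V_of \<phi>) w = B (V_of \<phi>) w" if "\<phi> \<in> calV" for \<phi>
        by (rule continuous_eq_on_V[where f = "B' (V_of \<phi>)" and g = "B (V_of \<phi>)"])
          (use B B' that in \<open>auto intro!: linear_continuous_on bounded_bilinear.bounded_linear_right\<close>)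
      show "B' u w = B u w"
        by (rule continuous_eq_on_V[where f = "\<lambda>u. B' u w" and g = "\<lambda>u. B u w"])
          (use B B' right in \<open>auto intro!: linear_continuous_on bounded_bilinear.bounded_linear_left\<close>)
    qed
  qed (use B in blast)
  with B show "bounded_bilinear bilin"
    "\<phi> \<in> calV \<Longrightarrow> \<psi> \<in> calV \<Longrightarrow> bilin (V_of \<phi>) (V_of \<psi>) = convect_dual \<phi> \<psi>" by auto
qed

text \<open>The integral of \<open>\<partial>\<^sub>i(\<phi>\<^sub>i (\<psi> \<bullet> w))\<close> vanishes. Summed over \<open>i\<close>, the terms with a derivative of \<open>\<phi>\<^sub>i\<close>
  form the divergence of \<open>\<phi>\<close>, which is zero.\<close>

lemma convect_dual_antisymmetric:
  assumes \<phi>: "\<phi> \<in> calV" and \<psi>: "\<psi> \<in> calV" and w: "w \<in> calV"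
  shows "blinfun_apply (convect_dual \<phi> \<psi>) (V_of w) = - blinfun_apply (convect_dual \<phi> w) (V_of \<psi>)"
proof -
  note t = \<phi>[THEN calV_trig_poly] \<psi>[THEN calV_trig_poly] w[THEN calV_trig_poly]
  note c = t[THEN trig_poly_continuous] trig_poly_continuous[OF trig_poly_partial[OF t(1)]]
    trig_poly_continuous[OF trig_poly_partial[OF t(2)]] trig_poly_continuous[OF trig_poly_partial[OF t(3)]]
  note D = t[THEN trig_poly_periodic_C1, THEN periodic_C1_has_derivative]
  have zero: "(\<integral>x. (partial i \<phi> x $ i) * (\<psi> x \<bullet> w x) \<partial>torus)
      + (\<integral>x. \<phi> x $ i * (partial i \<psi> x \<bullet> w x) \<partial>torus)
      + (\<integral>x. \<phi> x $ i * (partial i w x \<bullet> \<psi> x) \<partial>torus) = 0" for i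
  proof -
    let ?f' = "\<lambda>x h. \<phi> x $ i * (\<psi> x \<bullet> frechet_derivative w (at x) h + frechet_derivative \<psi> (at x) h \<bullet> w x)
        + (frechet_derivative \<phi> (at x) h $ i) * (\<psi> x \<bullet> w x)"
    have "(\<integral>x. ?f' x (axis i 1) \<partial>torus) = 0"
    proof (rule integral_torus_derivative_eq_0[of "\<lambda>x. \<phi> x $ i * (\<psi> x \<bullet> w x)"])
      show "((\<lambda>x. \<phi> x $ i * (\<psi> x \<bullet> w x)) has_derivative ?f' x) (at x)" for x
        by (intro has_derivative_mult has_derivative_inner D
            bounded_linear.has_derivative[OF bounded_linear_vec_nth])
      show "continuous_on UNIV (\<lambda>x. ?f' x (axis i 1))"
        unfolding partial_def[symmetric] by (intro continuous_intros c)
    qed (simp add: t trig_poly_periodic)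
    also have "(\<lambda>x. ?f' x (axis i 1)) = (\<lambda>x. (partial i \<phi> x $ i) * (\<psi> x \<bullet> w x)
        + \<phi> x $ i * (partial i \<psi> x \<bullet> w x) + \<phi> x $ i * (partial i w x \<bullet> \<psi> x))"
      by (simp add: partial_def inner_commute algebra_simps)
    also have "(\<integral>x. (partial i \<phi> x $ i) * (\<psi> x \<bullet> w x)
        + \<phi> x $ i * (partial i \<psi> x \<bullet> w x) + \<phi> x $ i * (partial i w x \<bullet> \<psi> x) \<partial>torus)
      = (\<integral>x. (partial i \<phi> x $ i) * (\<psi> x \<bullet> w x) \<partial>torus)
      + (\<integral>x. \<phi> x $ i * (partial i \<psi> x \<bullet> w x) \<partial>torus)
      + (\<integral>x. \<phi> x $ i * (partial i w x \<bullet> \<psi> x) \<partial>torus)"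
      by (subst Bochner_Integration.integral_add;
          (intro Bochner_Integration.integrable_add integrable_torus_continuous continuous_intros c)?)+ simp
    finally show ?thesis .
  qed
  have div: "(\<Sum>i\<in>UNIV. \<integral>x. (partial i \<phi> x $ i) * (\<psi> x \<bullet> w x) \<partial>torus) = 0"
  proof -
    have "(\<Sum>i\<in>UNIV. \<integral>x. (partial i \<phi> x $ i) * (\<psi> x \<bullet> w x) \<partial>torus)
        = (\<integral>x. (\<Sum>i\<in>UNIV. (partial i \<phi> x $ i) * (\<psi> x \<bullet> w x)) \<partial>torus)"
      by (intro Bochner_Integration.integral_sum[symmetric] integrable_torus_continuous continuous_intros c)
    also have "\<dots> = (\<integral>x. divergence \<phi> x * (\<psi> x \<bullet> w x) \<partial>torus)"
      by (simp add: divergence_def sum_distrib_right)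
    also have "\<dots> = 0" using \<phi> by (simp add: calV_def)
    finally show ?thesis .
  qed
  have "0 = (\<Sum>i\<in>UNIV. (\<integral>x. (partial i \<phi> x $ i) * (\<psi> x \<bullet> w x) \<partial>torus)
      + (\<integral>x. \<phi> x $ i * (partial i \<psi> x \<bullet> w x) \<partial>torus)
      + (\<integral>x. \<phi> x $ i * (partial i w x \<bullet> \<psi> x) \<partial>torus))"
    by (simp add: zero)
  then show ?thesis
    by (simp add: convect_dual_apply assms sum.distrib div)
qed

lemma continuous_on_bilin:
  assumes "continuous_on S f" "continuous_on S g" "continuous_on S h"
  shows "continuous_on S (\<lambda>x. blinfun_apply (bilin (f x) (g x)) (h x))"
  by (rule bounded_bilinear.continuous_on[OF bounded_bilinear_blinfun_apply
        bounded_bilinear.continuous_on[OF bounded_bilinear_bilin assms(1,2)] assms(3)])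

lemma bilin_antisymmetric: "blinfun_apply (bilin u w) z = - blinfun_apply (bilin u z) w"
proof -
  have "blinfun_apply (bilin (V_of \<phi>) (V_of \<psi>)) z = - blinfun_apply (bilin (V_of \<phi>) z) (V_of \<psi>)"
    if "\<phi> \<in> calV" "\<psi> \<in> calV" for \<phi> \<psi>
  proof (rule continuous_eq_on_V[where f = "\<lambda>z. blinfun_apply (bilin (V_of \<phi>) (V_of \<psi>)) z"
        and g = "\<lambda>z. - blinfun_apply (bilin (V_of \<phi>) z) (V_of \<psi>)"])
    fix w assume "w \<in> calV"
    then show "blinfun_apply (bilin (V_of \<phi>) (V_of \<psi>)) (V_of w)
        = - blinfun_apply (bilin (V_of \<phi>) (V_of w)) (V_of \<psi>)"
      using that convect_dual_antisymmetric[of \<phi> \<psi> w] by (simp only: bilin_V_of)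
  qed (intro continuous_on_bilin continuous_on_minus continuous_on_const continuous_on_id)+
  note 1 = this
  have "blinfun_apply (bilin (V_of \<phi>) w) z = - blinfun_apply (bilin (V_of \<phi>) z) w"
    if \<phi>: "\<phi> \<in> calV" for \<phi>
  proof (rule continuous_eq_on_V[where f = "\<lambda>w. blinfun_apply (bilin (V_of \<phi>) w) z"
        and g = "\<lambda>w. - blinfun_apply (bilin (V_of \<phi>) z) w"])
    show "blinfun_apply (bilin (V_of \<phi>) (V_of \<psi>)) z = - blinfun_apply (bilin (V_of \<phi>) z) (V_of \<psi>)"
      if "\<psi> \<in> calV" for \<psi> by (rule 1[OF \<phi> that])
  qed (intro continuous_on_bilin continuous_on_minus continuous_on_const continuous_on_id)+
  note 2 = this
  show ?thesis
  proof (rule continuous_eq_on_V[where f = "\<lambda>u. blinfun_apply (bilin u w) z"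
        and g = "\<lambda>u. - blinfun_apply (bilin u z) w"])
    show "blinfun_apply (bilin (V_of \<phi>) w) z = - blinfun_apply (bilin (V_of \<phi>) z) w"
      if "\<phi> \<in> calV" for \<phi> by (rule 2[OF that])
  qed (intro continuous_on_bilin continuous_on_minus continuous_on_const continuous_on_id)+
qed

section \<open>The Voigt regularisation as an isomorphism\<close>

lemma voigt_coercive: "min (\<alpha>\<^sup>2) 1 * (norm u)\<^sup>2 \<le> blinfun_apply (voigt \<alpha> u) u"
proof -
  have "min (\<alpha>\<^sup>2) 1 * (norm u)\<^sup>2 = min (\<alpha>\<^sup>2) 1 * (norm (V_grad u))\<^sup>2 + min (\<alpha>\<^sup>2) 1 * (norm (V_fun u))\<^sup>2"
    by (simp add: power2_norm_eq_inner inner_V algebra_simps)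
  also have "\<dots> \<le> \<alpha>\<^sup>2 * (norm (V_grad u))\<^sup>2 + 1 * (norm (V_fun u))\<^sup>2"
    by (intro add_mono mult_right_mono) auto
  finally show ?thesis by (simp add: voigt_apply power2_norm_eq_inner)
qed

lemma voigt_symmetric: "blinfun_apply (voigt \<alpha> u) w = blinfun_apply (voigt \<alpha> w) u"
  by (simp add: voigt_apply inner_commute)

lemma bounded_bilinear_voigt: "bounded_bilinear (\<lambda>u w. blinfun_apply (voigt \<alpha> u) w)"
  by (rule bounded_bilinear.comp[OF bounded_bilinear_blinfun_apply bounded_linear_voigt bounded_linear_ident])

text \<open>Surjectivity is the Lax-Milgram lemma; coercivity gives injectivity and the bound of the inverse.\<close>

lemma voigt_inverse:
  assumes "\<alpha> \<noteq> 0"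
  obtains R where "bounded_linear R" "\<And>F. voigt \<alpha> (R F) = F" "\<And>u. R (voigt \<alpha> u) = u"
proof -
  define c where "c = min (\<alpha>\<^sup>2) 1"
  have c: "c > 0" "\<And>u. c * (norm u)\<^sup>2 \<le> blinfun_apply (voigt \<alpha> u) u"
    using assms voigt_coercive by (auto simp: c_def)
  have surj: "\<exists>u. voigt \<alpha> u = F" for F
  proof -
    have "\<exists>u\<in>UNIV. \<forall>w\<in>UNIV. blinfun_apply (voigt \<alpha> u) w = blinfun_apply F w"
      by (rule symmetric_Lax_Milgram[OF bounded_bilinear_voigt voigt_symmetric c subspace_UNIV
            complete_UNIV blinfun.bounded_linear_right])
    then show ?thesis by (auto intro: blinfun_eqI)
  qed
  have lower: "norm u \<le> norm (voigt \<alpha> u) * (1 / c)" for u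
  proof (cases "u = 0")
    case False
    have "c * (norm u)\<^sup>2 \<le> norm (voigt \<alpha> u) * norm u"
      using c(2)[of u] norm_blinfun[of "voigt \<alpha> u" u] by simp
    then show ?thesis using False c(1) by (simp add: power2_eq_square field_simps)
  qed (use c in simp)
  interpret voigt: bounded_linear "voigt \<alpha>" by (rule bounded_linear_voigt)
  have inj: "u = w" if "voigt \<alpha> u = voigt \<alpha> w" for u w
    using lower[of "u - w"] that by (simp add: voigt.diff)
  define R where "R F = (THE u. voigt \<alpha> u = F)" for F
  have R_voigt: "R (voigt \<alpha> u) = u" for u unfolding R_def using inj by blast
  have voigt_R: "voigt \<alpha> (R F) = F" for F using surj[of F] R_voigt by metis
  have "bounded_linear R"
  proof (rule bounded_linear_intro)
    show "R (F + G) = R F + R G" for F G by (rule inj) (simp add: voigt.add voigt_R)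
    show "R (r *\<^sub>R F) = r *\<^sub>R R F" for r F by (rule inj) (simp add: voigt.scaleR voigt_R)
    show "norm (R F) \<le> norm F * (1 / c)" for F using lower[of "R F"] by (simp add: voigt_R)
  qed
  with voigt_R R_voigt that show thesis by blast
qed

section \<open>The MHD-Voigt flow\<close>

text \<open>The bilinear map \<open>Q\<close> whose diagonal is the right-hand side of the system solved for \<open>(u', b')\<close>,
  where \<open>R\<close> and \<open>S\<close> stand for the inverses of the two Voigt operators.\<close>

definition mhd_field :: "(V_dual \<Rightarrow> V) \<Rightarrow> (V_dual \<Rightarrow> V) \<Rightarrow> V \<times> V \<Rightarrow> V \<times> V \<Rightarrow> V \<times> V"
  where "mhd_field R S = (\<lambda>x y. (R (bilin (snd x) (snd y) - bilin (fst x) (fst y)),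
    S (bilin (snd x) (fst y) - bilin (fst x) (snd y))))"

lemma bounded_bilinear_mhd_field:
  assumes "bounded_linear R" "bounded_linear S"
  shows "bounded_bilinear (mhd_field R S)"
  unfolding mhd_field_def
  by (intro bounded_bilinear_Pair bounded_linear_compose_bilinear[OF assms(1)]
      bounded_linear_compose_bilinear[OF assms(2)] bounded_bilinear_diff bounded_bilinear.comp[OF bounded_bilinear_bilin]
      bounded_linear_fst bounded_linear_snd)

text \<open>The transport terms vanish separately, while the Lorentz force and the stretching of the magnetic
  field exchange energy: \<open>\<langle>B(b, b), u\<rangle>\<close> and \<open>\<langle>B(b, u), b\<rangle>\<close> cancel each other.\<close>

lemma mhd_energy_flux_eq_0:
  "blinfun_apply (bilin b b - bilin u u) u + blinfun_apply (bilin b u - bilin u b) b = 0"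
  using bilin_antisymmetric[of b b u] bilin_antisymmetric[of u u u] bilin_antisymmetric[of u b b]
  by (simp add: blinfun.diff_left)

lemma mhd_flow_exists_unique:
  assumes R: "bounded_linear R" "\<And>F. voigt \<alpha> (R F) = F" and S: "bounded_linear S" "\<And>F. voigt \<beta> (S F) = F"
    and nz: "\<alpha> \<noteq> 0" "\<beta> \<noteq> 0"
  shows "\<exists>!x. x 0 = x0 \<and> (\<forall>t. (x has_vector_derivative mhd_field R S (x t) (x t)) (at t))"
proof -
  define e where "e x y = blinfun_apply (voigt \<alpha> (fst x)) (fst y) + blinfun_apply (voigt \<beta> (snd x)) (snd y)" for x y
  define c where "c = min (min (\<alpha>\<^sup>2) 1) (min (\<beta>\<^sup>2) 1)"
  show ?thesis
  proof (rule conservative_quadratic_ODE[where Q = "mhd_field R S" and e = e and c = c])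
    show "bounded_bilinear (mhd_field R S)" by (rule bounded_bilinear_mhd_field[OF R(1) S(1)])
    show "bounded_bilinear e"
      unfolding e_def
      by (intro bounded_bilinear_add bounded_bilinear.comp[OF bounded_bilinear_voigt]
          bounded_linear_fst bounded_linear_snd)
    show "e x y = e y x" for x y
      unfolding e_def using voigt_symmetric[of \<alpha>] voigt_symmetric[of \<beta>] by metis
    show "c > 0" using nz by (simp add: c_def)
    show "c * (norm x)\<^sup>2 \<le> e x x" for x
    proof -
      obtain u b where x: "x = (u, b)" by fastforce
      have "c * (norm x)\<^sup>2 = c * (norm u)\<^sup>2 + c * (norm b)\<^sup>2"
        by (simp add: x norm_Pair distrib_left)
      also have "\<dots> \<le> min (\<alpha>\<^sup>2) 1 * (norm u)\<^sup>2 + min (\<beta>\<^sup>2) 1 * (norm b)\<^sup>2"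
        by (intro add_mono mult_right_mono) (auto simp: c_def)
      also have "\<dots> \<le> e x x" using voigt_coercive[of \<alpha> u] voigt_coercive[of \<beta> b] by (simp add: e_def x)
      finally show ?thesis .
    qed
    show "e x (mhd_field R S x x) = 0" for x
      using mhd_energy_flux_eq_0[of "snd x" "fst x"]
      by (simp add: e_def mhd_field_def voigt_symmetric[of \<alpha> "fst x"] voigt_symmetric[of \<beta> "snd x"] R(2) S(2))
  qed
qed

lemma C1_differentiable_on_bounded_linear:
  assumes "bounded_linear h" "f C1_differentiable_on S"
  shows "(\<lambda>t. h (f t)) C1_differentiable_on S"
proof -
  obtain D where D: "\<forall>t\<in>S. (f has_vector_derivative D t) (at t)" "continuous_on S D"
    using assms(2) by (auto simp: C1_differentiable_on_def)
  then show ?thesis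
    unfolding C1_differentiable_on_def
    by (intro exI[of _ "\<lambda>t. h (D t)"])
      (auto intro: bounded_linear.has_vector_derivative[OF assms(1)] bounded_linear.continuous_on[OF assms(1)])
qed

theorem theorem6p2:
  fixes \<alpha> \<alpha>\<^sub>M :: real and v_in Z_in :: V_dual
  assumes "\<alpha> > 0" "\<alpha>\<^sub>M > 0"
  shows
    "(\<exists>!vZ. case vZ of (v, Z) \<Rightarrow>
        v C1_differentiable_on UNIV \<and> Z C1_differentiable_on UNIV \<and>
        (\<exists>u b. voigt_related \<alpha> \<alpha>\<^sub>M v Z u b \<and> mhd_voigt_system v_in Z_in v Z u b)) \<and>
     (\<exists>!ub. case ub of (u, b) \<Rightarrow>
        u C1_differentiable_on UNIV \<and> b C1_differentiable_on UNIV \<and>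
        (\<exists>v Z. voigt_related \<alpha> \<alpha>\<^sub>M v Z u b \<and> mhd_voigt_system v_in Z_in v Z u b)) \<and>
     (\<forall>v Z u b. voigt_related \<alpha> \<alpha>\<^sub>M v Z u b \<longrightarrow>
        (v C1_differentiable_on UNIV \<and> Z C1_differentiable_on UNIV \<longleftrightarrow>
         u C1_differentiable_on UNIV \<and> b C1_differentiable_on UNIV)) \<and>
     (\<exists>!u_in. v_in = voigt \<alpha> u_in) \<and> (\<exists>!b_in. Z_in = voigt \<alpha>\<^sub>M b_in)"
proof -
  have nz: "\<alpha> \<noteq> 0" "\<alpha>\<^sub>M \<noteq> 0" using assms by auto
  obtain R where R: "bounded_linear R" "\<And>F. voigt \<alpha> (R F) = F" "\<And>u. R (voigt \<alpha> u) = u"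
    using voigt_inverse[OF nz(1)] by blast
  obtain S where S: "bounded_linear S" "\<And>F. voigt \<alpha>\<^sub>M (S F) = F" "\<And>u. S (voigt \<alpha>\<^sub>M u) = u"
    using voigt_inverse[OF nz(2)] by blast
  note voigt' = bounded_linear.has_vector_derivative[OF bounded_linear_voigt]
  have related: "voigt_related \<alpha> \<alpha>\<^sub>M v Z u b \<longleftrightarrow> v = (\<lambda>t. voigt \<alpha> (u t)) \<and> Z = (\<lambda>t. voigt \<alpha>\<^sub>M (b t))"
    for v Z u b by (auto simp: voigt_related_def)
  \<comment> \<open>The initial value problem for \<open>(u, b)\<close> in \<open>V \<times> V\<close>, obtained by applying the inverse Voigt operators.\<close>
  define sol where "sol u b \<longleftrightarrow> u 0 = R v_in \<and> b 0 = S Z_in \<and>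
      (\<forall>t. (u has_vector_derivative R (bilin (b t) (b t) - bilin (u t) (u t))) (at t)) \<and>
      (\<forall>t. (b has_vector_derivative S (bilin (b t) (u t) - bilin (u t) (b t))) (at t))" for u b
  have system: "mhd_voigt_system v_in Z_in (\<lambda>t. voigt \<alpha> (u t)) (\<lambda>t. voigt \<alpha>\<^sub>M (b t)) u b \<longleftrightarrow> sol u b" for u b
  proof
    assume *: "mhd_voigt_system v_in Z_in (\<lambda>t. voigt \<alpha> (u t)) (\<lambda>t. voigt \<alpha>\<^sub>M (b t)) u b"
    have "u 0 = R v_in" "b 0 = S Z_in"
      using * R(3)[of "u 0"] S(3)[of "b 0"] by (auto simp: mhd_voigt_system_def)
    moreover have "(u has_vector_derivative R (bilin (b t) (b t) - bilin (u t) (u t))) (at t)" for t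
      using bounded_linear.has_vector_derivative[OF R(1), of "\<lambda>t. voigt \<alpha> (u t)"] * R(3)
      by (simp add: mhd_voigt_system_def)
    moreover have "(b has_vector_derivative S (bilin (b t) (u t) - bilin (u t) (b t))) (at t)" for t
      using bounded_linear.has_vector_derivative[OF S(1), of "\<lambda>t. voigt \<alpha>\<^sub>M (b t)"] * S(3)
      by (simp add: mhd_voigt_system_def)
    ultimately show "sol u b" by (simp add: sol_def)
  next
    assume *: "sol u b"
    have "((\<lambda>t. voigt \<alpha> (u t)) has_vector_derivative bilin (b t) (b t) - bilin (u t) (u t)) (at t)" for t
      using voigt'[of u _ _ \<alpha>] * R(2) unfolding sol_def by metis
    moreover have "((\<lambda>t. voigt \<alpha>\<^sub>M (b t)) has_vector_derivative bilin (b t) (u t) - bilin (u t) (b t)) (at t)" for t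
      using voigt'[of b _ _ \<alpha>\<^sub>M] * S(2) unfolding sol_def by metis
    ultimately show "mhd_voigt_system v_in Z_in (\<lambda>t. voigt \<alpha> (u t)) (\<lambda>t. voigt \<alpha>\<^sub>M (b t)) u b"
      using * R(2) S(2) by (simp add: mhd_voigt_system_def sol_def)
  qed
  have sol_flow: "sol u b \<longleftrightarrow> (u 0, b 0) = (R v_in, S Z_in) \<and>
      (\<forall>t. ((\<lambda>t. (u t, b t)) has_vector_derivative mhd_field R S (u t, b t) (u t, b t)) (at t))" for u b
  proof -
    have "((\<lambda>t. (u t, b t)) has_vector_derivative (p, q)) (at t) \<longleftrightarrow>
        (u has_vector_derivative p) (at t) \<and> (b has_vector_derivative q) (at t)" for p q t
      using bounded_linear.has_vector_derivative[OF bounded_linear_fst, of "\<lambda>t. (u t, b t)" "(p, q)" "at t"]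
        bounded_linear.has_vector_derivative[OF bounded_linear_snd, of "\<lambda>t. (u t, b t)" "(p, q)" "at t"]
      by (auto intro: has_vector_derivative_Pair)
    then show ?thesis by (auto simp: sol_def mhd_field_def)
  qed
  obtain x where x: "x 0 = (R v_in, S Z_in)"
      "\<And>t. (x has_vector_derivative mhd_field R S (x t) (x t)) (at t)"
    and x_unique: "\<And>y. y 0 = (R v_in, S Z_in) \<Longrightarrow>
      (\<And>t. (y has_vector_derivative mhd_field R S (y t) (y t)) (at t)) \<Longrightarrow> y = x"
    using mhd_flow_exists_unique[OF R(1,2) S(1,2) nz, of "(R v_in, S Z_in)"] by (elim ex1E) blast
  define u b where "u t = fst (x t)" and "b t = snd (x t)" for t
  have sol: "sol u b" using x by (simp add: sol_flow u_def b_def)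
  have sol_unique: "u' = u \<and> b' = b" if "sol u' b'" for u' b'
  proof -
    have "(\<lambda>t. (u' t, b' t)) = x" using that by (intro x_unique) (auto simp: sol_flow)
    then have "x t = (u' t, b' t)" for t by (simp add: fun_eq_iff)
    then show ?thesis by (simp add: u_def b_def fun_eq_iff)
  qed
  have C1: "u C1_differentiable_on UNIV" "b C1_differentiable_on UNIV"
  proof -
    have d: "\<And>t. (u has_vector_derivative R (bilin (b t) (b t) - bilin (u t) (u t))) (at t)"
      "\<And>t. (b has_vector_derivative S (bilin (b t) (u t) - bilin (u t) (b t))) (at t)"
      using sol by (auto simp: sol_def)
    have c: "continuous_on UNIV u" "continuous_on UNIV b"
      by (rule has_vector_derivative_imp_continuous_on[OF d(1)], rule has_vector_derivative_imp_continuous_on[OF d(2)])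
    have "continuous_on UNIV (\<lambda>t. R (bilin (b t) (b t) - bilin (u t) (u t)))"
      by (intro bounded_linear.continuous_on[OF R(1)] continuous_on_diff bounded_bilinear.continuous_on[OF bounded_bilinear_bilin] c)
    with d(1) show "u C1_differentiable_on UNIV"
      unfolding C1_differentiable_on_def by (intro exI conjI ballI)
    have "continuous_on UNIV (\<lambda>t. S (bilin (b t) (u t) - bilin (u t) (b t)))"
      by (intro bounded_linear.continuous_on[OF S(1)] continuous_on_diff bounded_bilinear.continuous_on[OF bounded_bilinear_bilin] c)
    with d(2) show "b C1_differentiable_on UNIV"
      unfolding C1_differentiable_on_def by (intro exI conjI ballI)
  qed
  have C1_iff: "(\<lambda>t. voigt \<alpha> (u t)) C1_differentiable_on UNIV \<longleftrightarrow> u C1_differentiable_on UNIV"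
    "(\<lambda>t. voigt \<alpha>\<^sub>M (b t)) C1_differentiable_on UNIV \<longleftrightarrow> b C1_differentiable_on UNIV" for u b
    using C1_differentiable_on_bounded_linear[OF bounded_linear_voigt, of u UNIV \<alpha>]
      C1_differentiable_on_bounded_linear[OF R(1), of "\<lambda>t. voigt \<alpha> (u t)" UNIV]
      C1_differentiable_on_bounded_linear[OF bounded_linear_voigt, of b UNIV \<alpha>\<^sub>M]
      C1_differentiable_on_bounded_linear[OF S(1), of "\<lambda>t. voigt \<alpha>\<^sub>M (b t)" UNIV]
    by (auto simp: R(3) S(3))
  show ?thesis
  proof (intro conjI)
    show "\<exists>!vZ. case vZ of (v, Z) \<Rightarrow>
        v C1_differentiable_on UNIV \<and> Z C1_differentiable_on UNIV \<and>
        (\<exists>u b. voigt_related \<alpha> \<alpha>\<^sub>M v Z u b \<and> mhd_voigt_system v_in Z_in v Z u b)"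
    proof (rule ex1I[of _ "(\<lambda>t. voigt \<alpha> (u t), \<lambda>t. voigt \<alpha>\<^sub>M (b t))"])
      show "case (\<lambda>t. voigt \<alpha> (u t), \<lambda>t. voigt \<alpha>\<^sub>M (b t)) of (v, Z) \<Rightarrow>
        v C1_differentiable_on UNIV \<and> Z C1_differentiable_on UNIV \<and>
        (\<exists>u b. voigt_related \<alpha> \<alpha>\<^sub>M v Z u b \<and> mhd_voigt_system v_in Z_in v Z u b)"
        using C1 sol system related by (auto simp: C1_iff)
    next
      fix vZ
      assume *: "case vZ of (v, Z) \<Rightarrow>
        v C1_differentiable_on UNIV \<and> Z C1_differentiable_on UNIV \<and>
        (\<exists>u b. voigt_related \<alpha> \<alpha>\<^sub>M v Z u b \<and> mhd_voigt_system v_in Z_in v Z u b)"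
      obtain v Z where vZ: "vZ = (v, Z)" by fastforce
      with * obtain u' b' where "voigt_related \<alpha> \<alpha>\<^sub>M v Z u' b'" "mhd_voigt_system v_in Z_in v Z u' b'" by auto
      then show "vZ = (\<lambda>t. voigt \<alpha> (u t), \<lambda>t. voigt \<alpha>\<^sub>M (b t))"
        using sol_unique[of u' b'] system[of u' b'] by (auto simp: related vZ)
    qed
    show "\<exists>!ub. case ub of (u, b) \<Rightarrow>
        u C1_differentiable_on UNIV \<and> b C1_differentiable_on UNIV \<and>
        (\<exists>v Z. voigt_related \<alpha> \<alpha>\<^sub>M v Z u b \<and> mhd_voigt_system v_in Z_in v Z u b)"
    proof (rule ex1I[of _ "(u, b)"])
      fix ub
      assume *: "case ub of (u, b) \<Rightarrow>
        u C1_differentiable_on UNIV \<and> b C1_differentiable_on UNIV \<and>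
        (\<exists>v Z. voigt_related \<alpha> \<alpha>\<^sub>M v Z u b \<and> mhd_voigt_system v_in Z_in v Z u b)"
      obtain u' b' where ub: "ub = (u', b')" by fastforce
      with * have "sol u' b'" by (auto simp: related system)
      then show "ub = (u, b)" using sol_unique[of u' b'] ub by simp
    qed (use C1 sol in \<open>simp add: related system\<close>)
    show "\<forall>v Z u b. voigt_related \<alpha> \<alpha>\<^sub>M v Z u b \<longrightarrow>
        (v C1_differentiable_on UNIV \<and> Z C1_differentiable_on UNIV \<longleftrightarrow>
         u C1_differentiable_on UNIV \<and> b C1_differentiable_on UNIV)"
      by (simp add: related C1_iff)
    show "\<exists>!u_in. v_in = voigt \<alpha> u_in" using R(2,3) by metis
    show "\<exists>!b_in. Z_in = voigt \<alpha>\<^sub>M b_in" using S(2,3) by metis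
  qed
qed

end
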